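(* Let $\Omega$ be an open bounded polygonal domain of $\mathbb{R}^2$. Let $p,q$ be real numbers such that either $1\le p<2$ and $1\le q\le p^*=\frac{2p}{2-p}$, or $p\ge 2$ and $1\le q<+\infty$. Then there exists a constant $C>0$ depending only on $p$, $q$ and $\Omega$ such that, for every DDFV mesh $\mathcal{T}=(\overline{\mathfrak{M}},\overline{\mathfrak{M}^*},\mathfrak{D})$ of $\Omega$ satisfying the regularity conditions (R1) with parameter $\alpha_{\mathcal{T}}$ and (R2) with parameter $\zeta$ (defined in the context), $$\|u\|_{0,q,\mathcal{T}}\le \frac{C}{(\sin\alpha_{\mathcal{T}})^{1/p}\,\zeta^{(p-1)/p}}\,\|u\|_{1,p,\mathcal{T}}\qquad\text{for all }u\in Z(\mathcal{T}).$$
   Context: Standing assumption: $\Omega$ is a Lipschitz domain. $\mathrm{m}$ denotes area (2D Lebesgue measure) or length. DDFV mesh. The interior primal mesh $\mathfrak{M}$ is a finite partition of $\Omega$ (up to a null set) into disjoint open polygonal control volumes $\mathcal{K}$, each with a center $x_{\mathcal{K}}\in\mathcal{K}$. $\partial\mathfrak{M}$ is the set of boundary edges, considered as degenerate control volumes, each with a center $x_{\mathcal{K}}$ on the edge. The primal mesh is $\overline{\mathfrak{M}}=\mathfrak{M}\cup\partial\mathfrak{M}$. The dual mesh $\overline{\mathfrak{M}^*}$ is obtained by connecting the centers of the primal mesh: to each vertex $x_{\mathcal{K}^*}$ of the primal mesh is associated the polygonal dual cell $\mathcal{K}^*$ around it whose vertices are the centers $x_{\mathcal{K}}$ of the $\mathcal{K}\in\overline{\mathfrak{M}}$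 having $x_{\mathcal{K}^*}$ as a vertex (together with $x_{\mathcal{K}^*}$ itself when $x_{\mathcal{K}^*}\in\partial\Omega$). $\mathfrak{M}^*$ (resp. $\partial\mathfrak{M}^*$) is the set of dual cells whose vertex $x_{\mathcal{K}^*}$ is interior to $\Omega$ (resp. on $\partial\Omega$), and $\overline{\mathfrak{M}^*}=\mathfrak{M}^*\cup\partial\mathfrak{M}^*$ is also a partition of $\Omega$. Each primal cell $\mathcal{K}\in\mathfrak{M}$ is assumed star-shaped with respect to $x_{\mathcal{K}}$ and each dual cell $\mathcal{K}^*$ star-shaped with respect to $x_{\mathcal{K}^*}$. To each primal edge $\sigma=\mathcal{K}|\mathcal{L}$ (with endpoints $x_{\mathcal{K}^*},x_{\mathcal{L}^*}$; if $\sigma\subset\partial\Omega$, $\mathcal{L}\in\partial\mathfrak{M}$ is the degenerate volume $\sigma$) corresponds the dual edge $\sigma^*=\mathcal{K}^*|\mathcal{L}^*$, the segment joining $x_{\mathcal{K}}$ and $x_{\mathcal{L}}$. The diamond $\mathcal{D}=\mathcal{D}_{\sigma,\sigma^*}$ is the quadrilateral with diagonals $\sigma$ and $\sigma^*$, i.e. with vertices $x_{\mathcal{K}},x_{\mathcal{K}^*},x_{\mathcal{L}},x_{\mathcal{L}^*}$ (degenerating into a triangle if $\sigma\subset\partial\Omega$). The set $\mathfrak{D}$ of diamonds is a partition of $\Omega$. For $V$ a primal or dual cell, $\mathfrak{D}_V$ is the set of diamonds $\mathcal{D}_{\sigma,\sigma^*}$ such that $\sigma$ (if $V$ is primal) or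 $\sigma^*$ (if $V$ is dual) is an edge of $V$. $\alpha_{\mathcal{D}}$ is the angle between the lines $(x_{\mathcal{K}},x_{\mathcal{L}})$ and $(x_{\mathcal{K}^*},x_{\mathcal{L}^*})$, so $2\mathrm{m}(\mathcal{D})=\mathrm{m}(\sigma)\mathrm{m}(\sigma^* )\sin\alpha_{\mathcal{D}}$. Regularity conditions. (R1): $\alpha_{\mathcal{T}}\in(0,\pi/2]$ and $|\sin\alpha_{\mathcal{D}}|\ge\sin\alpha_{\mathcal{T}}$ for all $\mathcal{D}\in\mathfrak{D}$. (R2): $\zeta>0$, $\sum_{\mathcal{D}_{\sigma,\sigma^*}\in\mathfrak{D}_{\mathcal{K}}}\mathrm{m}(\sigma)\mathrm{m}(\sigma^* )\le \mathrm{m}(\mathcal{K})/\zeta$ for all $\mathcal{K}\in\mathfrak{M}$, and $\sum_{\mathcal{D}_{\sigma,\sigma^*}\in\mathfrak{D}_{\mathcal{K}^*}}\mathrm{m}(\sigma)\mathrm{m}(\sigma^* )\le \mathrm{m}(\mathcal{K}^* )/\zeta$ for all $\mathcal{K}^*\in\overline{\mathfrak{M}^*}$. Discrete functions. $Z(\mathcal{T})$ is the set of functions $u=\frac12(u_{\mathfrak{M}}+u_{\overline{\mathfrak{M}^*}})$ with $u_{\mathfrak{M}}=\sum_{\mathcal{K}\in\mathfrak{M}}u_{\mathcal{K}}\mathbf{1}_{\mathcal{K}}$ and $u_{\overline{\mathfrak{M}^*}}=\sum_{\mathcal{K}^*\in\overline{\mathfrak{M}^*}}u_{\mathcal{K}^*}\mathbf{1}_{\mathcal{K}^*}$,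 where $u_{\mathcal{T}}=((u_{\mathcal{K}})_{\mathcal{K}\in\overline{\mathfrak{M}}},(u_{\mathcal{K}^*})_{\mathcal{K}^*\in\overline{\mathfrak{M}^*}})$ are real discrete unknowns; $u$ is understood as given together with $u_{\mathcal{T}}$, and the quantities below are computed from $u_{\mathcal{T}}$. For $p\in[1,\infty)$, $$\|u\|_{0,p,\mathcal{T}}^p=\tfrac12\|u_{\mathfrak{M}}\|_{L^p(\Omega)}^p+\tfrac12\|u_{\overline{\mathfrak{M}^*}}\|_{L^p(\Omega)}^p.$$ For $\mathcal{D}=\mathcal{D}_{\sigma,\sigma^*}\in\mathfrak{D}$ the discrete gradient is $$\nabla^{\mathcal{D}}u=\frac{1}{\sin\alpha_{\mathcal{D}}}\Big(\frac{u_{\mathcal{L}}-u_{\mathcal{K}}}{\mathrm{m}(\sigma^* )}\mathbf{n}_{\sigma\mathcal{K}}+\frac{u_{\mathcal{L}^*}-u_{\mathcal{K}^*}}{\mathrm{m}(\sigma)}\mathbf{n}_{\sigma^*\mathcal{K}^*}\Big),$$ where $\mathbf{n}_{\sigma\mathcal{K}}$ is the unit normal to $\sigma$ outward $\mathcal{K}$ and $\mathbf{n}_{\sigma^*\mathcal{K}^*}$ the unit normal to $\sigma^*$ outward $\mathcal{K}^*$; equivalently, its component along the unit vector from $x_{\mathcal{K}}$ to $x_{\mathcal{L}}$ is $(u_{\mathcal{L}}-u_{\mathcal{K}})/\mathrm{m}(\sigma^* )$ and its component along the unit vector from $x_{\mathcal{K}^*}$ to $x_{\mathcal{L}^*}$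 is $(u_{\mathcal{L}^*}-u_{\mathcal{K}^*})/\mathrm{m}(\sigma)$. Finally $$|u|_{1,p,\mathcal{T}}=\Big(\sum_{\mathcal{D}\in\mathfrak{D}}\mathrm{m}(\mathcal{D})|\nabla^{\mathcal{D}}u|^p\Big)^{1/p},\qquad \|u\|_{1,p,\mathcal{T}}=\|u\|_{0,p,\mathcal{T}}+|u|_{1,p,\mathcal{T}}.$$ *)

theory Defs
  imports "HOL-Analysis.Analysis"
begin

type_synonym plane = "real^2"

subsection \<open>Domains\<close>

definition polygonal_domain :: "plane set \<Rightarrow> bool" where
  "polygonal_domain \<Omega> \<longleftrightarrow>
     open \<Omega> \<and> connected \<Omega> \<and> \<Omega> \<noteq> {} \<and> bounded \<Omega> \<and>
     (\<exists>S. finite S \<and> frontier \<Omega> = (\<Union>(a, b)\<in>S. closed_segment a b))"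

text \<open>Near each boundary point, in suitable orthonormal coordinates \<open>(s, t)\<close> centred at that point,
  the set is the strict epigraph of a Lipschitz function. Necessarily \<open>\<phi> 0 = 0\<close>.\<close>

definition lipschitz_domain :: "plane set \<Rightarrow> bool" where
  "lipschitz_domain \<Omega> \<longleftrightarrow>
     open \<Omega> \<and> connected \<Omega> \<and> \<Omega> \<noteq> {} \<and>
     (\<forall>x\<in>frontier \<Omega>. \<exists>e1 e2 r h L \<phi>.
        norm e1 = 1 \<and> norm e2 = 1 \<and> e1 \<bullet> e2 = 0 \<and> 0 < r \<and> 0 < h \<and>
        L-lipschitz_on {-r<..<r} \<phi> \<and>
        (\<forall>s\<in>{-r<..<r}. \<forall>t\<in>{-h<..<h}.
           x + s *\<^sub>R e1 + t *\<^sub>R e2 \<in> \<Omega> \<longleftrightarrow> \<phi> s < t))"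

subsection \<open>Polygons\<close>

definition polygon_edge :: "plane list \<Rightarrow> nat \<Rightarrow> plane set" where
  "polygon_edge vs i = closed_segment (vs ! i) (vs ! (Suc i mod length vs))"

text \<open>Flat angles are allowed, so a polygon may have additional vertices in the middle of a
  geometric side. This covers nonconforming primal meshes.\<close>

definition simple_polygon :: "plane list \<Rightarrow> bool" where
  "simple_polygon vs \<longleftrightarrow>
     3 \<le> length vs \<and> distinct vs \<and>
     (\<forall>i<length vs. \<forall>j<length vs. i \<noteq> j \<longrightarrow>
        polygon_edge vs i \<inter> polygon_edge vs j
          \<subseteq> {vs ! i, vs ! (Suc i mod length vs)} \<inter> {vs ! j, vs ! (Suc j mod length vs)})"

definition open_polygon :: "plane set \<Rightarrow> plane set set \<Rightarrow> bool" where
  "open_polygon V E \<longleftrightarrow>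
     (\<exists>vs. simple_polygon vs \<and> E = polygon_edge vs ` {..<length vs} \<and> V = inside (\<Union>E))"

text \<open>The reference point \<open>x\<close> may lie on the boundary of the open set \<open>V\<close>, as it does for
  boundary dual cells; hence open segments.\<close>

definition star_shaped_wrt :: "plane set \<Rightarrow> plane \<Rightarrow> bool" where
  "star_shaped_wrt V x \<longleftrightarrow> (\<forall>y\<in>V. open_segment x y \<subseteq> V)"

definition outward_normal :: "plane set \<Rightarrow> plane set \<Rightarrow> plane" where
  "outward_normal s V =
     (THE n. norm n = 1 \<and> (\<forall>x\<in>s. \<forall>y\<in>s. n \<bullet> (y - x) = 0) \<and>
        (\<forall>x\<in>rel_interior s. \<forall>\<^sub>F t in at_right 0. x - t *\<^sub>R n \<in> V \<and> x + t *\<^sub>R n \<notin> V))"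

definition line_angle :: "plane \<Rightarrow> plane \<Rightarrow> real" where
  "line_angle d e = arccos (\<bar>d \<bullet> e\<bar> / (norm d * norm e))"

subsection \<open>DDFV meshes\<close>

text \<open>Control volumes are sets: open polygons for interior ones, closed segments (the boundary
  edges) for degenerate ones; \<open>center\<close> is used on both. Dual cells are indexed by
  their vertex. Each edge carries a labelling: \<open>cellK\<close>, \<open>cellL\<close> are the two primal control volumes
  \<open>K\<close>, \<open>L\<close> it separates and \<open>vertK\<close>, \<open>vertL\<close> its endpoints \<open>x\<^sub>K\<^sub>*\<close>, \<open>x\<^sub>L\<^sub>*\<close>. The order in each pair is
  arbitrary (on the boundary, \<open>cellL\<close> is the degenerate volume).\<close>

record ddfv =
  cells :: "plane set set"
  edges :: "plane set set"
  center :: "plane set \<Rightarrow> plane"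
  cellK :: "plane set \<Rightarrow> plane set"
  cellL :: "plane set \<Rightarrow> plane set"
  vertK :: "plane set \<Rightarrow> plane"
  vertL :: "plane set \<Rightarrow> plane"

definition vertices :: "ddfv \<Rightarrow> plane set" where
  "vertices T = vertK T ` edges T \<union> vertL T ` edges T"

definition boundary_edges :: "plane set \<Rightarrow> ddfv \<Rightarrow> plane set set" where
  "boundary_edges \<Omega> T = {\<sigma> \<in> edges T. \<sigma> \<subseteq> frontier \<Omega>}"

definition cell_edges :: "ddfv \<Rightarrow> plane set \<Rightarrow> plane set set" where
  "cell_edges T K = {\<sigma> \<in> edges T. \<sigma> \<subseteq> frontier K}"

definition dual_edge :: "ddfv \<Rightarrow> plane set \<Rightarrow> plane set" where
  "dual_edge T \<sigma> = closed_segment (center T (cellK T \<sigma>)) (center T (cellL T \<sigma>))"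

text \<open>The sides of the dual cell at \<open>v\<close>: the segments joining centers of primal volumes adjacent
  through an edge at \<open>v\<close>, and, if \<open>v\<close> is a boundary vertex, the segments joining \<open>v\<close> to the centers
  of the boundary edges at \<open>v\<close> (a trivial segment is not a side).\<close>

definition dual_cell_edges :: "plane set \<Rightarrow> ddfv \<Rightarrow> plane \<Rightarrow> plane set set" where
  "dual_cell_edges \<Omega> T v =
     dual_edge T ` {\<sigma> \<in> edges T. v \<in> {vertK T \<sigma>, vertL T \<sigma>}} \<union>
     (\<lambda>\<sigma>. closed_segment v (center T \<sigma>)) `
       {\<sigma> \<in> boundary_edges \<Omega> T. v \<in> {vertK T \<sigma>, vertL T \<sigma>} \<and> center T \<sigma> \<noteq> v}"

definition dual_cell :: "plane set \<Rightarrow> ddfv \<Rightarrow> plane \<Rightarrow> plane set" where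
  "dual_cell \<Omega> T v = inside (\<Union>(dual_cell_edges \<Omega> T v))"

text \<open>Star-shapedness of the primal and dual cells forces the diagonals of a diamond to cross, so
  the quadrilateral with these diagonals is the (closed) convex hull of its vertices.\<close>

definition diamond :: "ddfv \<Rightarrow> plane set \<Rightarrow> plane set" where
  "diamond T \<sigma> =
     convex hull {center T (cellK T \<sigma>), vertK T \<sigma>, center T (cellL T \<sigma>), vertL T \<sigma>}"

text \<open>Partitions are understood up to null sets.\<close>

definition ddfv_mesh :: "plane set \<Rightarrow> ddfv \<Rightarrow> bool" where
  "ddfv_mesh \<Omega> T \<longleftrightarrow>
     \<comment> \<open>primal mesh\<close>
     finite (cells T) \<and> pairwise disjnt (cells T) \<and>
     (\<forall>K\<in>cells T. K \<subseteq> \<Omega> \<and> open_polygon K (cell_edges T K) \<and>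
        center T K \<in> K \<and> star_shaped_wrt K (center T K)) \<and>
     negligible (\<Omega> - \<Union>(cells T)) \<and>
     \<comment> \<open>primal edges\<close>
     finite (edges T) \<and>
     (\<forall>\<sigma>\<in>edges T.
        vertK T \<sigma> \<noteq> vertL T \<sigma> \<and> \<sigma> = closed_segment (vertK T \<sigma>) (vertL T \<sigma>) \<and>
        cellK T \<sigma> \<in> cells T \<and> \<sigma> \<subseteq> frontier (cellK T \<sigma>) \<and>
        (if \<sigma> \<in> boundary_edges \<Omega> T
         then cellL T \<sigma> = \<sigma> \<and> center T \<sigma> \<in> \<sigma>
         else cellL T \<sigma> \<in> cells T \<and> cellL T \<sigma> \<noteq> cellK T \<sigma> \<and> \<sigma> \<subseteq> frontier (cellL T \<sigma>))) \<and>
     \<comment> \<open>dual mesh\<close>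
     disjoint_family_on (dual_cell \<Omega> T) (vertices T) \<and>
     (\<forall>v\<in>vertices T. dual_cell \<Omega> T v \<subseteq> \<Omega> \<and>
        open_polygon (dual_cell \<Omega> T v) (dual_cell_edges \<Omega> T v) \<and>
        (v \<in> \<Omega> \<longrightarrow> v \<in> dual_cell \<Omega> T v) \<and> star_shaped_wrt (dual_cell \<Omega> T v) v) \<and>
     negligible (\<Omega> - (\<Union>v\<in>vertices T. dual_cell \<Omega> T v)) \<and>
     \<comment> \<open>diamonds\<close>
     disjoint_family_on (\<lambda>\<sigma>. interior (diamond T \<sigma>)) (edges T) \<and>
     (\<forall>\<sigma>\<in>edges T. diamond T \<sigma> \<subseteq> closure \<Omega>) \<and>
     negligible (\<Omega> - (\<Union>\<sigma>\<in>edges T. diamond T \<sigma>))"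

definition edge_length :: "ddfv \<Rightarrow> plane set \<Rightarrow> real" where
  "edge_length T \<sigma> = dist (vertK T \<sigma>) (vertL T \<sigma>)"

definition dual_edge_length :: "ddfv \<Rightarrow> plane set \<Rightarrow> real" where
  "dual_edge_length T \<sigma> = dist (center T (cellK T \<sigma>)) (center T (cellL T \<sigma>))"

definition diamond_angle :: "ddfv \<Rightarrow> plane set \<Rightarrow> real" where
  "diamond_angle T \<sigma> =
     line_angle (center T (cellL T \<sigma>) - center T (cellK T \<sigma>)) (vertL T \<sigma> - vertK T \<sigma>)"

definition regular_R1 :: "ddfv \<Rightarrow> real \<Rightarrow> bool" where
  "regular_R1 T \<alpha> \<longleftrightarrow>
     0 < \<alpha> \<and> \<alpha> \<le> pi / 2 \<and> (\<forall>\<sigma>\<in>edges T. sin \<alpha> \<le> \<bar>sin (diamond_angle T \<sigma>)\<bar>)"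

definition regular_R2 :: "plane set \<Rightarrow> ddfv \<Rightarrow> real \<Rightarrow> bool" where
  "regular_R2 \<Omega> T \<zeta> \<longleftrightarrow>
     0 < \<zeta> \<and>
     (\<forall>K\<in>cells T.
        (\<Sum>\<sigma>\<in>cell_edges T K. edge_length T \<sigma> * dual_edge_length T \<sigma>)
          \<le> measure lebesgue K / \<zeta>) \<and>
     (\<forall>v\<in>vertices T.
        (\<Sum>\<sigma> | \<sigma> \<in> edges T \<and> dual_edge T \<sigma> \<in> dual_cell_edges \<Omega> T v.
           edge_length T \<sigma> * dual_edge_length T \<sigma>)
          \<le> measure lebesgue (dual_cell \<Omega> T v) / \<zeta>)"

subsection \<open>Discrete functions and norms\<close>

text \<open>The discrete unknowns, on primal control volumes and on dual cells (identified with their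
  vertices). Values off the mesh are irrelevant to everything below.\<close>

type_synonym unknowns = "(plane set \<Rightarrow> real) \<times> (plane \<Rightarrow> real)"

definition primal_part :: "ddfv \<Rightarrow> unknowns \<Rightarrow> plane \<Rightarrow> real" where
  "primal_part T u x = (\<Sum>K\<in>cells T. fst u K * indicat_real K x)"

definition dual_part :: "plane set \<Rightarrow> ddfv \<Rightarrow> unknowns \<Rightarrow> plane \<Rightarrow> real" where
  "dual_part \<Omega> T u x = (\<Sum>v\<in>vertices T. snd u v * indicat_real (dual_cell \<Omega> T v) x)"

definition Lp_norm :: "plane set \<Rightarrow> real \<Rightarrow> (plane \<Rightarrow> real) \<Rightarrow> real" where
  "Lp_norm \<Omega> p f = (LINT x:\<Omega>|lebesgue. \<bar>f x\<bar> powr p) powr (1 / p)"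

definition norm0 :: "plane set \<Rightarrow> ddfv \<Rightarrow> real \<Rightarrow> unknowns \<Rightarrow> real" where
  "norm0 \<Omega> T p u =
     (1/2 * Lp_norm \<Omega> p (primal_part T u) powr p +
      1/2 * Lp_norm \<Omega> p (dual_part \<Omega> T u) powr p) powr (1 / p)"

definition discrete_grad :: "plane set \<Rightarrow> ddfv \<Rightarrow> unknowns \<Rightarrow> plane set \<Rightarrow> plane" where
  "discrete_grad \<Omega> T u \<sigma> =
     (1 / sin (diamond_angle T \<sigma>)) *\<^sub>R
       (((fst u (cellL T \<sigma>) - fst u (cellK T \<sigma>)) / dual_edge_length T \<sigma>) *\<^sub>R
          outward_normal \<sigma> (cellK T \<sigma>) +
        ((snd u (vertL T \<sigma>) - snd u (vertK T \<sigma>)) / edge_length T \<sigma>) *\<^sub>R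
          outward_normal (dual_edge T \<sigma>) (dual_cell \<Omega> T (vertK T \<sigma>)))"

definition seminorm1 :: "plane set \<Rightarrow> ddfv \<Rightarrow> real \<Rightarrow> unknowns \<Rightarrow> real" where
  "seminorm1 \<Omega> T p u =
     (\<Sum>\<sigma>\<in>edges T. measure lebesgue (diamond T \<sigma>) * norm (discrete_grad \<Omega> T u \<sigma>) powr p)
       powr (1 / p)"

definition norm1 :: "plane set \<Rightarrow> ddfv \<Rightarrow> real \<Rightarrow> unknowns \<Rightarrow> real" where
  "norm1 \<Omega> T p u = norm0 \<Omega> T p u + seminorm1 \<Omega> T p u"

end

theory Submission
  imports Defs
begin

text \<open>The inequality is the Sobolev inequality for functions of bounded variation in the plane, applied
to powers of the two piecewise constant functions that make up \<open>u\<close>.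

If \<open>w\<close> is nonnegative and piecewise constant on a polygonal partition of \<open>\<Omega>\<close>, then
\[ \|w\|_{L^2(\Omega)} \le C \Big( \|w\|_{L^1(\Omega)} + \sum_\sigma \mathrm{m}(\sigma) |[w]_\sigma| \Big), \]
where the sum is over the edges inside \<open>\<Omega>\<close> and \<open>[w]\<close> is the jump (\<open>piecewise_constant_sobolev\<close>). For
the proof, cover \<open>\<Omega>\<close> by finitely many open sets \<open>U\<close>, each with two independent directions \<open>e\<close> and
\<open>f\<close> such that a short segment in either direction, starting at a point of \<open>U \<inter> \<Omega>\<close>, stays in \<open>\<Omega>\<close>; a
Lipschitz domain has such a cover (\<open>lipschitz_domain_local_directions\<close>). At \<open>x \<in> U \<inter> \<Omega>\<close>, the value
\<open>w x\<close> is at most the mean of \<open>w\<close> over the segment from \<open>x\<close> in direction \<open>e\<close> plus the jumps met on the way,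
hence at most a quantity \<open>G\<close> that depends only on the line through \<open>x\<close> in direction \<open>e\<close>. With \<open>H\<close> for
the direction \<open>f\<close> this gives \<open>w\<^sup>2 \<le> G H\<close>, and in oblique coordinates the integral of \<open>G H\<close>
is a product of two one-dimensional integrals, each bounded by a multiple of the right-hand side.
The function is never extended beyond \<open>\<Omega>\<close>, so that no boundary values enter.

For \<open>w = \<bar>u\<bar>\<^sup>s\<close> the jump is at most \<open>s\<close> times the jump of \<open>u\<close> times the sum of the values of \<open>\<bar>u\<bar>\<close> to the
power \<open>s - 1\<close> on both sides. The jump of \<open>u\<close> is the dual edge length times a component of the discrete
gradient. Hoelder's inequality with weights \<open>m(\<sigma>) m(\<sigma>\<^sup>*)\<close> separates the gradient from the powers
of \<open>u\<close>; condition (R1) turns the weights of the gradient into areas of diamonds, and (R2) turns the other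
weights into areas of cells, which produces the factor \<open>\<zeta>\<close> to the power \<open>- (p - 1) / p\<close>. After division by
a power of the norm of \<open>u\<close> the claim follows for the exponent \<open>2 s\<close> (\<open>sobolev_from_power_one\<close>). If \<open>p < 2\<close>, the
choice \<open>s = p / (2 - p)\<close> gives the critical exponent; if \<open>p \<ge> 2\<close>, every \<open>s > 1\<close> is admissible. Smaller exponents
follow because \<open>\<Omega>\<close> has finite area. The constant in front of the lower order term can be absorbed, because
(R2) forces \<open>\<zeta> \<le> 1 / 2\<close> (\<open>regularity_parameter_le\<close>).

The dual mesh is treated in the same way, with the roles of edges and dual edges exchanged. What
the geometry has to supply is that exactly two cells meet at an interior point of an edge and that
the outward normals in the discrete gradient are well defined. Both follow from the Jordan
curve theorem, by which a polygon lies on exactly one side of each of its edges.\<close>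

section \<open>Polygons and the Jordan curve theorem\<close>

lemma simple_polygon_edges_Int:
  "simple_polygon vs \<Longrightarrow> i < length vs \<Longrightarrow> j < length vs \<Longrightarrow> i \<noteq> j \<Longrightarrow>
   polygon_edge vs i \<inter> polygon_edge vs j
     \<subseteq> {vs ! i, vs ! (Suc i mod length vs)} \<inter> {vs ! j, vs ! (Suc j mod length vs)}"
  unfolding simple_polygon_def by blast

lemma simple_polygon_nth_eq_iff:
  "simple_polygon vs \<Longrightarrow> i < length vs \<Longrightarrow> j < length vs \<Longrightarrow> vs ! i = vs ! j \<longleftrightarrow> i = j"
  by (simp add: simple_polygon_def nth_eq_iff_index_eq)

lemma polygon_chain_arc:
  assumes vs: "simple_polygon vs" and k: "1 \<le> k" "k < length vs"
  shows "\<exists>g. arc g \<and> pathstart g = vs ! 0 \<and> pathfinish g = vs ! k \<and>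
             path_image g = (\<Union>i<k. polygon_edge vs i)"
  using k
proof (induction k rule: nat_induct_at_least)
  case base
  then have "vs ! 0 \<noteq> vs ! 1"
    using simple_polygon_nth_eq_iff[OF vs, of 0 1] by (cases vs) auto
  with base show ?case
    by (intro exI[of _ "linepath (vs ! 0) (vs ! 1)"]) (auto simp: polygon_edge_def)
next
  case (Suc k)
  then obtain g where g: "arc g" "pathstart g = vs ! 0" "pathfinish g = vs ! k"
      "path_image g = (\<Union>i<k. polygon_edge vs i)" by auto
  have dis: "vs ! i = vs ! j \<longleftrightarrow> i = j" if "i < length vs" "j < length vs" for i j
    using simple_polygon_nth_eq_iff[OF vs] that by simp
  have edge: "polygon_edge vs k = closed_segment (vs ! k) (vs ! Suc k)"
    using Suc.prems by (simp add: polygon_edge_def)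
  have "polygon_edge vs i \<inter> polygon_edge vs k \<subseteq> {vs ! k}" if "i < k" for i
  proof -
    have "polygon_edge vs i \<inter> polygon_edge vs k
        \<subseteq> {vs ! i, vs ! (Suc i mod length vs)} \<inter> {vs ! k, vs ! (Suc k mod length vs)}"
      using that Suc.prems by (intro simple_polygon_edges_Int[OF vs]) auto
    also have "\<dots> \<subseteq> {vs ! k}"
      using that Suc.prems by (auto simp: dis)
    finally show ?thesis .
  qed
  then have "arc (g +++ linepath (vs ! k) (vs ! Suc k))"
    using g Suc.prems edge by (intro arc_join) (auto simp: dis arc_linepath)
  then show ?case
    using g edge by (intro exI[of _ "g +++ linepath (vs ! k) (vs ! Suc k)"])
      (auto simp: path_image_join lessThan_Suc)
qed

text \<open>The sides of a simple polygon can be traversed by a closed path without self-intersections, so that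
the Jordan-Brouwer theorem applies to their union.\<close>

lemma simple_polygon_homeomorphic_circle:
  assumes vs: "simple_polygon vs"
  shows "(\<Union>(polygon_edge vs ` {..<length vs})) homeomorphic sphere (0::plane) 1"
proof -
  define n where "n = length vs - 1"
  have n: "length vs = Suc n" "2 \<le> n"
    using vs by (auto simp: simple_polygon_def n_def)
  obtain g where g: "arc g" "pathstart g = vs ! 0" "pathfinish g = vs ! n"
      "path_image g = (\<Union>i<n. polygon_edge vs i)"
    using polygon_chain_arc[OF vs, of n] n by auto
  have edge: "polygon_edge vs n = closed_segment (vs ! n) (vs ! 0)"
    using n by (simp add: polygon_edge_def)
  have ne: "vs ! n \<noteq> vs ! 0"
    using simple_polygon_nth_eq_iff[OF vs, of n 0] n by simp
  have "polygon_edge vs i \<inter> polygon_edge vs n \<subseteq> {vs ! n, vs ! 0}" if "i < n" for i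
  proof -
    have "polygon_edge vs i \<inter> polygon_edge vs n
        \<subseteq> {vs ! i, vs ! (Suc i mod length vs)} \<inter> {vs ! n, vs ! (Suc n mod length vs)}"
      using that n by (intro simple_polygon_edges_Int[OF vs]) auto
    then show ?thesis using n by auto
  qed
  then have "simple_path (g +++ linepath (vs ! n) (vs ! 0))"
    using g edge ne by (intro simple_path_join_loop) (auto simp: arc_linepath)
  moreover have "path_image (g +++ linepath (vs ! n) (vs ! 0))
      = \<Union>(polygon_edge vs ` {..<length vs})"
    using g edge n by (auto simp: path_image_join lessThan_Suc)
  ultimately have "(\<Union>(polygon_edge vs ` {..<length vs})) homeomorphic sphere (0::complex) 1"
    using homeomorphic_simple_path_image_circle[of "g +++ linepath (vs ! n) (vs ! 0)" 1 0] g by simp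
  also have "sphere (0::complex) 1 homeomorphic sphere (0::plane) 1"
    by (rule homeomorphic_spheres_gen) auto
  finally show ?thesis .
qed

text \<open>Every component of the complement of the curve has the whole curve as its boundary. Since the
complement is disconnected and its unbounded component is unique, there are a component inside
and a component outside.\<close>

lemma frontier_inside_outside_circle:
  fixes S :: "'a::euclidean_space set"
  assumes S: "S homeomorphic sphere (0::'a) 1" and 2: "2 \<le> DIM('a)"
  shows "frontier (inside S) = S" "frontier (outside S) = S"
proof -
  have "compact S"
    using S homeomorphic_compactness compact_sphere by blast
  then have S': "closed S" "bounded S" by (auto simp: compact_imp_closed compact_imp_bounded)
  have "\<not> connected (- S)"
    using Jordan_Brouwer_separation[OF S] by simp
  then obtain c where c: "c \<in> components (- S)" "bounded c"
    using cobounded_has_bounded_component[of "- S"] S' 2 by auto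
  have "\<exists>d\<in>components (- S). \<not> bounded d"
    using cobounded_unbounded_components[of "- S"] S' by auto
  then obtain d where d: "d \<in> components (- S)" "\<not> bounded d" by blast
  have "frontier c = S" "frontier d = S"
    using Jordan_Brouwer_frontier[OF S _ 2] c d by auto
  moreover have "c \<subseteq> inside S"
  proof
    fix x assume "x \<in> c"
    then have "x \<notin> S"
      using in_components_subset[OF c(1)] by blast
    obtain y where "c = connected_component_set (- S) y"
      using c(1) by (auto simp: components_def)
    then have "connected_component_set (- S) x = c"
      using connected_component_eq \<open>x \<in> c\<close> by blast
    then show "x \<in> inside S" using \<open>x \<notin> S\<close> c(2) by (simp add: inside_def)
  qed
  moreover have "d \<subseteq> outside S"
  proof
    fix x assume "x \<in> d"
    then have "x \<notin> S"
      using in_components_subset[OF d(1)] by blast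
    obtain y where "d = connected_component_set (- S) y"
      using d(1) by (auto simp: components_def)
    then have "connected_component_set (- S) x = d"
      using connected_component_eq \<open>x \<in> d\<close> by blast
    then show "x \<in> outside S" using \<open>x \<notin> S\<close> d(2) by (simp add: outside_def)
  qed
  ultimately have "S \<subseteq> closure (inside S)" "S \<subseteq> closure (outside S)"
    using closure_mono[of c "inside S"] closure_mono[of d "outside S"] by (auto simp: frontier_def)
  moreover have "open (inside S)" "open (outside S)"
    using S' by (auto simp: open_inside open_outside)
  ultimately show "frontier (inside S) = S" "frontier (outside S) = S"
    using frontier_inside_subset[OF S'(1)] frontier_outside_subset[OF S'(1)]
      inside_no_overlap[of S] outside_no_overlap[of S]
    unfolding frontier_def by (simp_all only: interior_open) blast+
qed

lemma open_polygon_frontier: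
  assumes "open_polygon V E"
  shows "finite E" "open V" "bounded V" "frontier V = \<Union>E" "frontier (outside (\<Union>E)) = \<Union>E"
    "V = inside (\<Union>E)" "closed (\<Union>E)"
proof -
  obtain vs where vs: "simple_polygon vs" "E = polygon_edge vs ` {..<length vs}" "V = inside (\<Union>E)"
    using assms by (auto simp: open_polygon_def)
  note hom = simple_polygon_homeomorphic_circle[OF vs(1), folded vs(2)]
  show "finite E" using vs by simp
  show "V = inside (\<Union>E)" by fact
  show "frontier V = \<Union>E" "frontier (outside (\<Union>E)) = \<Union>E"
    using frontier_inside_outside_circle[OF hom] vs(3) by auto
  have "compact (\<Union>E)"
    using hom homeomorphic_compactness compact_sphere by blast
  then show "open V" "bounded V" "closed (\<Union>E)"
    using vs(3) by (auto simp: compact_imp_closed compact_imp_bounded open_inside bounded_inside)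
qed

lemma open_polygon_edges:
  assumes "open_polygon V E" "s \<in> E"
  obtains a b where "a \<noteq> b" "s = closed_segment a b"
    "\<And>s'. s' \<in> E \<Longrightarrow> s' \<noteq> s \<Longrightarrow> s' \<inter> s \<subseteq> {a, b}"
proof -
  obtain vs where vs: "simple_polygon vs" "E = polygon_edge vs ` {..<length vs}"
    using assms by (auto simp: open_polygon_def)
  obtain i where i: "i < length vs" "s = polygon_edge vs i" using assms vs by auto
  let ?a = "vs ! i" let ?b = "vs ! (Suc i mod length vs)"
  have "Suc i mod length vs \<noteq> i"
    using vs(1) i unfolding simple_polygon_def
    by (cases "Suc i = length vs") auto
  moreover have "Suc i mod length vs < length vs" using i by (intro mod_less_divisor) auto
  ultimately have "?a \<noteq> ?b"
    using simple_polygon_nth_eq_iff[OF vs(1)] i by auto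
  moreover have "s = closed_segment ?a ?b" using i by (simp add: polygon_edge_def)
  moreover have "s' \<inter> s \<subseteq> {?a, ?b}" if "s' \<in> E" "s' \<noteq> s" for s'
  proof -
    obtain j where j: "j < length vs" "s' = polygon_edge vs j"
      using \<open>s' \<in> E\<close> vs(2) by blast
    then have "j \<noteq> i" using that i by auto
    then show ?thesis
      using simple_polygon_edges_Int[OF vs(1), of j i] i j by blast
  qed
  ultimately show ?thesis using that by blast
qed

section \<open>Sides and normals of a polygon\<close>

text \<open>The quarter turn of the plane. The inner product of \<open>rot x\<close> and \<open>y\<close> is the cross product of \<open>x\<close>
and \<open>y\<close>, and in this form it serves for areas, for unit normals and as a Jacobian determinant.\<close>

definition rot :: "plane \<Rightarrow> plane" where
  "rot x = vector [- x $ 2, x $ 1]"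

lemma rot_inner: "rot x \<bullet> y = x $ 1 * y $ 2 - x $ 2 * y $ 1"
  by (simp add: rot_def inner_vec_def sum_2)

lemma inner_plane: "(x::plane) \<bullet> y = x $ 1 * y $ 1 + x $ 2 * y $ 2"
  by (simp add: inner_vec_def sum_2)

lemma rot_inner_self [simp]: "rot x \<bullet> x = 0"
  by (simp add: rot_inner)

lemma norm_rot [simp]: "norm (rot x) = norm x"
  unfolding norm_eq_sqrt_inner by (simp add: inner_plane rot_def)

text \<open>Cosine and sine squared add up to 1.\<close>

lemma rot_inner_squared: "(rot x \<bullet> y)\<^sup>2 + (x \<bullet> y)\<^sup>2 = (norm x)\<^sup>2 * (norm y)\<^sup>2"
  unfolding power2_norm_eq_inner rot_inner
  unfolding inner_plane by (simp add: power2_eq_square algebra_simps)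

lemma rot_inner_eq_0_imp:
  assumes "rot x \<bullet> y = 0" "x \<noteq> 0"
  shows "\<exists>c. y = c *\<^sub>R x"
proof -
  have nz: "x \<bullet> x \<noteq> 0" using assms by simp
  have "y = ((x \<bullet> y) / (x \<bullet> x)) *\<^sub>R x"
  proof -
    have "(x \<bullet> x) *\<^sub>R y = (x \<bullet> y) *\<^sub>R x"
      using assms(1) unfolding vec_eq_iff forall_2 rot_inner
      unfolding inner_plane by (auto simp: algebra_simps)
    then have "(1 / (x \<bullet> x)) *\<^sub>R ((x \<bullet> x) *\<^sub>R y) = (1 / (x \<bullet> x)) *\<^sub>R ((x \<bullet> y) *\<^sub>R x)"
      by simp
    with nz show ?thesis by simp
  qed
  then show ?thesis by blast
qed

lemma unit_normal_eq:
  assumes "norm n = 1" "n \<bullet> x = 0" "x \<noteq> 0"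
  shows "n = (1 / norm x) *\<^sub>R rot x \<or> n = - (1 / norm x) *\<^sub>R rot x"
proof -
  have "rot (rot x) \<bullet> n = 0" using assms(2)
    by (simp add: rot_inner inner_plane) (simp add: rot_def algebra_simps)
  moreover have "rot x \<noteq> 0" using assms(3) norm_rot[of x] by (metis norm_eq_zero)
  ultimately obtain c where c: "n = c *\<^sub>R rot x" using rot_inner_eq_0_imp by blast
  with assms(1) have "\<bar>c\<bar> * norm x = 1" by simp
  with assms(3) have "\<bar>c\<bar> = 1 / norm x" by (simp add: field_simps)
  then have "c = 1 / norm x \<or> c = - (1 / norm x)" by linarith
  with c show ?thesis by auto
qed

text \<open>Near \<open>z\<close>, the set \<open>V\<close> is exactly the side of the line through \<open>z\<close> normal to \<open>n\<close> away from which \<open>n\<close>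
points. The points on the line itself are left open.\<close>

definition lies_below :: "plane set \<Rightarrow> plane \<Rightarrow> plane \<Rightarrow> bool" where
  "lies_below V n z \<longleftrightarrow>
     (\<exists>\<epsilon>>0. \<forall>y\<in>ball z \<epsilon>. (n \<bullet> (y - z) < 0 \<longrightarrow> y \<in> V) \<and> (0 < n \<bullet> (y - z) \<longrightarrow> y \<notin> V))"

lemma convex_half_disc: "convex {y \<in> ball z \<epsilon>. 0 < (n::plane) \<bullet> (y - z)}"
proof -
  have "{y \<in> ball z \<epsilon>. 0 < n \<bullet> (y - z)} = ball z \<epsilon> \<inter> {y. n \<bullet> y > n \<bullet> z}"
    by (auto simp: inner_diff_right)
  then show ?thesis by (simp add: convex_Int convex_halfspace_gt)
qed

lemma half_disc_side:
  assumes fr: "frontier V = C" and dis: "ball z \<epsilon> \<inter> C \<subseteq> {y. n \<bullet> (y - z) = 0}"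
  shows "{y \<in> ball z \<epsilon>. 0 < (n::plane) \<bullet> (y - z)} \<subseteq> V \<or> {y \<in> ball z \<epsilon>. 0 < n \<bullet> (y - z)} \<inter> V = {}"
proof (rule ccontr)
  let ?H = "{y \<in> ball z \<epsilon>. 0 < n \<bullet> (y - z)}"
  assume "\<not> (?H \<subseteq> V \<or> ?H \<inter> V = {})"
  then have "?H \<inter> frontier V \<noteq> {}"
    by (intro connected_Int_frontier convex_connected convex_half_disc) auto
  then show False using fr dis by force
qed

lemma segment_perp:
  assumes x: "x \<in> closed_segment a b" and y: "y \<in> closed_segment a b" and n: "n \<bullet> (b - a) = 0"
  shows "n \<bullet> (y - x) = 0"
proof -
  obtain u where u: "x = (1 - u) *\<^sub>R a + u *\<^sub>R b" using x by (auto simp: in_segment)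
  obtain v where v: "y = (1 - v) *\<^sub>R a + v *\<^sub>R b" using y by (auto simp: in_segment)
  have "y - x = (v - u) *\<^sub>R (b - a)" unfolding u v by (simp add: algebra_simps)
  then show ?thesis using n by simp
qed

lemma segment_line_ball:
  fixes a b z :: plane
  assumes "z \<in> open_segment a b" "n \<bullet> (b - a) = 0" "norm n = 1"
  obtains \<epsilon> where "\<epsilon> > 0" "\<And>y. y \<in> ball z \<epsilon> \<Longrightarrow> n \<bullet> (y - z) = 0 \<Longrightarrow> y \<in> closed_segment a b"
proof -
  have ab: "a \<noteq> b" using assms(1) by auto
  obtain u where u: "0 < u" "u < 1" "z = (1 - u) *\<^sub>R a + u *\<^sub>R b"
    using assms(1) by (auto simp: in_segment)
  define \<epsilon> where "\<epsilon> = min u (1 - u) * norm (b - a)"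
  have "\<epsilon> > 0" using u ab by (simp add: \<epsilon>_def)
  moreover have "y \<in> closed_segment a b" if y: "y \<in> ball z \<epsilon>" "n \<bullet> (y - z) = 0" for y
  proof -
    have "rot (b - a) \<bullet> (y - z) = 0"
      using unit_normal_eq[OF assms(3) assms(2)] ab y(2) by auto
    then obtain c where c: "y - z = c *\<^sub>R (b - a)"
      using rot_inner_eq_0_imp[of "b - a" "y - z"] ab by auto
    have "\<bar>c\<bar> * norm (b - a) < min u (1 - u) * norm (b - a)"
      using y(1) c by (metis \<epsilon>_def dist_commute dist_norm mem_ball norm_scaleR)
    then have "\<bar>c\<bar> < min u (1 - u)" using ab by simp
    moreover have "y = (1 - (u + c)) *\<^sub>R a + (u + c) *\<^sub>R b"
      using c u(3) by (simp add: algebra_simps)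
    ultimately show ?thesis unfolding in_segment by (intro exI[of _ "u + c"]) auto
  qed
  ultimately show ?thesis using that by blast
qed

text \<open>Near an interior point of one of its sides, a polygon is a half-disc: the two open
  half-discs cut out by the side do not meet the boundary curve, so each of them lies inside or
  outside, and by the Jordan curve theorem the point is in the closure of both regions.\<close>

lemma open_polygon_lies_below:
  assumes P: "open_polygon V E" and s: "closed_segment a b \<in> E" and z: "z \<in> open_segment a b"
  shows "\<exists>n. norm n = 1 \<and> n \<bullet> (b - a) = 0 \<and> lies_below V n z"
proof -
  note fr = open_polygon_frontier[OF P]
  have ab: "a \<noteq> b" using z by auto
  define n where "n = (1 / norm (b - a)) *\<^sub>R rot (b - a)"
  have n: "norm n = 1" "n \<bullet> (b - a) = 0" using ab by (auto simp: n_def)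
  have zs: "z \<in> \<Union>E" using s z open_closed_segment by blast
  have rest: "z \<notin> \<Union>(E - {closed_segment a b})"
  proof -
    obtain a' b' where ab': "closed_segment a b = closed_segment a' b'"
      "\<And>s'. s' \<in> E \<Longrightarrow> s' \<noteq> closed_segment a b \<Longrightarrow> s' \<inter> closed_segment a b \<subseteq> {a', b'}"
      using open_polygon_edges[OF P s] by metis
    then have "{a', b'} = {a, b}" by auto
    moreover have "z \<notin> {a, b}" "z \<in> closed_segment a b" using z by (auto simp: open_segment_def)
    ultimately show ?thesis using ab'(2) by blast
  qed
  have "closed t" if "t \<in> E" for t
    using open_polygon_edges[OF P that] by (metis closed_segment)
  then have "closed (\<Union>(E - {closed_segment a b}))" using fr(1) by blast
  then have "open (- \<Union>(E - {closed_segment a b}))" by (simp add: open_Compl)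
  then obtain \<epsilon>1 where "\<epsilon>1 > 0" "ball z \<epsilon>1 \<subseteq> - \<Union>(E - {closed_segment a b})"
    using rest by (meson ComplI openE)
  then have e1: "\<epsilon>1 > 0" "ball z \<epsilon>1 \<inter> \<Union>(E - {closed_segment a b}) = {}" by blast+
  obtain \<epsilon>2 where e2: "\<epsilon>2 > 0" "\<And>y. y \<in> ball z \<epsilon>2 \<Longrightarrow> n \<bullet> (y - z) = 0 \<Longrightarrow> y \<in> closed_segment a b"
    using segment_line_ball[OF z n(2) n(1)] by blast
  define \<epsilon> where "\<epsilon> = min \<epsilon>1 \<epsilon>2"
  have e: "\<epsilon> > 0" using e1 e2 by (simp add: \<epsilon>_def)
  have line: "n \<bullet> (y - z) = 0" if "y \<in> closed_segment a b" for y
    using segment_perp[OF _ that n(2)] z open_closed_segment by blast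
  have C: "ball z \<epsilon> \<inter> \<Union>E \<subseteq> {y. n \<bullet> (y - z) = 0}"
  proof clarify
    fix y t assume y: "y \<in> ball z \<epsilon>" "y \<in> t" "t \<in> E"
    then have "y \<in> ball z \<epsilon>1" by (simp add: \<epsilon>_def)
    then have "t = closed_segment a b" using e1(2) y by blast
    then show "n \<bullet> (y - z) = 0" using line y by blast
  qed
  then have C': "ball z \<epsilon> \<inter> \<Union>E \<subseteq> {y. (- n) \<bullet> (y - z) = 0}" by auto
  let ?P = "{y \<in> ball z \<epsilon>. 0 < n \<bullet> (y - z)}"
  let ?N = "{y \<in> ball z \<epsilon>. 0 < (- n) \<bullet> (y - z)}"
  let ?O = "outside (\<Union>E)"
  have cover: "y \<in> ?P \<or> y \<in> ?N" if "y \<in> ball z \<epsilon>" "y \<notin> \<Union>E" for y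
    using that e2(2)[of y] s by (force simp: \<epsilon>_def)
  have meets: "\<exists>y\<in>ball z \<epsilon>. y \<in> W \<and> y \<notin> \<Union>E"
    if "frontier W = \<Union>E" "W \<inter> \<Union>E = {}" for W
  proof -
    have "z \<in> closure W" using that(1) zs by (auto simp: frontier_def)
    then show ?thesis using e that(2)
      by (metis closure_approachable disjoint_iff dist_commute mem_ball)
  qed
  have VO: "V \<inter> ?O = {}" "V \<inter> \<Union>E = {}" "?O \<inter> \<Union>E = {}"
    using fr(6) inside_Int_outside[of "\<Union>E"] inside_no_overlap[of "\<Union>E"] outside_no_overlap[of "\<Union>E"]
    by auto
  obtain yV where yV: "yV \<in> ball z \<epsilon>" "yV \<in> V" "yV \<notin> \<Union>E" using meets[OF fr(4)] VO by blast
  obtain yO where yO: "yO \<in> ball z \<epsilon>" "yO \<in> ?O" "yO \<notin> \<Union>E" using meets[OF fr(5)] VO by blast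
  note sP = half_disc_side[OF fr(4) C] and sN = half_disc_side[OF fr(4) C']
  have sides: "(?P \<subseteq> V \<and> ?N \<inter> V = {}) \<or> (?N \<subseteq> V \<and> ?P \<inter> V = {})"
    using sP sN cover[OF yV(1,3)] cover[OF yO(1,3)] yV yO VO(1) by blast
  then show ?thesis
  proof
    assume *: "?P \<subseteq> V \<and> ?N \<inter> V = {}"
    have "lies_below V (- n) z" unfolding lies_below_def
      using e * by (intro exI[of _ \<epsilon>]) auto
    then show ?thesis using n by (intro exI[of _ "- n"]) auto
  next
    assume *: "?N \<subseteq> V \<and> ?P \<inter> V = {}"
    have "lies_below V n z" unfolding lies_below_def
      using e * by (intro exI[of _ \<epsilon>]) auto
    then show ?thesis using n by (intro exI[of _ n]) auto
  qed
qed

text \<open>The side on which the polygon lies is the same all along the edge, because it is locally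
  constant there.\<close>

lemma open_polygon_side:
  assumes P: "open_polygon V E" and s: "closed_segment a b \<in> E" and ab: "a \<noteq> b"
  obtains n where "norm n = 1" "n \<bullet> (b - a) = 0" "\<And>z. z \<in> open_segment a b \<Longrightarrow> lies_below V n z"
proof -
  define m where "m = (1 / norm (b - a)) *\<^sub>R rot (b - a)"
  have m: "norm m = 1" "m \<bullet> (b - a) = 0" using ab by (auto simp: m_def)
  have side: "lies_below V m z \<or> lies_below V (- m) z" if "z \<in> open_segment a b" for z
    using open_polygon_lies_below[OF P s that] unit_normal_eq[of _ "b - a"] ab
    by (auto simp: m_def)
  have not_both: "\<not> (lies_below V m z \<and> lies_below V (- m) z)" for z
  proof
    assume "lies_below V m z \<and> lies_below V (- m) z"
    then obtain d e where d: "d > 0" "\<And>y. y \<in> ball z d \<Longrightarrow> m \<bullet> (y - z) < 0 \<Longrightarrow> y \<in> V"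
      and e: "e > 0" "\<And>y. y \<in> ball z e \<Longrightarrow> m \<bullet> (y - z) < 0 \<Longrightarrow> y \<notin> V"
      unfolding lies_below_def by auto
    define y where "y = z - (min d e / 2) *\<^sub>R m"
    have "m \<bullet> (y - z) < 0" "y \<in> ball z d" "y \<in> ball z e"
      using d(1) e(1) m(1) by (auto simp: y_def dist_norm dot_square_norm)
    with d(2) e(2) show False by blast
  qed
  have loc: "\<exists>\<epsilon>>0. \<forall>z'\<in>open_segment a b. dist z' z < \<epsilon> \<longrightarrow> lies_below V n z'"
    if z: "z \<in> open_segment a b" "lies_below V n z" "n \<bullet> (b - a) = 0" for n z
  proof -
    obtain d where d: "d > 0"
      "\<And>y. y \<in> ball z d \<Longrightarrow> (n \<bullet> (y - z) < 0 \<longrightarrow> y \<in> V) \<and> (0 < n \<bullet> (y - z) \<longrightarrow> y \<notin> V)"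
      using z(2) unfolding lies_below_def by blast
    have "lies_below V n z'" if z': "z' \<in> open_segment a b" "dist z' z < d" for z'
    proof -
      have "n \<bullet> (z' - z) = 0"
        using segment_perp[OF _ _ z(3)] z' z(1) open_closed_segment by blast
      then have eq: "n \<bullet> (y - z') = n \<bullet> (y - z)" for y
        by (simp add: inner_diff_right)
      have "ball z' (d - dist z' z) \<subseteq> ball z d"
        by (simp add: ball_subset_ball_iff)
      then show ?thesis
        unfolding lies_below_def eq using d z'(2) by (intro exI[of _ "d - dist z' z"]) auto
    qed
    then show ?thesis using d(1) by blast
  qed
  let ?S = "open_segment a b"
  let ?A = "{z \<in> ?S. lies_below V m z}" and ?B = "{z \<in> ?S. lies_below V (- m) z}"
  have "openin (top_of_set ?S) ?A" "openin (top_of_set ?S) ?B"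
    unfolding openin_euclidean_subtopology_iff using loc m(2)
    by (fastforce simp: dist_commute)+
  moreover have "connected ?S" by (simp add: convex_connected)
  moreover have "?S \<subseteq> ?A \<union> ?B" "?A \<inter> ?B = {}" using side not_both by auto
  ultimately have "?A = {} \<or> ?B = {}"
    unfolding connected_openin by blast
  then have "(\<forall>z\<in>?S. lies_below V (- m) z) \<or> (\<forall>z\<in>?S. lies_below V m z)"
    using side by blast
  then show ?thesis using that[of m] that[of "- m"] m by auto
qed

lemma lies_below_normal:
  assumes "lies_below V n z" "norm n = 1"
  shows "\<forall>\<^sub>F t in at_right 0. z - t *\<^sub>R n \<in> V \<and> z + t *\<^sub>R n \<notin> V"
proof -
  obtain d where d: "d > 0"
    "\<And>y. y \<in> ball z d \<Longrightarrow> (n \<bullet> (y - z) < 0 \<longrightarrow> y \<in> V) \<and> (0 < n \<bullet> (y - z) \<longrightarrow> y \<notin> V)"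
    using assms(1) unfolding lies_below_def by blast
  have "z - t *\<^sub>R n \<in> V \<and> z + t *\<^sub>R n \<notin> V" if "0 < t" "t < d" for t
    using d(2)[of "z - t *\<^sub>R n"] d(2)[of "z + t *\<^sub>R n"] that assms(2)
    by (simp add: dist_norm dot_square_norm)
  then show ?thesis
    unfolding eventually_at_right_field using d(1) by blast
qed

text \<open>The description that defines the outward normal has exactly one solution, so that the
  outward normal is a unit normal of the edge.\<close>

lemma outward_normal_polygon:
  assumes P: "open_polygon V E" and s: "closed_segment a b \<in> E" and ab: "a \<noteq> b"
  shows "norm (outward_normal (closed_segment a b) V) = 1"
    and "outward_normal (closed_segment a b) V \<bullet> (b - a) = 0"
proof -
  let ?s = "closed_segment a b"
  obtain n where n: "norm n = 1" "n \<bullet> (b - a) = 0" "\<And>z. z \<in> open_segment a b \<Longrightarrow> lies_below V n z"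
    using open_polygon_side[OF P s ab] by blast
  define Q where "Q = (\<lambda>n. norm n = 1 \<and> (\<forall>x\<in>?s. \<forall>y\<in>?s. n \<bullet> (y - x) = 0) \<and>
        (\<forall>x\<in>rel_interior ?s. \<forall>\<^sub>F t in at_right 0. x - t *\<^sub>R n \<in> V \<and> x + t *\<^sub>R n \<notin> V))"
  have ri: "rel_interior ?s = open_segment a b" using ab by (simp add: rel_interior_closed_segment)
  note perp = segment_perp[OF _ _ n(2)]
  have Qn: "Q n" unfolding Q_def ri using n perp lies_below_normal by blast
  have "m = n" if m: "Q m" for m
  proof (rule ccontr)
    assume "m \<noteq> n"
    have "m \<bullet> (b - a) = 0" "norm m = 1" using m by (auto simp: Q_def)
    then have mn: "m = - n"
      using unit_normal_eq[of m "b - a"] unit_normal_eq[of n "b - a"] n ab \<open>m \<noteq> n\<close> by auto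
    have z: "midpoint a b \<in> open_segment a b" using ab by simp
    have "\<forall>\<^sub>F t in at_right 0. midpoint a b + t *\<^sub>R n \<in> V"
      using m z unfolding Q_def ri mn by (force elim: eventually_mono)
    moreover have "\<forall>\<^sub>F t in at_right 0. midpoint a b + t *\<^sub>R n \<notin> V"
      using Qn z unfolding Q_def ri by (force elim: eventually_mono)
    ultimately have "\<forall>\<^sub>F t in at_right (0::real). False"
      by eventually_elim simp
    then show False by simp
  qed
  then have "outward_normal ?s V = n"
    unfolding outward_normal_def using Qn unfolding Q_def by (intro the_equality) blast+
  then show "norm (outward_normal ?s V) = 1" "outward_normal ?s V \<bullet> (b - a) = 0"
    using n by auto
qed

section \<open>Adjacent polygons\<close>

text \<open>Two disjoint polygons cannot lie on the same side of a common edge, so each of the two half-discs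
at an interior point of the edge belongs to one of them.\<close>

lemma polygons_sharing_edge:
  assumes P1: "open_polygon V1 E1" and P2: "open_polygon V2 E2" and dis: "V1 \<inter> V2 = {}"
    and s: "closed_segment a b \<in> E1" "closed_segment a b \<in> E2" and z: "z \<in> open_segment a b"
  obtains n \<epsilon> where "norm n = 1" "n \<bullet> (b - a) = 0" "\<epsilon> > 0"
    "\<And>y. y \<in> ball z \<epsilon> \<Longrightarrow> n \<bullet> (y - z) < 0 \<Longrightarrow> y \<in> V1"
    "\<And>y. y \<in> ball z \<epsilon> \<Longrightarrow> 0 < n \<bullet> (y - z) \<Longrightarrow> y \<in> V2"
    "\<And>y. y \<in> ball z \<epsilon> \<Longrightarrow> n \<bullet> (y - z) = 0 \<Longrightarrow> y \<in> closed_segment a b"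
proof -
  have ab: "b - a \<noteq> 0" using z by auto
  obtain n where n: "norm n = 1" "n \<bullet> (b - a) = 0" "lies_below V1 n z"
    using open_polygon_lies_below[OF P1 s(1) z] by blast
  obtain m where m: "norm m = 1" "m \<bullet> (b - a) = 0" "lies_below V2 m z"
    using open_polygon_lies_below[OF P2 s(2) z] by blast
  obtain d where d: "d > 0" "\<And>y. y \<in> ball z d \<Longrightarrow> n \<bullet> (y - z) < 0 \<Longrightarrow> y \<in> V1"
    using n(3) unfolding lies_below_def by blast
  obtain e where e: "e > 0" "\<And>y. y \<in> ball z e \<Longrightarrow> m \<bullet> (y - z) < 0 \<Longrightarrow> y \<in> V2"
    using m(3) unfolding lies_below_def by blast
  \<comment> \<open>With equal normals, both polygons would contain the points just below \<open>z\<close>.\<close>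
  have "m \<noteq> n"
  proof
    assume "m = n"
    define y where "y = z - (min d e / 2) *\<^sub>R n"
    have "n \<bullet> (y - z) < 0" "y \<in> ball z d" "y \<in> ball z e"
      using d(1) e(1) n(1) by (auto simp: y_def dist_norm dot_square_norm)
    with d(2) e(2) \<open>m = n\<close> dis show False by blast
  qed
  then have mn: "m = - n"
    using unit_normal_eq[OF n(1,2) ab] unit_normal_eq[OF m(1,2) ab] by auto
  obtain r where r: "r > 0" "\<And>y. y \<in> ball z r \<Longrightarrow> n \<bullet> (y - z) = 0 \<Longrightarrow> y \<in> closed_segment a b"
    using segment_line_ball[OF z n(2,1)] by blast
  show ?thesis
    by (rule that[of n "min d (min e r)"]) (use n d e r mn in auto)
qed

lemma polygons_sharing_edge_cover:
  assumes "open_polygon V1 E1" "open_polygon V2 E2" "V1 \<inter> V2 = {}"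
    and "closed_segment a b \<in> E1" "closed_segment a b \<in> E2" "z \<in> open_segment a b"
  shows "\<exists>\<epsilon>>0. ball z \<epsilon> \<subseteq> V1 \<union> V2 \<union> closed_segment a b"
proof -
  obtain n \<epsilon> where "\<epsilon> > 0"
    "\<And>y. y \<in> ball z \<epsilon> \<Longrightarrow> n \<bullet> (y - z) < 0 \<Longrightarrow> y \<in> V1"
    "\<And>y. y \<in> ball z \<epsilon> \<Longrightarrow> 0 < n \<bullet> (y - z) \<Longrightarrow> y \<in> V2"
    "\<And>y. y \<in> ball z \<epsilon> \<Longrightarrow> n \<bullet> (y - z) = 0 \<Longrightarrow> y \<in> closed_segment a b"
    using polygons_sharing_edge[OF assms] by metis
  then show ?thesis by (intro exI[of _ \<epsilon>]) (metis UnCI linorder_neqE_linordered_idom subsetI)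
qed

section \<open>Areas and gradients of diamonds\<close>

lemma sin_line_angle:
  assumes "d \<noteq> 0" "e \<noteq> 0"
  shows "norm d * norm e * sin (line_angle d e) = \<bar>rot d \<bullet> e\<bar>"
proof -
  have c: "\<bar>d \<bullet> e\<bar> / (norm d * norm e) \<le> 1"
    using Cauchy_Schwarz_ineq2[of d e] assms by simp
  have c0: "0 \<le> \<bar>d \<bullet> e\<bar> / (norm d * norm e)" by simp
  have "sin (line_angle d e) = sqrt (1 - (\<bar>d \<bullet> e\<bar> / (norm d * norm e))\<^sup>2)"
    unfolding line_angle_def using c c0 by (intro sin_arccos) linarith+
  then have "norm d * norm e * sin (line_angle d e)
      = sqrt ((norm d * norm e)\<^sup>2 * (1 - (\<bar>d \<bullet> e\<bar> / (norm d * norm e))\<^sup>2))"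
    using assms by (simp add: real_sqrt_mult)
  also have "(norm d * norm e)\<^sup>2 * (1 - (\<bar>d \<bullet> e\<bar> / (norm d * norm e))\<^sup>2)
      = (norm d)\<^sup>2 * (norm e)\<^sup>2 - (d \<bullet> e)\<^sup>2"
    using assms by (simp add: field_simps power_mult_distrib)
  also have "\<dots> = (rot d \<bullet> e)\<^sup>2" using rot_inner_squared[of d e] by simp
  finally show ?thesis by simp
qed

lemma sin_line_angle_nonneg: "0 \<le> sin (line_angle d e)"
proof -
  have "\<bar>d \<bullet> e\<bar> / (norm d * norm e) \<le> 1"
    using Cauchy_Schwarz_ineq2[of d e] by (cases "norm d * norm e = 0") (auto simp: divide_le_eq)
  moreover have "0 \<le> \<bar>d \<bullet> e\<bar> / (norm d * norm e)" by simp
  ultimately have "-1 \<le> \<bar>d \<bullet> e\<bar> / (norm d * norm e)" "\<bar>d \<bullet> e\<bar> / (norm d * norm e) \<le> 1" by linarith+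
  then show ?thesis unfolding line_angle_def
    using sin_ge_zero arccos_lbound arccos_ubound by blast
qed

lemma measure_triangle:
  "measure lebesgue (convex hull {A, B, C :: plane}) = \<bar>rot (B - A) \<bullet> (C - A)\<bar> / 2"
proof -
  have "compact (convex hull {A, B, C})" by (intro finite_imp_compact_convex_hull) auto
  then have "measure lebesgue (convex hull {A, B, C}) = measure lborel (convex hull {A, B, C})"
    by (simp add: borel_compact)
  then show ?thesis
    unfolding content_triangle by (simp add: rot_inner abs_minus_commute algebra_simps)
qed

text \<open>The half-product of the diagonals and the sine of their angle is at most the area of the
  convex hull, whether the diagonals cross or not: if \<open>b\<close> and \<open>d\<close> are on the same side of the line
  through \<open>a\<close> and \<open>c\<close>, it is the difference of the areas of two triangles in the hull, and
  otherwise the sum of the areas of two triangles that overlap only in that line.\<close>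

lemma quadrilateral_area:
  fixes a b c d :: plane
  assumes ac: "a \<noteq> c"
  shows "\<bar>rot (c - a) \<bullet> (d - b)\<bar> / 2 \<le> measure lebesgue (convex hull {a, b, c, d})"
proof -
  let ?H = "convex hull {a, b, c, d}"
  let ?T = "\<lambda>x. convex hull {a, c, x}"
  let ?h = "\<lambda>x. rot (c - a) \<bullet> (x - a)"
  have "compact ?H" "compact (?T x)" for x
    by (intro finite_imp_compact_convex_hull; simp)+
  then have H: "?H \<in> lmeasurable" and T: "?T x \<in> lmeasurable" for x by (simp_all add: lmeasurable_compact)
  have sub: "?T b \<subseteq> ?H" "?T d \<subseteq> ?H" by (intro hull_mono; auto)+
  have le: "measure lebesgue (?T b) \<le> measure lebesgue ?H" "measure lebesgue (?T d) \<le> measure lebesgue ?H"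
    using sub T H by (auto intro!: measure_mono_fmeasurable simp: fmeasurableD)
  have m: "measure lebesgue (?T x) = \<bar>?h x\<bar> / 2" for x by (rule measure_triangle)
  have split: "rot (c - a) \<bullet> (d - b) = ?h d - ?h b" by (simp add: inner_diff_right)
  show ?thesis
  proof (cases "?h b * ?h d \<ge> 0")
    case True
    then have "\<bar>?h d - ?h b\<bar> \<le> max \<bar>?h d\<bar> \<bar>?h b\<bar>"
      by (auto simp: zero_le_mult_iff)
    then show ?thesis using le m split by (simp add: max_def split: if_splits)
  next
    case False
    have side: "y \<in> ?T x \<Longrightarrow> ?h y * ?h x \<ge> 0" for x y
    proof -
      have "?T x \<subseteq> {y. 0 \<le> ?h y * ?h x}"
      proof (rule hull_minimal)
        have eq: "{y. 0 \<le> ?h y * ?h x} = {y. (?h x *\<^sub>R rot (c - a)) \<bullet> y \<ge> (?h x *\<^sub>R rot (c - a)) \<bullet> a}"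
          by (auto simp: inner_diff_right algebra_simps)
        show "convex {y. 0 \<le> ?h y * ?h x}" unfolding eq by (rule convex_halfspace_ge)
      qed auto
      then show "y \<in> ?T x \<Longrightarrow> ?h y * ?h x \<ge> 0" by blast
    qed
    have "?T b \<inter> ?T d \<subseteq> {y. rot (c - a) \<bullet> y = rot (c - a) \<bullet> a}"
    proof
      fix y assume y: "y \<in> ?T b \<inter> ?T d"
      then have "?h y * ?h b \<ge> 0" "?h y * ?h d \<ge> 0" using side by auto
      with False have "?h y = 0" by (auto simp: zero_le_mult_iff not_le)
      then show "y \<in> {y. rot (c - a) \<bullet> y = rot (c - a) \<bullet> a}" by (simp add: inner_diff_right)
    qed
    moreover have "rot (c - a) \<noteq> 0" using ac norm_rot[of "c - a"] by (metis norm_eq_zero right_minus_eq)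
    ultimately have "negligible (?T b \<inter> ?T d)"
      using negligible_hyperplane negligible_subset by blast
    then have "measure lebesgue (?T b \<union> ?T d) = measure lebesgue (?T b) + measure lebesgue (?T d)"
      using measure_Un3[OF T[of b] T[of d]] negligible_imp_measure0 by simp
    moreover have "measure lebesgue (?T b \<union> ?T d) \<le> measure lebesgue ?H"
      using sub T H by (intro measure_mono_fmeasurable) (auto simp: fmeasurableD)
    moreover have "\<bar>?h d - ?h b\<bar> \<le> \<bar>?h d\<bar> + \<bar>?h b\<bar>" by linarith
    ultimately show ?thesis using m split by simp
  qed
qed

text \<open>Up to sign, \<open>n\<close> is the normalised quarter turn of \<open>e\<close>.\<close>

lemma unit_normal_inner:
  fixes n d e :: plane
  assumes "norm n = 1" "n \<bullet> e = 0" "d \<noteq> 0" "e \<noteq> 0"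
  shows "\<bar>n \<bullet> d\<bar> = norm d * sin (line_angle d e)"
proof -
  have "\<bar>n \<bullet> d\<bar> = \<bar>rot e \<bullet> d\<bar> / norm e"
    using unit_normal_eq[OF assms(1,2,4)] by auto
  also have "\<bar>rot e \<bullet> d\<bar> = \<bar>rot d \<bullet> e\<bar>" by (simp add: rot_inner abs_minus_commute algebra_simps)
  also have "\<dots> = norm d * norm e * sin (line_angle d e)" using sin_line_angle[OF assms(3,4)] by simp
  finally show ?thesis using assms by simp
qed

lemma line_angle_commute: "line_angle d e = line_angle e d"
  by (simp add: line_angle_def inner_commute mult.commute)

text \<open>The inner product with \<open>d\<close> cancels \<open>n2\<close> and makes the sine appear from \<open>n1\<close>; the orientation of the
normals affects only signs.\<close>

lemma two_directions_gradient:
  fixes n1 n2 d e :: plane and s t :: real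
  assumes n1: "norm n1 = 1" "n1 \<bullet> e = 0" and n2: "norm n2 = 1" "n2 \<bullet> d = 0"
    and de: "d \<noteq> 0" "e \<noteq> 0" and sn: "sin (line_angle d e) > 0"
  defines "g \<equiv> (1 / sin (line_angle d e)) *\<^sub>R ((s / norm d) *\<^sub>R n1 + (t / norm e) *\<^sub>R n2)"
  shows "\<bar>s\<bar> \<le> norm g * norm d" "\<bar>t\<bar> \<le> norm g * norm e"
proof -
  have "\<bar>g \<bullet> d\<bar> = \<bar>s\<bar> / (sin (line_angle d e) * norm d) * \<bar>n1 \<bullet> d\<bar>"
    using n2 sn by (simp add: g_def inner_add_left abs_mult)
  then have "\<bar>g \<bullet> d\<bar> = \<bar>s\<bar>"
    using unit_normal_inner[OF n1 de] sn de by simp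
  then show "\<bar>s\<bar> \<le> norm g * norm d" using Cauchy_Schwarz_ineq2[of g d] by simp
  have "\<bar>g \<bullet> e\<bar> = \<bar>t\<bar> / (sin (line_angle d e) * norm e) * \<bar>n2 \<bullet> e\<bar>"
    using n1 sn by (simp add: g_def inner_add_left abs_mult)
  then have "\<bar>g \<bullet> e\<bar> = \<bar>t\<bar>"
    using unit_normal_inner[OF n2 de(2,1)] sn de by (simp add: line_angle_commute)
  then show "\<bar>t\<bar> \<le> norm g * norm e" using Cauchy_Schwarz_ineq2[of g e] by simp
qed

section \<open>Star-shaped polygons\<close>

lemma polygon_edges_ne:
  assumes "open_polygon V E" shows "E \<noteq> {}"
  using assms unfolding open_polygon_def simple_polygon_def by force

text \<open>A bounded open set is swept by the segments from any point to the boundary.\<close>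

lemma polygon_subset_cones:
  assumes P: "open_polygon V E"
  shows "V \<subseteq> (\<Union>s\<in>E. convex hull (insert v s))"
proof
  fix y assume y: "y \<in> V"
  note fr = open_polygon_frontier[OF P]
  show "y \<in> (\<Union>s\<in>E. convex hull (insert v s))"
  proof (cases "y = v")
    case True
    then show ?thesis using polygon_edges_ne[OF P] hull_inc[of v "insert v _"] by fastforce
  next
    case False
    have "y \<in> interior V" using y fr(2) by (simp add: interior_open)
    then obtain d where d: "0 < d" "y + d *\<^sub>R (y - v) \<in> frontier V"
      using ray_to_frontier[OF fr(3), of y "y - v"] False by auto
    then obtain s where s: "s \<in> E" "y + d *\<^sub>R (y - v) \<in> s" using fr(4) by auto
    let ?w = "y + d *\<^sub>R (y - v)"
    have "(1 + d) *\<^sub>R y = d *\<^sub>R v + ?w" by (simp add: algebra_simps)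
    then have "(1 / (1 + d)) *\<^sub>R ((1 + d) *\<^sub>R y) = (1 / (1 + d)) *\<^sub>R (d *\<^sub>R v + ?w)" by simp
    then have "y = (d / (1 + d)) *\<^sub>R v + (1 / (1 + d)) *\<^sub>R ?w"
      using d(1) by (simp add: scaleR_add_right)
    moreover have "v \<in> convex hull (insert v s)" "?w \<in> convex hull (insert v s)"
      using s by (auto intro: hull_inc)
    moreover have "d / (1 + d) + 1 / (1 + d) = 1" "0 \<le> d / (1 + d)" "0 \<le> 1 / (1 + d)"
      using d(1) by (auto simp: field_simps)
    ultimately have "y \<in> convex hull (insert v s)"
      using convexD[OF convex_convex_hull] by metis
    then show ?thesis using s(1) by blast
  qed
qed

lemma convex_hull_insert_segment:
  "convex hull (insert v (closed_segment a b)) = convex hull {v, a, b}"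
  unfolding segment_convex_hull by (rule hull_insert[symmetric])

lemma polygon_area_le:
  assumes P: "open_polygon V E"
  shows "measure lebesgue V \<le> (\<Sum>s\<in>E. measure lebesgue (convex hull (insert v s)))"
proof -
  have fm: "convex hull (insert v s) \<in> lmeasurable" if s: "s \<in> E" for s
  proof -
    have "compact s" using open_polygon_edges[OF P s] by (metis compact_segment(1))
    then show ?thesis by (intro lmeasurable_compact compact_convex_hull compact_insert)
  qed
  have fin: "finite E" "V \<in> lmeasurable"
    using open_polygon_frontier[OF P] by (auto intro: lmeasurable_open)
  have "measure lebesgue V \<le> measure lebesgue (\<Union>s\<in>E. convex hull (insert v s))"
    using polygon_subset_cones[OF P] fm fin
    by (intro measure_mono_fmeasurable fmeasurable.finite_UN) (auto simp: fmeasurableD)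
  also have "\<dots> \<le> (\<Sum>s\<in>E. measure lebesgue (convex hull (insert v s)))"
    using fm fin by (intro measure_UNION_le) (auto simp: fmeasurableD)
  finally show ?thesis .
qed

text \<open>A star-shaped polygon sees an edge that it shares with a disjoint polygon from its own side
  of the edge: otherwise a segment from its center would reach it, near the edge, through the
  other polygon.\<close>

lemma star_center_side:
  assumes star: "star_shaped_wrt V2 x" and dis: "V1 \<inter> V2 = {}" and e: "\<epsilon> > 0"
    and V1: "\<And>y. y \<in> ball z \<epsilon> \<Longrightarrow> n \<bullet> (y - z) < 0 \<Longrightarrow> y \<in> V1"
    and V2: "\<And>y. y \<in> ball z \<epsilon> \<Longrightarrow> 0 < n \<bullet> (y - z) \<Longrightarrow> y \<in> V2"
  shows "0 \<le> n \<bullet> (x - z)"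
proof (rule ccontr)
  assume neg: "\<not> 0 \<le> n \<bullet> (x - z)"
  then have "x - z \<noteq> 0" by auto
  define t where "t = min (1/2) (\<epsilon> / (2 * norm (x - z)))"
  have t: "0 < t" "t < 1" using e \<open>x - z \<noteq> 0\<close> by (auto simp: t_def)
  have "t * norm (x - z) \<le> \<epsilon> / (2 * norm (x - z)) * norm (x - z)"
    unfolding t_def by (intro mult_right_mono) auto
  also have "\<dots> < \<epsilon>" using e \<open>x - z \<noteq> 0\<close> by simp
  finally have tn: "t * norm (x - z) < \<epsilon>" .
  \<comment> \<open>\<open>?k\<close> lies on the segment from \<open>x\<close> to \<open>?y\<close>, but on the side of \<open>V1\<close>.\<close>
  let ?k = "z + t *\<^sub>R (x - z)" let ?y = "z - t *\<^sub>R (x - z)"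
  have "?k \<in> V1" using tn t neg by (intro V1) (auto simp: dist_norm mult_less_0_iff)
  moreover have "?y \<in> V2" using tn t neg by (intro V2) (auto simp: dist_norm mult_less_0_iff not_le)
  then have "open_segment x ?y \<subseteq> V2" using star by (simp add: star_shaped_wrt_def)
  moreover have "?k \<in> open_segment x ?y"
  proof -
    have "?k = (1 - (1 - t) / (1 + t)) *\<^sub>R x + ((1 - t) / (1 + t)) *\<^sub>R ?y"
    proof -
      have "(1 + t) *\<^sub>R ?k = (1 + t - (1 - t)) *\<^sub>R x + (1 - t) *\<^sub>R ?y"
        unfolding vec_eq_iff by (simp add: algebra_simps)
      then have "(1 / (1 + t)) *\<^sub>R ((1 + t) *\<^sub>R ?k)
          = (1 / (1 + t)) *\<^sub>R ((1 + t - (1 - t)) *\<^sub>R x + (1 - t) *\<^sub>R ?y)" by simp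
      moreover have "1 - (1 - t) / (1 + t) = (1 / (1 + t)) * (1 + t - (1 - t))"
        using t by (simp add: field_simps)
      ultimately show ?thesis using t by (simp add: scaleR_add_right)
    qed
    moreover have "x \<noteq> ?y"
    proof
      assume "x = ?y"
      then have "(1 + t) *\<^sub>R (x - z) = 0" by (simp add: algebra_simps)
      then show False using t \<open>x - z \<noteq> 0\<close> by simp
    qed
    ultimately show ?thesis using t unfolding in_segment
      by (intro conjI exI[of _ "(1 - t) / (1 + t)"]) (auto simp: field_simps)
  qed
  ultimately show False using dis by blast
qed

text \<open>Since the centers of two adjacent polygons are on different sides of the common edge, the
  distance from one of them to the line of the edge is at most their distance.\<close>

lemma adjacent_centers_distance:
  assumes P1: "open_polygon V1 E1" and P2: "open_polygon V2 E2" and dis: "V1 \<inter> V2 = {}"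
    and s: "closed_segment a b \<in> E1" "closed_segment a b \<in> E2" and ab: "a \<noteq> b"
    and star: "star_shaped_wrt V1 x1" "star_shaped_wrt V2 x2"
  shows "\<bar>rot (b - a) \<bullet> (x1 - a)\<bar> \<le> norm (b - a) * dist x1 x2"
proof -
  have z: "midpoint a b \<in> open_segment a b" using ab by simp
  obtain n \<epsilon> where n: "norm n = 1" "n \<bullet> (b - a) = 0" "\<epsilon> > 0"
    "\<And>y. y \<in> ball (midpoint a b) \<epsilon> \<Longrightarrow> n \<bullet> (y - midpoint a b) < 0 \<Longrightarrow> y \<in> V1"
    "\<And>y. y \<in> ball (midpoint a b) \<epsilon> \<Longrightarrow> 0 < n \<bullet> (y - midpoint a b) \<Longrightarrow> y \<in> V2"
    using polygons_sharing_edge[OF P1 P2 dis s z] by metis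
  let ?z = "midpoint a b"
  have "0 \<le> n \<bullet> (x2 - ?z)"
    using star_center_side[OF star(2) dis n(3,4,5)] by blast
  moreover have "0 \<le> (- n) \<bullet> (x1 - ?z)"
    by (rule star_center_side[OF star(1) _ n(3), where ?V1.0 = V2]) (use dis n in auto)
  ultimately have "\<bar>n \<bullet> (x1 - ?z)\<bar> \<le> n \<bullet> (x2 - x1)" by (simp add: inner_diff_right)
  also have "\<dots> \<le> dist x1 x2"
    using Cauchy_Schwarz_ineq2[of n "x2 - x1"] n(1) by (simp add: dist_norm norm_minus_commute)
  finally have d: "\<bar>n \<bullet> (x1 - ?z)\<bar> \<le> dist x1 x2" .
  have "n \<bullet> (?z - a) = 0"
    using segment_perp[OF _ _ n(2), of a ?z] by simp
  then have "n \<bullet> (x1 - ?z) = n \<bullet> (x1 - a)" by (simp add: inner_diff_right)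
  moreover have "\<bar>n \<bullet> (x1 - a)\<bar> = \<bar>rot (b - a) \<bullet> (x1 - a)\<bar> / norm (b - a)"
    using unit_normal_eq[OF n(1,2)] ab by auto
  ultimately have "\<bar>rot (b - a) \<bullet> (x1 - a)\<bar> = norm (b - a) * \<bar>n \<bullet> (x1 - ?z)\<bar>"
    using ab by (simp add: field_simps)
  then show ?thesis using mult_left_mono[OF d, of "norm (b - a)"] by simp
qed

section \<open>Variation along a segment\<close>

text \<open>The set \<open>T i\<close> contains the parameter, if any, at which a path meets the \<open>i\<close>-th edge. The induction is on
the number of edges met: without any, the function is locally constant and hence constant.\<close>

lemma variation_on_interval:
  fixes v :: "real \<Rightarrow> real" and T :: "'i \<Rightarrow> real set" and J :: "'i \<Rightarrow> real"
  assumes fin: "finite I" and J: "\<And>i. i \<in> I \<Longrightarrow> 0 \<le> J i"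
    and one: "\<And>i s t. i \<in> I \<Longrightarrow> s \<in> T i \<Longrightarrow> t \<in> T i \<Longrightarrow> s = t"
    and loc: "\<And>t. t \<in> {A..B} \<Longrightarrow> \<exists>\<epsilon>>0. \<forall>s\<in>{A..B}. \<forall>s'\<in>{A..B}. \<bar>s - t\<bar> < \<epsilon> \<longrightarrow> \<bar>s' - t\<bar> < \<epsilon> \<longrightarrow>
      s \<notin> (\<Union>i\<in>I. T i) \<longrightarrow> s' \<notin> (\<Union>i\<in>I. T i) \<longrightarrow> \<bar>v s - v s'\<bar> \<le> (\<Sum>i | i \<in> I \<and> t \<in> T i. J i)"
    and ab: "A \<le> a" "a \<le> b" "b \<le> B" "a \<notin> (\<Union>i\<in>I. T i)" "b \<notin> (\<Union>i\<in>I. T i)"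
  shows "\<bar>v a - v b\<bar> \<le> (\<Sum>i | i \<in> I \<and> T i \<inter> {a..b} \<noteq> {}. J i)"
  using ab
proof (induction "card {i \<in> I. T i \<inter> {a..b} \<noteq> {}}" arbitrary: a b rule: less_induct)
  case less
  let ?H = "\<lambda>a b. {i \<in> I. T i \<inter> {a..b} \<noteq> {}}"
  show ?case
  proof (cases "?H a b = {}")
    case True
    then have off: "s \<notin> (\<Union>i\<in>I. T i)" if "s \<in> {a..b}" for s using that by blast
    have "\<forall>\<^sub>F s in at t within {a..b}. v t = v s" if t: "t \<in> {a..b}" for t
    proof -
      have tAB: "t \<in> {A..B}" using t less.prems by auto
      obtain e where e: "e > 0" "\<And>s s'. s \<in> {A..B} \<Longrightarrow> s' \<in> {A..B} \<Longrightarrow> \<bar>s - t\<bar> < e \<Longrightarrow> \<bar>s' - t\<bar> < e \<Longrightarrow>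
          s \<notin> (\<Union>i\<in>I. T i) \<Longrightarrow> s' \<notin> (\<Union>i\<in>I. T i) \<Longrightarrow> \<bar>v s - v s'\<bar> \<le> (\<Sum>i | i \<in> I \<and> t \<in> T i. J i)"
        using loc[OF tAB] by meson
      have none: "{i \<in> I. t \<in> T i} = {}" using off[OF t] by blast
      then have "v t = v s" if s: "s \<in> {a..b}" "\<bar>s - t\<bar> < e" for s
        using e(2)[of t s, unfolded none] off[OF t] off[OF s(1)] s t e(1) less.prems by auto
      then show ?thesis
        unfolding eventually_at using e(1) by (auto simp: dist_real_def)
    qed
    then have "v a = v b"
      using connected_local_const[of "{a..b}" a b v] less.prems(2) by auto
    moreover have "0 \<le> sum J (?H a b)" using J by (intro sum_nonneg) auto
    ultimately show ?thesis by simp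
  next
    case False
    then obtain i t where i: "i \<in> I" and t: "t \<in> T i" "t \<in> {a..b}" by blast
    then have t': "a < t" "t < b"
      using less.prems(4,5) by (auto simp: less_le)
    have tAB: "t \<in> {A..B}" using t less.prems by auto
    obtain e where e: "e > 0" "\<And>s s'. s \<in> {A..B} \<Longrightarrow> s' \<in> {A..B} \<Longrightarrow> \<bar>s - t\<bar> < e \<Longrightarrow> \<bar>s' - t\<bar> < e \<Longrightarrow>
          s \<notin> (\<Union>i\<in>I. T i) \<Longrightarrow> s' \<notin> (\<Union>i\<in>I. T i) \<Longrightarrow> \<bar>v s - v s'\<bar> \<le> (\<Sum>i | i \<in> I \<and> t \<in> T i. J i)"
      using loc[OF tAB] by meson
    have finT: "finite (\<Union>i\<in>I. T i)"
    proof (intro finite_UN_I fin)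
      fix i assume "i \<in> I"
      then have "T i \<subseteq> {SOME t. t \<in> T i}" using one by (metis singletonI someI subsetI)
      then show "finite (T i)" using finite_subset by blast
    qed
    \<comment> \<open>Step over the crossing at \<open>t\<close> from \<open>s\<close> to \<open>s'\<close>; the two remaining pieces have fewer crossings.\<close>
    have "infinite {max a (t - e)<..<t}" "infinite {t<..<min b (t + e)}"
      using t' e(1) by auto
    then obtain s s' where "s \<in> {max a (t - e)<..<t} - (\<Union>i\<in>I. T i)" "s' \<in> {t<..<min b (t + e)} - (\<Union>i\<in>I. T i)"
      using finT by (metis Diff_eq_empty_iff finite_subset ex_in_conv)
    then have s: "a < s" "t - e < s" "s < t" "s \<notin> (\<Union>i\<in>I. T i)"
      and s': "t < s'" "s' < t + e" "s' < b" "s' \<notin> (\<Union>i\<in>I. T i)" by auto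
    have finH: "finite (?H c d)" for c d using fin by simp
    have "i \<notin> ?H a s" "i \<notin> ?H s' b" using one[OF i t(1)] s s' by force+
    moreover have "i \<in> ?H a b" using i t by blast
    moreover have sub: "?H a s \<subseteq> ?H a b" "?H s' b \<subseteq> ?H a b" using s s' t' by force+
    ultimately have psub: "?H a s \<subset> ?H a b" "?H s' b \<subset> ?H a b" by blast+
    note card = psub[THEN psubset_card_mono[OF finH]]
    have 1: "\<bar>v a - v s\<bar> \<le> sum J (?H a s)"
      using less.hyps[OF card(1)] less.prems s t' by simp
    have 2: "\<bar>v s' - v b\<bar> \<le> sum J (?H s' b)"
      using less.hyps[OF card(2)] less.prems s' t' by simp
    have 3: "\<bar>v s - v s'\<bar> \<le> sum J {i \<in> I. t \<in> T i}"
      using e(2)[of s s'] s s' t' less.prems by auto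
    have only: "r \<le> s \<Longrightarrow> r' \<ge> t \<Longrightarrow> \<not> (r \<in> T j \<and> r' \<in> T j)"
      "r \<le> t \<Longrightarrow> r' \<ge> s' \<Longrightarrow> \<not> (r \<in> T j \<and> r' \<in> T j)" if "j \<in> I" for r r' j
      using one[OF that, of r r'] s(3) s'(1) by auto
    have dis: "?H a s \<inter> {i \<in> I. t \<in> T i} = {}"
    proof (rule equals0I)
      fix j assume "j \<in> ?H a s \<inter> {i \<in> I. t \<in> T i}"
      then obtain r where "j \<in> I" "r \<in> T j" "r \<le> s" "t \<in> T j" by auto
      then show False using only(1)[of j r t] by simp
    qed
    have dis': "(?H a s \<union> {i \<in> I. t \<in> T i}) \<inter> ?H s' b = {}"
    proof (rule equals0I)
      fix j assume j: "j \<in> (?H a s \<union> {i \<in> I. t \<in> T i}) \<inter> ?H s' b"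
      then have "j \<in> I" "(\<exists>r\<in>T j. r \<le> s) \<or> t \<in> T j" by auto
      then obtain r where "j \<in> I" "r \<in> T j" "r \<le> t" using s(3) by fastforce
      moreover obtain r' where "r' \<in> T j" "s' \<le> r'" using j by auto
      ultimately show False using only(2)[of j r r'] by simp
    qed
    have "sum J (?H a s) + sum J {i \<in> I. t \<in> T i} + sum J (?H s' b)
        = sum J (?H a s \<union> {i \<in> I. t \<in> T i} \<union> ?H s' b)"
      using dis dis' fin by (subst sum.union_disjoint; simp)+
    also have "\<dots> \<le> sum J (?H a b)"
      using sub t fin J by (intro sum_mono2) auto
    finally show ?thesis using 1 2 3 by linarith
  qed
qed

text \<open>The function \<open>w\<close> varies in \<open>\<Omega>\<close> only across the sets \<open>S i\<close>, and then by at most \<open>J i\<close>. At a point on no \<open>S i\<close>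
the sum is empty, so that \<open>w\<close> is constant around it. Nothing is required at the points of \<open>V\<close>, in
applications the endpoints of the edges, where many cells may meet, nor of the values of \<open>w\<close> on the
sets \<open>S i\<close>.\<close>

definition steps_bounded ::
  "plane set \<Rightarrow> plane set \<Rightarrow> 'i set \<Rightarrow> ('i \<Rightarrow> plane set) \<Rightarrow> ('i \<Rightarrow> real) \<Rightarrow> (plane \<Rightarrow> real) \<Rightarrow> bool" where
  "steps_bounded \<Omega> V I S J w \<longleftrightarrow>
     (\<forall>z\<in>\<Omega> - V. \<exists>\<epsilon>>0. \<forall>x\<in>ball z \<epsilon> - (\<Union>i\<in>I. S i). \<forall>y\<in>ball z \<epsilon> - (\<Union>i\<in>I. S i).
        \<bar>w x - w y\<bar> \<le> (\<Sum>i | i \<in> I \<and> z \<in> S i. J i))"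

lemma line_meets_segment_once:
  fixes x e a b :: "'a::real_vector"
  assumes "x + s *\<^sub>R e \<in> closed_segment a b" "x + t *\<^sub>R e \<in> closed_segment a b" "s \<noteq> t" "e \<noteq> 0"
  shows "\<exists>r. x + r *\<^sub>R e = a"
proof -
  obtain u where u: "x + s *\<^sub>R e = (1 - u) *\<^sub>R a + u *\<^sub>R b" using assms(1) by (auto simp: in_segment)
  obtain v where v: "x + t *\<^sub>R e = (1 - v) *\<^sub>R a + v *\<^sub>R b" using assms(2) by (auto simp: in_segment)
  have *: "(t - s) *\<^sub>R e = (v - u) *\<^sub>R (b - a)"
  proof -
    have "(t - s) *\<^sub>R e = (x + t *\<^sub>R e) - (x + s *\<^sub>R e)" by (simp add: algebra_simps)
    also have "\<dots> = (v - u) *\<^sub>R (b - a)" unfolding u v by (simp add: algebra_simps)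
    finally show ?thesis .
  qed
  have "(t - s) *\<^sub>R e \<noteq> 0" using assms by simp
  then have vu: "v - u \<noteq> 0" using * by auto
  have "b - a = (1 / (v - u)) *\<^sub>R ((v - u) *\<^sub>R (b - a))" using vu by simp
  also have "\<dots> = ((t - s) / (v - u)) *\<^sub>R e" unfolding *[symmetric] by simp
  finally have ba: "b - a = ((t - s) / (v - u)) *\<^sub>R e" .
  have "a = x + s *\<^sub>R e - u *\<^sub>R (b - a)" unfolding u by (simp add: algebra_simps)
  also have "\<dots> = x + (s - u * ((t - s) / (v - u))) *\<^sub>R e" unfolding ba by (simp add: algebra_simps)
  finally show ?thesis by metis
qed

text \<open>A line that avoids the endpoint \<open>p i\<close> meets the edge at most once, since otherwise it would contain
the edge. So every edge contributes its jump at most once, and the edges met on the segment are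
among those met on the whole line.\<close>

lemma variation_along_segment:
  fixes p q :: "'i \<Rightarrow> plane"
  assumes st: "steps_bounded \<Omega> V I (\<lambda>i. closed_segment (p i) (q i)) J w"
    and fin: "finite I" and J: "\<And>i. i \<in> I \<Longrightarrow> 0 \<le> J i" and pV: "\<And>i. i \<in> I \<Longrightarrow> p i \<in> V"
    and e: "e \<noteq> 0" and h: "0 \<le> h" "\<And>t. 0 \<le> t \<Longrightarrow> t \<le> h \<Longrightarrow> x + t *\<^sub>R e \<in> \<Omega>"
    and off: "\<And>t. x + t *\<^sub>R e \<notin> V"
    and x: "x \<notin> (\<Union>i\<in>I. closed_segment (p i) (q i))" "x + h *\<^sub>R e \<notin> (\<Union>i\<in>I. closed_segment (p i) (q i))"
  shows "\<bar>w x - w (x + h *\<^sub>R e)\<bar> \<le> (\<Sum>i | i \<in> I \<and> (\<exists>t. x + t *\<^sub>R e \<in> closed_segment (p i) (q i)). J i)"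
proof -
  let ?S = "\<lambda>i. closed_segment (p i) (q i)"
  define T where "T = (\<lambda>i. {t. x + t *\<^sub>R e \<in> ?S i})"
  define v where "v = (\<lambda>t. w (x + t *\<^sub>R e))"
  have one: "s = t" if "i \<in> I" "s \<in> T i" "t \<in> T i" for i s t
    using line_meets_segment_once[of x s e "p i" "q i" t] e off pV[OF that(1)] that(2,3)
    unfolding T_def by (metis mem_Collect_eq)
  have loc: "\<exists>\<epsilon>>0. \<forall>s\<in>{0..h}. \<forall>s'\<in>{0..h}. \<bar>s - t\<bar> < \<epsilon> \<longrightarrow> \<bar>s' - t\<bar> < \<epsilon> \<longrightarrow>
      s \<notin> (\<Union>i\<in>I. T i) \<longrightarrow> s' \<notin> (\<Union>i\<in>I. T i) \<longrightarrow> \<bar>v s - v s'\<bar> \<le> (\<Sum>i | i \<in> I \<and> t \<in> T i. J i)"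
    if t: "t \<in> {0..h}" for t
  proof -
    have "x + t *\<^sub>R e \<in> \<Omega> - V" using h(2) t off by auto
    then obtain d where d: "d > 0" "\<And>y y'. y \<in> ball (x + t *\<^sub>R e) d - (\<Union>i\<in>I. ?S i) \<Longrightarrow>
        y' \<in> ball (x + t *\<^sub>R e) d - (\<Union>i\<in>I. ?S i) \<Longrightarrow>
        \<bar>w y - w y'\<bar> \<le> (\<Sum>i | i \<in> I \<and> x + t *\<^sub>R e \<in> ?S i. J i)"
      using st unfolding steps_bounded_def by meson
    have "x + s *\<^sub>R e \<in> ball (x + t *\<^sub>R e) d" if "\<bar>s - t\<bar> < d / norm e" for s
    proof -
      have "(x + t *\<^sub>R e) - (x + s *\<^sub>R e) = (t - s) *\<^sub>R e" by (simp add: algebra_simps)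
      then have "dist (x + t *\<^sub>R e) (x + s *\<^sub>R e) = \<bar>s - t\<bar> * norm e"
        by (simp add: dist_norm abs_minus_commute)
      then show ?thesis using that e by (simp add: pos_less_divide_eq)
    qed
    then have "\<bar>v s - v s'\<bar> \<le> (\<Sum>i | i \<in> I \<and> t \<in> T i. J i)"
      if "\<bar>s - t\<bar> < d / norm e" "\<bar>s' - t\<bar> < d / norm e" "s \<notin> (\<Union>i\<in>I. T i)" "s' \<notin> (\<Union>i\<in>I. T i)" for s s'
      using d(2)[of "x + s *\<^sub>R e" "x + s' *\<^sub>R e"] that unfolding v_def T_def by simp
    moreover have "d / norm e > 0" using d(1) e by simp
    ultimately show ?thesis by blast
  qed
  have "\<bar>v 0 - v h\<bar> \<le> (\<Sum>i | i \<in> I \<and> T i \<inter> {0..h} \<noteq> {}. J i)"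
    by (rule variation_on_interval[OF fin J one loc]) (use h x in \<open>auto simp: T_def\<close>)
  also have "\<dots> \<le> (\<Sum>i | i \<in> I \<and> (\<exists>t. x + t *\<^sub>R e \<in> ?S i). J i)"
    using fin J by (intro sum_mono2) (auto simp: T_def)
  finally show ?thesis by (simp add: v_def)
qed

section \<open>Integration in oblique coordinates\<close>

lemma nn_integral_plane:
  assumes [measurable]: "g \<in> borel_measurable (borel :: plane measure)"
  shows "(\<integral>\<^sup>+x. g x \<partial>lborel) = (\<integral>\<^sup>+s. \<integral>\<^sup>+t. g (s *\<^sub>R axis 1 1 + t *\<^sub>R axis 2 1) \<partial>lborel \<partial>lborel)"
proof -
  define \<iota> :: "real \<times> real \<Rightarrow> plane" where "\<iota> = (\<lambda>(s, t). s *\<^sub>R axis 1 1 + t *\<^sub>R axis 2 1)"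
  have [measurable]: "\<iota> \<in> borel \<rightarrow>\<^sub>M borel"
    unfolding \<iota>_def case_prod_beta by (intro borel_measurable_continuous_onI continuous_intros)
  have Basis: "(Basis :: plane set) = {axis 1 1, axis 2 1}"
    by (auto simp: Basis_vec_def) (metis exhaust_2)+
  have ne: "(axis 1 1 :: plane) \<noteq> axis 2 1" by (simp add: axis_eq_axis)
  have coord: "(s *\<^sub>R axis 1 1 + t *\<^sub>R axis 2 1 :: plane) $ 1 = s"
      "(s *\<^sub>R axis 1 1 + t *\<^sub>R axis 2 1 :: plane) $ 2 = t"
      "(axis 2 1 :: plane) $ 1 = 0" "(axis 1 1 :: plane) $ 2 = 0" for s t :: real
    by (simp_all add: axis_def)
  have eq: "(lborel :: plane measure) = distr lborel borel \<iota>"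
  proof (rule lborel_eqI)
    fix l u :: plane assume le: "\<And>b. b \<in> Basis \<Longrightarrow> l \<bullet> b \<le> u \<bullet> b"
    have lu: "l $ 1 \<le> u $ 1" "l $ 2 \<le> u $ 2"
      using le[of "axis 1 1"] le[of "axis 2 1"] by (auto simp: Basis inner_axis)
    have "\<iota> -` box l u = box (l $ 1) (u $ 1) \<times> box (l $ 2) (u $ 2)"
      by (auto simp: \<iota>_def box_def Basis inner_axis coord)
    then have "emeasure (distr lborel borel \<iota>) (box l u)
        = emeasure (lborel \<Otimes>\<^sub>M lborel) (box (l $ 1) (u $ 1) \<times> box (l $ 2) (u $ 2))"
      by (simp add: emeasure_distr lborel_prod)
    also have "\<dots> = ennreal ((u $ 1 - l $ 1) * (u $ 2 - l $ 2))"
      using lu by (simp add: lborel.emeasure_pair_measure_Times ennreal_mult)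
    finally show "emeasure (distr lborel borel \<iota>) (box l u) = ennreal (\<Prod>b\<in>Basis. (u - l) \<bullet> b)"
      using ne by (simp add: Basis inner_axis)
  qed simp
  have "(\<integral>\<^sup>+x. g x \<partial>lborel) = (\<integral>\<^sup>+x. g x \<partial>distr lborel borel \<iota>)"
    by (rule arg_cong[OF eq, where f = "\<lambda>M. nn_integral M g"])
  also have "\<dots> = (\<integral>\<^sup>+z. g (\<iota> z) \<partial>(lborel \<Otimes>\<^sub>M lborel))"
    unfolding lborel_prod by (rule nn_integral_distr) auto
  also have "\<dots> = (\<integral>\<^sup>+s. \<integral>\<^sup>+t. g (\<iota> (s, t)) \<partial>lborel \<partial>lborel)"
    by (subst lborel.nn_integral_fst[symmetric]) (auto simp: lborel_prod)
  finally show ?thesis by (simp add: \<iota>_def)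
qed

text \<open>The two coordinates are substituted one after the other; the assumption on \<open>e\<close> makes the first
substitution possible.\<close>

lemma nn_integral_oblique_aux:
  assumes [measurable]: "g \<in> borel_measurable (borel :: plane measure)"
    and D: "rot e \<bullet> f \<noteq> 0" and e1: "e $ 1 \<noteq> 0"
  shows "(\<integral>\<^sup>+x. g x \<partial>lborel) = ennreal \<bar>rot e \<bullet> f\<bar> * (\<integral>\<^sup>+t. \<integral>\<^sup>+s. g (s *\<^sub>R e + t *\<^sub>R f) \<partial>lborel \<partial>lborel)"
proof -
  define D where "D = rot e \<bullet> f"
  have D': "D = e $ 1 * f $ 2 - e $ 2 * f $ 1" by (simp add: D_def rot_inner)
  define F where "F = (\<lambda>x y :: real. g (x *\<^sub>R axis 1 1 + y *\<^sub>R axis 2 1))"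
  have [measurable]: "case_prod F \<in> borel_measurable (borel :: (real \<times> real) measure)"
    unfolding F_def case_prod_beta
    by (rule measurable_compose[OF _ assms(1)]) (intro borel_measurable_continuous_onI continuous_intros)
  have Fm: "(\<lambda>z. F (a z) (b z)) \<in> borel_measurable M"
    if [measurable]: "a \<in> borel_measurable M" "b \<in> borel_measurable M" for a b and M :: "'z measure"
  proof -
    have "(\<lambda>z. (a z, b z)) \<in> M \<rightarrow>\<^sub>M borel" by (simp add: borel_prod[symmetric])
    then have "(\<lambda>z. case_prod F (a z, b z)) \<in> borel_measurable M"
      by (rule measurable_compose) fact
    then show ?thesis by simp
  qed
  have g: "g (s *\<^sub>R e + t *\<^sub>R f) = F (s * e $ 1 + t * f $ 1) (s * e $ 2 + t * f $ 2)" for s t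
  proof -
    have "s *\<^sub>R e + t *\<^sub>R f = (s * e $ 1 + t * f $ 1) *\<^sub>R axis 1 1 + (s * e $ 2 + t * f $ 2) *\<^sub>R axis 2 1"
      by (simp add: vec_eq_iff forall_2 axis_def)
    then show ?thesis by (simp add: F_def)
  qed
  have in1: "ennreal \<bar>e $ 1\<bar> * (\<integral>\<^sup>+s. g (s *\<^sub>R e + t *\<^sub>R f) \<partial>lborel)
      = (\<integral>\<^sup>+x. F x (x * (e $ 2 / e $ 1) + t * (D / e $ 1)) \<partial>lborel)" for t
  proof -
    have "(\<integral>\<^sup>+x. F x (x * (e $ 2 / e $ 1) + t * (D / e $ 1)) \<partial>lborel) = ennreal \<bar>e $ 1\<bar> *
      (\<integral>\<^sup>+s. F (t * f $ 1 + e $ 1 * s) ((t * f $ 1 + e $ 1 * s) * (e $ 2 / e $ 1) + t * (D / e $ 1)) \<partial>lborel)"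
      by (rule nn_integral_real_affine) (use e1 in \<open>auto intro!: Fm\<close>)
    moreover have "F (t * f $ 1 + e $ 1 * s) ((t * f $ 1 + e $ 1 * s) * (e $ 2 / e $ 1) + t * (D / e $ 1))
        = g (s *\<^sub>R e + t *\<^sub>R f)" for s
    proof -
      have "(t * f $ 1 + e $ 1 * s) * (e $ 2 / e $ 1) + t * (D / e $ 1) = s * e $ 2 + t * f $ 2"
        using e1 by (simp add: D' field_simps)
      then show ?thesis by (simp add: g mult.commute[of "e $ 1"] add.commute[of "t * f $ 1"])
    qed
    ultimately show ?thesis by simp
  qed
  have in2: "ennreal \<bar>D / e $ 1\<bar> * (\<integral>\<^sup>+t. F x (x * (e $ 2 / e $ 1) + t * (D / e $ 1)) \<partial>lborel)
      = (\<integral>\<^sup>+y. F x y \<partial>lborel)" for x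
  proof -
    have "(\<integral>\<^sup>+y. F x y \<partial>lborel)
       = ennreal \<bar>D / e $ 1\<bar> * (\<integral>\<^sup>+t. F x (x * (e $ 2 / e $ 1) + (D / e $ 1) * t) \<partial>lborel)"
      by (rule nn_integral_real_affine) (use e1 D in \<open>auto intro!: Fm simp: D_def\<close>)
    then show ?thesis by (simp add: mult.commute)
  qed
  have "ennreal \<bar>D\<bar> * (\<integral>\<^sup>+t. \<integral>\<^sup>+s. g (s *\<^sub>R e + t *\<^sub>R f) \<partial>lborel \<partial>lborel)
      = ennreal \<bar>D / e $ 1\<bar> * (\<integral>\<^sup>+t. ennreal \<bar>e $ 1\<bar> * (\<integral>\<^sup>+s. g (s *\<^sub>R e + t *\<^sub>R f) \<partial>lborel) \<partial>lborel)"
  proof -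
    have "(\<lambda>t. \<integral>\<^sup>+s. g (s *\<^sub>R e + t *\<^sub>R f) \<partial>lborel) \<in> borel_measurable lborel"
      unfolding g by (intro lborel.borel_measurable_nn_integral) (unfold case_prod_beta, intro Fm; measurable)
    moreover have "ennreal \<bar>D\<bar> = ennreal \<bar>D / e $ 1\<bar> * ennreal \<bar>e $ 1\<bar>"
      using e1 by (simp flip: ennreal_mult add: abs_divide)
    ultimately show ?thesis by (simp add: nn_integral_cmult mult.assoc)
  qed
  also have "\<dots> = ennreal \<bar>D / e $ 1\<bar> *
      (\<integral>\<^sup>+t. \<integral>\<^sup>+x. F x (x * (e $ 2 / e $ 1) + t * (D / e $ 1)) \<partial>lborel \<partial>lborel)"
    by (simp add: in1)
  also have "\<dots> = ennreal \<bar>D / e $ 1\<bar> *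
      (\<integral>\<^sup>+x. \<integral>\<^sup>+t. F x (x * (e $ 2 / e $ 1) + t * (D / e $ 1)) \<partial>lborel \<partial>lborel)"
    by (rule arg_cong[where f = "(*) _"], rule lborel_pair.Fubini')
      (unfold case_prod_beta, intro Fm; measurable)
  also have "\<dots> = (\<integral>\<^sup>+x. ennreal \<bar>D / e $ 1\<bar> * (\<integral>\<^sup>+t. F x (x * (e $ 2 / e $ 1) + t * (D / e $ 1)) \<partial>lborel) \<partial>lborel)"
    by (intro nn_integral_cmult[symmetric] lborel.borel_measurable_nn_integral)
      (unfold case_prod_beta, intro Fm; measurable)
  also have "\<dots> = (\<integral>\<^sup>+x. g x \<partial>lborel)"
    unfolding in2 unfolding F_def by (rule nn_integral_plane[symmetric]) simp
  finally show ?thesis by (simp add: D_def)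
qed

lemma nn_integral_oblique:
  assumes [measurable]: "g \<in> borel_measurable (borel :: plane measure)"
    and D: "rot e \<bullet> f \<noteq> 0"
  shows "(\<integral>\<^sup>+x. g x \<partial>lborel) = ennreal \<bar>rot e \<bullet> f\<bar> * (\<integral>\<^sup>+t. \<integral>\<^sup>+s. g (s *\<^sub>R e + t *\<^sub>R f) \<partial>lborel \<partial>lborel)"
proof (cases "e $ 1 = 0")
  case True
  then have f1: "f $ 1 \<noteq> 0" using D by (auto simp: rot_inner)
  have "rot f \<bullet> e = - (rot e \<bullet> f)" by (simp add: rot_inner)
  then have "(\<integral>\<^sup>+x. g x \<partial>lborel) = ennreal \<bar>rot e \<bullet> f\<bar> * (\<integral>\<^sup>+t. \<integral>\<^sup>+s. g (s *\<^sub>R f + t *\<^sub>R e) \<partial>lborel \<partial>lborel)"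
    using nn_integral_oblique_aux[of g f e] D f1 by simp
  also have "(\<integral>\<^sup>+t. \<integral>\<^sup>+s. g (s *\<^sub>R f + t *\<^sub>R e) \<partial>lborel \<partial>lborel)
      = (\<integral>\<^sup>+s. \<integral>\<^sup>+t. g (s *\<^sub>R f + t *\<^sub>R e) \<partial>lborel \<partial>lborel)"
    by (subst lborel_pair.Fubini') auto
  finally show ?thesis by (simp add: add.commute)
qed (use nn_integral_oblique_aux[OF assms] in simp)

section \<open>The Sobolev inequality for piecewise constant functions\<close>

lemma emeasure_real_segment: "emeasure lborel (closed_segment a b) = ennreal \<bar>a - b\<bar>" for a b :: real
  by (auto simp: closed_segment_eq_real_ivl)

text \<open>The value at a point from which the segment in direction \<open>e\<close> stays in the domain is at most the mean
over this segment plus the jumps met on the line through the point. As \<open>n\<close> is the coordinate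
functional dual to \<open>f\<close>, an edge meets the line with coordinate \<open>r\<close> only if \<open>r\<close> lies between the
coordinates of its endpoints. Thus the bound depends on \<open>r\<close> only.\<close>

lemma value_le_line_bound:
  fixes p q :: "'i \<Rightarrow> plane"
  assumes st: "steps_bounded \<Omega> V I (\<lambda>i. closed_segment (p i) (q i)) J w"
    and fin: "finite I" and J: "\<And>i. i \<in> I \<Longrightarrow> 0 \<le> J i" and pV: "\<And>i. i \<in> I \<Longrightarrow> p i \<in> V"
    and [measurable]: "w \<in> borel_measurable borel" "\<Omega> \<in> sets borel"
    and n: "n \<bullet> e = 0" and e: "e \<noteq> 0" and f: "n \<bullet> f = 1" and h: "0 < h"
    and x: "\<And>t. 0 \<le> t \<Longrightarrow> t \<le> h \<Longrightarrow> s *\<^sub>R e + r *\<^sub>R f + t *\<^sub>R e \<in> \<Omega>"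
    and off: "r \<notin> (\<lambda>v. n \<bullet> v) ` V" "s *\<^sub>R e + r *\<^sub>R f \<notin> (\<Union>i\<in>I. closed_segment (p i) (q i))"
  shows "ennreal (w (s *\<^sub>R e + r *\<^sub>R f)) \<le>
      ennreal (1 / h) * (\<integral>\<^sup>+s. ennreal (w (s *\<^sub>R e + r *\<^sub>R f)) * indicator \<Omega> (s *\<^sub>R e + r *\<^sub>R f) \<partial>lborel)
      + (\<Sum>i\<in>I. ennreal (J i) * indicator (closed_segment (n \<bullet> p i) (n \<bullet> q i)) r)"
proof -
  let ?S = "\<lambda>i. closed_segment (p i) (q i)"
  let ?x = "s *\<^sub>R e + r *\<^sub>R f"
  define Js where "Js = (\<Sum>i | i \<in> I \<and> (\<exists>t. ?x + t *\<^sub>R e \<in> ?S i). J i)"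
  have Js0: "0 \<le> Js" unfolding Js_def using J by (intro sum_nonneg) auto
  have nx: "n \<bullet> (?x + t *\<^sub>R e) = r" for t using n f by (simp add: inner_add_right)
  have offV: "?x + t *\<^sub>R e \<notin> V" for t using off(1) nx[of t] by (metis imageI)
  define B where "B = {t. ?x + t *\<^sub>R e \<in> (\<Union>i\<in>I. ?S i)}"
  have "finite B"
  proof -
    have "finite {t. ?x + t *\<^sub>R e \<in> ?S i}" if i: "i \<in> I" for i
    proof (rule finite_subset)
      show "{t. ?x + t *\<^sub>R e \<in> ?S i} \<subseteq> {SOME t. ?x + t *\<^sub>R e \<in> ?S i}"
      proof
        fix t assume "t \<in> {t. ?x + t *\<^sub>R e \<in> ?S i}"
        then have t: "?x + t *\<^sub>R e \<in> ?S i" by simp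
        then have "?x + (SOME t. ?x + t *\<^sub>R e \<in> ?S i) *\<^sub>R e \<in> ?S i" by (rule someI)
        with t show "t \<in> {SOME t. ?x + t *\<^sub>R e \<in> ?S i}"
          using line_meets_segment_once[of ?x t e "p i" "q i"] e offV pV[OF i] by (metis singletonI)
      qed
    qed simp
    moreover have "B = (\<Union>i\<in>I. {t. ?x + t *\<^sub>R e \<in> ?S i})" by (auto simp: B_def)
    ultimately show ?thesis using fin by simp
  qed
  then have "AE t in lborel. t \<notin> B"
    by (intro AE_not_in) (simp add: countable_imp_null_set_lborel countable_finite)
  have le: "w ?x \<le> w (?x + t *\<^sub>R e) + Js" if "0 \<le> t" "t \<le> h" "t \<notin> B" for t
  proof -
    have "\<bar>w ?x - w (?x + t *\<^sub>R e)\<bar> \<le> Js" unfolding Js_def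
      by (rule variation_along_segment[OF st fin J pV e that(1) _ offV off(2)])
        (use x that in \<open>auto simp: B_def\<close>)
    then show ?thesis by linarith
  qed
  let ?W = "\<integral>\<^sup>+s. ennreal (w (s *\<^sub>R e + r *\<^sub>R f)) * indicator \<Omega> (s *\<^sub>R e + r *\<^sub>R f) \<partial>lborel"
  have "ennreal (w ?x) * ennreal h = (\<integral>\<^sup>+t. ennreal (w ?x) * indicator {0..h} t \<partial>lborel)"
    using h by (simp add: nn_integral_cmult_indicator)
  also have "\<dots> \<le> (\<integral>\<^sup>+t. (ennreal (w (?x + t *\<^sub>R e)) * indicator \<Omega> (?x + t *\<^sub>R e) + ennreal Js * indicator {0..h} t) \<partial>lborel)"
  proof (rule nn_integral_mono_AE)
    show "AE t in lborel. ennreal (w ?x) * indicator {0..h} t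
        \<le> ennreal (w (?x + t *\<^sub>R e)) * indicator \<Omega> (?x + t *\<^sub>R e) + ennreal Js * indicator {0..h} t"
      using \<open>AE t in lborel. t \<notin> B\<close>
    proof eventually_elim
      case (elim t)
      show ?case
      proof (cases "t \<in> {0..h}")
        case True
        then have "ennreal (w ?x) \<le> ennreal (w (?x + t *\<^sub>R e) + Js)"
          using le elim by (intro ennreal_leI) auto
        also have "\<dots> \<le> ennreal (w (?x + t *\<^sub>R e)) + ennreal Js" 
          using Js0 by (auto simp: ennreal_plus_if intro!: ennreal_leI)
        finally show ?thesis using True x by simp
      qed simp
    qed
  qed
  also have "\<dots> = (\<integral>\<^sup>+t. ennreal (w (?x + t *\<^sub>R e)) * indicator \<Omega> (?x + t *\<^sub>R e) \<partial>lborel) + ennreal Js * ennreal h"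
    using h by (subst nn_integral_add) (auto simp: nn_integral_cmult_indicator)
  also have "(\<integral>\<^sup>+t. ennreal (w (?x + t *\<^sub>R e)) * indicator \<Omega> (?x + t *\<^sub>R e) \<partial>lborel) = ?W"
    using nn_integral_real_affine[of "\<lambda>s. ennreal (w (s *\<^sub>R e + r *\<^sub>R f)) * indicator \<Omega> (s *\<^sub>R e + r *\<^sub>R f)" 1 s]
    by (simp add: algebra_simps)
  finally have main: "ennreal (w ?x) * ennreal h \<le> ?W + ennreal Js * ennreal h" .
  have hh: "ennreal (1 / h) * ennreal h = 1"
    using h by (simp flip: ennreal_mult)
  have "ennreal (w ?x) = ennreal (1 / h) * (ennreal (w ?x) * ennreal h)"
    by (simp only: mult.left_commute[of "ennreal (1 / h)"] hh mult_1_right)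
  also have "\<dots> \<le> ennreal (1 / h) * (?W + ennreal Js * ennreal h)"
    by (intro mult_left_mono main) simp
  also have "\<dots> = ennreal (1 / h) * ?W + ennreal Js"
  proof -
    have "ennreal (1 / h) * (?W + ennreal Js * ennreal h)
        = ennreal (1 / h) * ?W + ennreal Js * (ennreal (1 / h) * ennreal h)"
      unfolding distrib_left by (simp only: mult.left_commute)
    then show ?thesis by (simp only: hh mult_1_right)
  qed
  finally have "ennreal (w ?x) \<le> ennreal (1 / h) * ?W + ennreal Js" .
  moreover have "ennreal Js \<le> (\<Sum>i\<in>I. ennreal (J i) * indicator (closed_segment (n \<bullet> p i) (n \<bullet> q i)) r)"
  proof -
    have r: "r \<in> closed_segment (n \<bullet> p i) (n \<bullet> q i)" if S: "?x + t *\<^sub>R e \<in> ?S i" for i t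
    proof -
      obtain u where u: "0 \<le> u" "u \<le> 1" "?x + t *\<^sub>R e = (1 - u) *\<^sub>R p i + u *\<^sub>R q i"
        using S by (auto simp: in_segment)
      then have "r = (1 - u) *\<^sub>R (n \<bullet> p i) + u *\<^sub>R (n \<bullet> q i)"
        using nx[of t] by (simp add: inner_add_right)
      then show ?thesis using u by (auto simp: in_segment)
    qed
    have "ennreal Js = (\<Sum>i | i \<in> I \<and> (\<exists>t. ?x + t *\<^sub>R e \<in> ?S i). ennreal (J i))"
      unfolding Js_def using J by (subst sum_ennreal) auto
    also have "\<dots> = (\<Sum>i | i \<in> I \<and> (\<exists>t. ?x + t *\<^sub>R e \<in> ?S i).
        ennreal (J i) * indicator (closed_segment (n \<bullet> p i) (n \<bullet> q i)) r)"
      using r by (intro sum.cong) auto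
    also have "\<dots> \<le> (\<Sum>i\<in>I. ennreal (J i) * indicator (closed_segment (n \<bullet> p i) (n \<bullet> q i)) r)"
      using fin by (intro sum_mono2) auto
    finally show ?thesis .
  qed
  ultimately show ?thesis by (meson add_left_mono order_trans)
qed

text \<open>The means integrate to the integral of \<open>w\<close>, up to the Jacobian, and a jump is counted on the projection of its
edge, which is no longer than a multiple of the edge.\<close>

lemma integral_line_bound:
  fixes p q :: "'i \<Rightarrow> plane"
  assumes J: "\<And>i. i \<in> I \<Longrightarrow> 0 \<le> J i"
    and [measurable]: "w \<in> borel_measurable borel" "\<Omega> \<in> sets borel"
    and D: "rot e \<bullet> f \<noteq> 0" and h: "0 < h"
  defines "n \<equiv> (1 / (rot e \<bullet> f)) *\<^sub>R rot e"
  defines "W \<equiv> \<integral>\<^sup>+x. ennreal (w x) * indicator \<Omega> x \<partial>lborel"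
  shows "(\<integral>\<^sup>+r. (ennreal (1 / h) * (\<integral>\<^sup>+s. ennreal (w (s *\<^sub>R e + r *\<^sub>R f)) * indicator \<Omega> (s *\<^sub>R e + r *\<^sub>R f) \<partial>lborel)
      + (\<Sum>i\<in>I. ennreal (J i) * indicator (closed_segment (n \<bullet> p i) (n \<bullet> q i)) r)) \<partial>lborel)
    \<le> ennreal (1 / (h * \<bar>rot e \<bullet> f\<bar>) + norm e / \<bar>rot e \<bullet> f\<bar>) * (W + (\<Sum>i\<in>I. ennreal (J i * dist (p i) (q i))))"
proof -
  let ?D = "\<bar>rot e \<bullet> f\<bar>"
  let ?F = "\<lambda>r. \<integral>\<^sup>+s. ennreal (w (s *\<^sub>R e + r *\<^sub>R f)) * indicator \<Omega> (s *\<^sub>R e + r *\<^sub>R f) \<partial>lborel"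
  let ?S = "\<Sum>i\<in>I. ennreal (J i * dist (p i) (q i))"
  have "W = ennreal ?D * (\<integral>\<^sup>+r. ?F r \<partial>lborel)"
    unfolding W_def using nn_integral_oblique[of "\<lambda>x. ennreal (w x) * indicator \<Omega> x" e f] D by simp
  then have "ennreal (1 / ?D) * W = (ennreal (1 / ?D) * ennreal ?D) * (\<integral>\<^sup>+r. ?F r \<partial>lborel)"
    by (simp add: mult.assoc)
  also have "ennreal (1 / ?D) * ennreal ?D = 1" using D by (simp flip: ennreal_mult)
  finally have F: "(\<integral>\<^sup>+r. ?F r \<partial>lborel) = ennreal (1 / ?D) * W" by simp
  have nn: "norm n = norm e / ?D" by (simp add: n_def)
  have "(\<integral>\<^sup>+r. (ennreal (1 / h) * ?F r + (\<Sum>i\<in>I. ennreal (J i) * indicator (closed_segment (n \<bullet> p i) (n \<bullet> q i)) r)) \<partial>lborel)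
      = ennreal (1 / h) * (\<integral>\<^sup>+r. ?F r \<partial>lborel) + (\<Sum>i\<in>I. ennreal (J i) * ennreal \<bar>n \<bullet> p i - n \<bullet> q i\<bar>)"
    by (subst nn_integral_add)
      (auto simp: nn_integral_cmult nn_integral_sum nn_integral_cmult_indicator emeasure_real_segment)
  also have "\<dots> \<le> ennreal (1 / h) * (ennreal (1 / ?D) * W) + ennreal (norm e / ?D) * ?S"
  proof (intro add_mono)
    have "(\<Sum>i\<in>I. ennreal (J i) * ennreal \<bar>n \<bullet> p i - n \<bullet> q i\<bar>)
        \<le> (\<Sum>i\<in>I. ennreal (norm e / ?D) * ennreal (J i * dist (p i) (q i)))"
    proof (rule sum_mono)
      fix i assume i: "i \<in> I"
      have "\<bar>n \<bullet> p i - n \<bullet> q i\<bar> \<le> norm n * dist (p i) (q i)"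
        using Cauchy_Schwarz_ineq2[of n "p i - q i"] by (simp add: inner_diff_right dist_norm)
      then have "J i * \<bar>n \<bullet> p i - n \<bullet> q i\<bar> \<le> norm e / ?D * (J i * dist (p i) (q i))"
        using mult_left_mono[OF _ J[OF i]] by (fastforce simp: nn mult.left_commute)
      then show "ennreal (J i) * ennreal \<bar>n \<bullet> p i - n \<bullet> q i\<bar> \<le> ennreal (norm e / ?D) * ennreal (J i * dist (p i) (q i))"
        using J[OF i] by (simp flip: ennreal_mult)
    qed
    then show "(\<Sum>i\<in>I. ennreal (J i) * ennreal \<bar>n \<bullet> p i - n \<bullet> q i\<bar>) \<le> ennreal (norm e / ?D) * ?S"
      by (simp add: sum_distrib_left)
  qed (simp add: F)
  also have "\<dots> = ennreal (1 / (h * ?D)) * W + ennreal (norm e / ?D) * ?S"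
    using h by (simp add: mult.assoc[symmetric] flip: ennreal_mult)
  also have "\<dots> \<le> ennreal (1 / (h * ?D) + norm e / ?D) * (W + ?S)"
    using h unfolding distrib_left by (intro add_mono mult_right_mono ennreal_leI) auto
  finally show ?thesis .
qed

text \<open>The square of a value is at most the product of the bounds for the lines in two directions,
  each of which depends on one oblique coordinate only. This is the Gagliardo-Nirenberg argument,
  localised: the lines are followed only inside the domain.\<close>

lemma sobolev_patch:
  fixes p q :: "'i \<Rightarrow> plane"
  assumes st: "steps_bounded \<Omega> V I (\<lambda>i. closed_segment (p i) (q i)) J w"
    and fin: "finite I" "finite V" and J: "\<And>i. i \<in> I \<Longrightarrow> 0 \<le> J i"
    and pV: "\<And>i. i \<in> I \<Longrightarrow> p i \<in> V" and w0: "\<And>x. 0 \<le> w x"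
    and [measurable]: "w \<in> borel_measurable borel" "\<Omega> \<in> sets borel" "U \<in> sets borel"
    and D: "rot e \<bullet> f \<noteq> 0" and h: "0 < h"
    and x: "\<And>x t. x \<in> U \<inter> \<Omega> \<Longrightarrow> 0 \<le> t \<Longrightarrow> t \<le> h \<Longrightarrow> x + t *\<^sub>R e \<in> \<Omega> \<and> x + t *\<^sub>R f \<in> \<Omega>"
  defines "W \<equiv> (\<integral>\<^sup>+x. ennreal (w x) * indicator \<Omega> x \<partial>lborel)"
  defines "K \<equiv> 1 / (h * \<bar>rot e \<bullet> f\<bar>) + norm e / \<bar>rot e \<bullet> f\<bar> + norm f / \<bar>rot e \<bullet> f\<bar>"
  shows "(\<integral>\<^sup>+x. ennreal ((w x)\<^sup>2) * indicator (U \<inter> \<Omega>) x \<partial>lborel)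
    \<le> ennreal (\<bar>rot e \<bullet> f\<bar> * K\<^sup>2) * (W + (\<Sum>i\<in>I. ennreal (J i * dist (p i) (q i))))\<^sup>2"
proof -
  let ?D = "\<bar>rot e \<bullet> f\<bar>"
  let ?S = "\<lambda>i. closed_segment (p i) (q i)"
  let ?SS = "\<Sum>i\<in>I. ennreal (J i * dist (p i) (q i))"
  define ne where "ne = (1 / (rot e \<bullet> f)) *\<^sub>R rot e"
  define nf where "nf = (1 / (rot f \<bullet> e)) *\<^sub>R rot f"
  have D': "rot f \<bullet> e = - (rot e \<bullet> f)" by (simp add: rot_inner)
  have ne: "ne \<bullet> e = 0" "ne \<bullet> f = 1" using D by (auto simp: ne_def)
  have nf: "nf \<bullet> f = 0" "nf \<bullet> e = 1" using D D' by (auto simp: nf_def)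
  have nz: "e \<noteq> 0" "f \<noteq> 0" using D by (auto simp: rot_inner)
  define G where "G = (\<lambda>r. ennreal (1 / h) * (\<integral>\<^sup>+s. ennreal (w (s *\<^sub>R e + r *\<^sub>R f)) * indicator \<Omega> (s *\<^sub>R e + r *\<^sub>R f) \<partial>lborel)
      + (\<Sum>i\<in>I. ennreal (J i) * indicator (closed_segment (ne \<bullet> p i) (ne \<bullet> q i)) r))"
  define H where "H = (\<lambda>r. ennreal (1 / h) * (\<integral>\<^sup>+s. ennreal (w (s *\<^sub>R f + r *\<^sub>R e)) * indicator \<Omega> (s *\<^sub>R f + r *\<^sub>R e) \<partial>lborel)
      + (\<Sum>i\<in>I. ennreal (J i) * indicator (closed_segment (nf \<bullet> p i) (nf \<bullet> q i)) r))"
  have [measurable]: "G \<in> borel_measurable borel" "H \<in> borel_measurable borel"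
    unfolding G_def H_def by measurable
  have GH: "(\<integral>\<^sup>+r. G r \<partial>lborel) \<le> ennreal K * (W + ?SS)" "(\<integral>\<^sup>+r. H r \<partial>lborel) \<le> ennreal K * (W + ?SS)"
  proof -
    have "(\<integral>\<^sup>+r. G r \<partial>lborel) \<le> ennreal (1 / (h * ?D) + norm e / ?D) * (W + ?SS)"
      unfolding G_def ne_def W_def by (rule integral_line_bound[OF J _ _ D h]) auto
    also have "\<dots> \<le> ennreal K * (W + ?SS)"
      unfolding K_def by (intro mult_right_mono ennreal_leI) auto
    finally show "(\<integral>\<^sup>+r. G r \<partial>lborel) \<le> ennreal K * (W + ?SS)" .
    have "(\<integral>\<^sup>+r. H r \<partial>lborel) \<le> ennreal (1 / (h * \<bar>rot f \<bullet> e\<bar>) + norm f / \<bar>rot f \<bullet> e\<bar>) * (W + ?SS)"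
      unfolding H_def nf_def W_def by (rule integral_line_bound[OF J _ _ _ h]) (use D D' in auto)
    also have "\<dots> \<le> ennreal K * (W + ?SS)"
      unfolding K_def D' by (intro mult_right_mono ennreal_leI) auto
    finally show "(\<integral>\<^sup>+r. H r \<partial>lborel) \<le> ennreal K * (W + ?SS)" .
  qed
  \<comment> \<open>The line bounds may fail on the segments and on the lines through the points of \<open>V\<close>.\<close>
  define N where "N = (\<Union>i\<in>I. ?S i) \<union> (\<Union>v\<in>V. {x. ne \<bullet> x = ne \<bullet> v}) \<union> (\<Union>v\<in>V. {x. nf \<bullet> x = nf \<bullet> v})"
  have "negligible N"
  proof -
    have "negligible (?S i)" for i by (rule negligible_convex_interior[THEN iffD2]) (simp_all add: interior_closed_segment_ge2)
    moreover have "ne \<noteq> 0" "nf \<noteq> 0" using ne nf by auto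
    ultimately show ?thesis unfolding N_def using fin
      by (intro negligible_Un negligible_Union finite_imageI) (auto intro: negligible_hyperplane)
  qed
  have "closed N"
    unfolding N_def using fin by (intro closed_Un closed_UN) (auto simp: closed_hyperplane)
  then have "N \<in> null_sets lborel"
    using \<open>negligible N\<close> by (simp add: negligible_iff_null_sets null_sets_completion_iff borel_closed)
  then have AE: "AE x in lborel. x \<notin> N" by (rule AE_not_in)
  have bound: "ennreal ((w x)\<^sup>2) * indicator (U \<inter> \<Omega>) x \<le> G (ne \<bullet> x) * H (nf \<bullet> x)" if xN: "x \<notin> N" for x
  proof (cases "x \<in> U \<inter> \<Omega>")
    case True
    have xx: "x = (nf \<bullet> x) *\<^sub>R e + (ne \<bullet> x) *\<^sub>R f"
    proof -
      define y where "y = x - ((nf \<bullet> x) *\<^sub>R e + (ne \<bullet> x) *\<^sub>R f)"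
      have "ne \<bullet> y = 0" "nf \<bullet> y = 0" using ne nf by (auto simp: y_def inner_diff_right inner_add_right)
      then have "rot e \<bullet> y = 0" "rot f \<bullet> y = 0" using D D' by (auto simp: ne_def nf_def)
      then obtain c where c: "y = c *\<^sub>R e" using rot_inner_eq_0_imp nz by blast
      with \<open>rot f \<bullet> y = 0\<close> D D' have "c = 0" by auto
      with c show ?thesis by (simp add: y_def)
    qed
    then have xx': "x = (ne \<bullet> x) *\<^sub>R f + (nf \<bullet> x) *\<^sub>R e" by (simp add: add.commute)
    have wG: "ennreal (w x) \<le> G (ne \<bullet> x)"
      unfolding G_def
      by (subst xx, rule value_le_line_bound[OF st fin(1) J pV _ _ ne(1) nz(1) ne(2) h])
        (use x[OF True] xN in \<open>auto simp: xx[symmetric] N_def\<close>)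
    have wH: "ennreal (w x) \<le> H (nf \<bullet> x)"
      unfolding H_def
      by (subst xx', rule value_le_line_bound[OF st fin(1) J pV _ _ nf(1) nz(2) nf(2) h])
        (use x[OF True] xN in \<open>auto simp: xx'[symmetric] N_def\<close>)
    have "ennreal ((w x)\<^sup>2) * indicator (U \<inter> \<Omega>) x = ennreal (w x) * ennreal (w x)"
      using True w0 by (simp add: power2_eq_square ennreal_mult)
    also have "\<dots> \<le> G (ne \<bullet> x) * H (nf \<bullet> x)" by (intro mult_mono wG wH) auto
    finally show ?thesis .
  qed simp
  have "(\<integral>\<^sup>+x. ennreal ((w x)\<^sup>2) * indicator (U \<inter> \<Omega>) x \<partial>lborel) \<le> (\<integral>\<^sup>+x. G (ne \<bullet> x) * H (nf \<bullet> x) \<partial>lborel)"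
    by (rule nn_integral_mono_AE) (use AE bound in \<open>auto elim: eventually_mono\<close>)
  also have "\<dots> = ennreal ?D * (\<integral>\<^sup>+t. \<integral>\<^sup>+s. G (ne \<bullet> (s *\<^sub>R e + t *\<^sub>R f)) * H (nf \<bullet> (s *\<^sub>R e + t *\<^sub>R f)) \<partial>lborel \<partial>lborel)"
    by (rule nn_integral_oblique[OF _ D]) measurable
  also have "(\<integral>\<^sup>+t. \<integral>\<^sup>+s. G (ne \<bullet> (s *\<^sub>R e + t *\<^sub>R f)) * H (nf \<bullet> (s *\<^sub>R e + t *\<^sub>R f)) \<partial>lborel \<partial>lborel)
      = (\<integral>\<^sup>+t. G t \<partial>lborel) * (\<integral>\<^sup>+s. H s \<partial>lborel)"
    using ne nf by (simp add: inner_add_right nn_integral_cmult nn_integral_multc)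
  also have "ennreal ?D * ((\<integral>\<^sup>+t. G t \<partial>lborel) * (\<integral>\<^sup>+s. H s \<partial>lborel))
      \<le> ennreal ?D * ((ennreal K * (W + ?SS)) * (ennreal K * (W + ?SS)))"
    by (intro mult_left_mono mult_mono GH) auto
  also have "\<dots> = ennreal (?D * K\<^sup>2) * (W + ?SS)\<^sup>2"
  proof -
    have "0 \<le> K" using h by (simp add: K_def)
    then have "ennreal (?D * K\<^sup>2) = ennreal ?D * (ennreal K * ennreal K)"
      by (simp add: power2_eq_square ennreal_mult)
    then show ?thesis by (simp add: power2_eq_square ac_simps)
  qed
  finally show ?thesis .
qed

lemma orthonormal_expansion:
  fixes a b v :: plane
  assumes "norm a = 1" "norm b = 1" "a \<bullet> b = 0"
  shows "v = (v \<bullet> a) *\<^sub>R a + (v \<bullet> b) *\<^sub>R b"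
proof -
  have aa: "a \<bullet> a = 1" "b \<bullet> b = 1" "b \<bullet> a = 0"
    using assms by (auto simp: dot_square_norm inner_commute)
  define y where "y = v - ((v \<bullet> a) *\<^sub>R a + (v \<bullet> b) *\<^sub>R b)"
  have ya: "y \<bullet> a = 0" and yb: "y \<bullet> b = 0"
    using aa assms(3) by (auto simp: y_def inner_diff_left inner_add_left)
  have "a \<noteq> 0" using assms(1) by auto
  then have "b = rot a \<or> b = - rot a"
    using unit_normal_eq[of b a] assms aa by (auto simp: inner_commute)
  then have "rot a \<bullet> y = 0" using yb by (auto simp: inner_commute)
  then obtain c where "y = c *\<^sub>R a"
    using rot_inner_eq_0_imp[of a y] assms(1) by fastforce
  then have "y = 0" using ya aa(1) by simp
  then show ?thesis by (simp add: y_def)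
qed

text \<open>Near a boundary point the domain is the epigraph of a Lipschitz function, and it contains the short
segments that start in it upwards or in a slightly inclined direction. At an interior point any two
directions will do.\<close>

lemma lipschitz_domain_local_directions:
  assumes \<Omega>: "lipschitz_domain \<Omega>" and x: "x \<in> closure \<Omega>"
  shows "\<exists>U e f h. open U \<and> x \<in> U \<and> rot e \<bullet> f \<noteq> 0 \<and> 0 < h \<and>
    (\<forall>y\<in>U \<inter> \<Omega>. \<forall>t. 0 \<le> t \<and> t \<le> h \<longrightarrow> y + t *\<^sub>R e \<in> \<Omega> \<and> y + t *\<^sub>R f \<in> \<Omega>)"
proof (cases "x \<in> \<Omega>")
  case True
  have "open \<Omega>" using \<Omega> by (simp add: lipschitz_domain_def)
  then obtain r where r: "r > 0" "ball x r \<subseteq> \<Omega>" using True openE by blast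
  have "y + t *\<^sub>R e \<in> \<Omega>" if "y \<in> ball x (r/2)" "0 \<le> t" "t \<le> r / 2" "norm e = 1" for y t and e :: plane
  proof -
    have "dist x (y + t *\<^sub>R e) \<le> dist x y + dist y (y + t *\<^sub>R e)" by (rule dist_triangle)
    also have "\<dots> < r" using that by (simp add: dist_norm[of y])
    finally show ?thesis using r(2) by auto
  qed
  moreover have "rot (axis 1 1) \<bullet> axis 2 1 \<noteq> 0" by (simp add: rot_inner axis_def)
  ultimately show ?thesis using r(1)
    by (intro exI[of _ "ball x (r/2)"] exI[of _ "axis 1 1"] exI[of _ "axis 2 1"] exI[of _ "r/2"])
      (auto simp: norm_axis_1)
next
  case False
  have "open \<Omega>" using \<Omega> by (simp add: lipschitz_domain_def)
  with x False have "x \<in> frontier \<Omega>" by (simp add: frontier_def interior_open)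
  then obtain a b r h L \<phi> where ab: "norm a = 1" "norm b = 1" "a \<bullet> b = 0" and rh: "0 < r" "0 < h"
    and L: "L-lipschitz_on {-r<..<r} \<phi>"
    and epi: "\<And>s t. s \<in> {-r<..<r} \<Longrightarrow> t \<in> {-h<..<h} \<Longrightarrow> x + s *\<^sub>R a + t *\<^sub>R b \<in> \<Omega> \<longleftrightarrow> \<phi> s < t"
    using \<Omega> unfolding lipschitz_domain_def by metis
  have L0: "0 \<le> L" using L by (rule lipschitz_on_nonneg)
  \<comment> \<open>An inclination that is too flat for the graph to catch up.\<close>
  define \<delta> where "\<delta> = 1 / (L + 1)"
  have d: "0 < \<delta>" "\<delta> \<le> 1" "L * \<delta> \<le> 1" using L0 by (auto simp: \<delta>_def field_simps)
  define U where "U = {y. \<bar>(y - x) \<bullet> a\<bar> < r / 2 \<and> \<bar>(y - x) \<bullet> b\<bar> < h / 2}"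
  have "open U" unfolding U_def
    by (intro open_Collect_conj open_Collect_less continuous_intros)
  moreover have "x \<in> U" using rh by (simp add: U_def)
  moreover have "rot b \<bullet> (b + \<delta> *\<^sub>R a) \<noteq> 0"
  proof
    assume "rot b \<bullet> (b + \<delta> *\<^sub>R a) = 0"
    then have "rot b \<bullet> a = 0" using d by (simp add: inner_add_right)
    then obtain c where "a = c *\<^sub>R b" using rot_inner_eq_0_imp[of b a] ab by fastforce
    then show False using ab by (auto simp: dot_square_norm)
  qed
  moreover define k where "k = min (h / 2) (r / 2)"
  have "0 < k" using rh by (simp add: k_def)
  moreover have "y + t *\<^sub>R (b + c *\<^sub>R a) \<in> \<Omega>"
    if y: "y \<in> U \<inter> \<Omega>" and t: "0 \<le> t" "t \<le> k" and c: "0 \<le> c" "c \<le> \<delta>" for y t c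
  proof -
    define s\<^sub>0 where "s\<^sub>0 = (y - x) \<bullet> a"
    define t\<^sub>0 where "t\<^sub>0 = (y - x) \<bullet> b"
    have st: "\<bar>s\<^sub>0\<bar> < r / 2" "\<bar>t\<^sub>0\<bar> < h / 2" using y by (auto simp: U_def s\<^sub>0_def t\<^sub>0_def)
    have yy: "y = x + s\<^sub>0 *\<^sub>R a + t\<^sub>0 *\<^sub>R b"
      using orthonormal_expansion[OF ab, of "y - x"] by (simp add: s\<^sub>0_def t\<^sub>0_def algebra_simps)
    have "s\<^sub>0 \<in> {-r<..<r}" "t\<^sub>0 \<in> {-h<..<h}" using st by auto
    then have "\<phi> s\<^sub>0 < t\<^sub>0" using epi[of s\<^sub>0 t\<^sub>0] y yy by auto
    have tc: "0 \<le> t * c" "t * c \<le> t" using t c d by (auto intro: mult_left_le)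
    have in_r: "s\<^sub>0 \<in> {-r<..<r}" "s\<^sub>0 + t * c \<in> {-r<..<r}" "t\<^sub>0 + t \<in> {-h<..<h}"
      using st t tc unfolding k_def by auto
    have "\<phi> (s\<^sub>0 + t * c) - \<phi> s\<^sub>0 \<le> L * (t * c)"
      using lipschitz_onD[OF L in_r(2,1)] tc by (simp add: dist_real_def)
    also have "\<dots> \<le> t * (L * \<delta>)" using L0 t c by (simp add: mult_left_mono mult.left_commute)
    also have "\<dots> \<le> t" using d t by (simp add: mult_left_le)
    finally have "\<phi> (s\<^sub>0 + t * c) < t\<^sub>0 + t" using \<open>\<phi> s\<^sub>0 < t\<^sub>0\<close> by linarith
    then have "x + (s\<^sub>0 + t * c) *\<^sub>R a + (t\<^sub>0 + t) *\<^sub>R b \<in> \<Omega>" using epi in_r by blast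
    then show ?thesis unfolding yy by (simp add: algebra_simps)
  qed
  from this[of _ _ 0] this[of _ _ \<delta>]
  have "\<forall>y\<in>U \<inter> \<Omega>. \<forall>t. 0 \<le> t \<and> t \<le> k \<longrightarrow> y + t *\<^sub>R b \<in> \<Omega> \<and> y + t *\<^sub>R (b + \<delta> *\<^sub>R a) \<in> \<Omega>"
    using d by auto
  ultimately show ?thesis by blast
qed

text \<open>The Sobolev inequality between the exponents 1 and 2, squared, for functions with jumps across the segments from \<open>p i\<close> to
\<open>q i\<close>. The index \<open>i\<close> is a plane set because primal and dual edges are both indexed by primal edges.\<close>

definition sobolev_constant :: "plane set \<Rightarrow> real \<Rightarrow> bool" where
  "sobolev_constant \<Omega> C \<longleftrightarrow>
     (\<forall>V (I :: plane set set) p q J w.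
        finite I \<longrightarrow> finite V \<longrightarrow> (\<forall>i\<in>I. 0 \<le> J i \<and> p i \<in> V) \<longrightarrow>
        (\<forall>x. 0 \<le> w x) \<longrightarrow> w \<in> borel_measurable borel \<longrightarrow>
        steps_bounded \<Omega> V I (\<lambda>i. closed_segment (p i) (q i)) J w \<longrightarrow>
        (\<integral>\<^sup>+x. ennreal ((w x)\<^sup>2) * indicator \<Omega> x \<partial>lborel)
          \<le> ennreal C * ((\<integral>\<^sup>+x. ennreal (w x) * indicator \<Omega> x \<partial>lborel)
              + (\<Sum>i\<in>I. ennreal (J i * dist (p i) (q i))))\<^sup>2)"

theorem piecewise_constant_sobolev:
  assumes \<Omega>: "lipschitz_domain \<Omega>" "bounded \<Omega>"
  shows "\<exists>C>0. sobolev_constant \<Omega> C"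
proof -
  have op: "open \<Omega>" using \<Omega> by (simp add: lipschitz_domain_def)
  obtain U e f h where U: "\<And>x. x \<in> closure \<Omega> \<Longrightarrow> open (U x) \<and> x \<in> U x \<and> rot (e x) \<bullet> f x \<noteq> 0 \<and> 0 < (h x :: real) \<and>
    (\<forall>y\<in>U x \<inter> \<Omega>. \<forall>t. 0 \<le> t \<and> t \<le> h x \<longrightarrow> y + t *\<^sub>R e x \<in> \<Omega> \<and> y + t *\<^sub>R f x \<in> \<Omega>)"
    using lipschitz_domain_local_directions[OF \<Omega>(1)] by metis
  have "compact (closure \<Omega>)" using \<Omega>(2) by simp
  then obtain F where F: "F \<subseteq> closure \<Omega>" "finite F" "closure \<Omega> \<subseteq> (\<Union>x\<in>F. U x)"
    using compactE_image[of "closure \<Omega>" "closure \<Omega>" U] U by blast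
  define c where "c = (\<lambda>x. \<bar>rot (e x) \<bullet> f x\<bar> * (1 / (h x * \<bar>rot (e x) \<bullet> f x\<bar>)
      + norm (e x) / \<bar>rot (e x) \<bullet> f x\<bar> + norm (f x) / \<bar>rot (e x) \<bullet> f x\<bar>)\<^sup>2)"
  have c0: "0 \<le> c x" for x by (simp add: c_def)
  show ?thesis
    unfolding sobolev_constant_def
  proof (rule exI[of _ "(\<Sum>x\<in>F. c x) + 1"], intro conjI allI impI)
    show "0 < (\<Sum>x\<in>F. c x) + 1" using c0 by (simp add: add_nonneg_pos sum_nonneg)
    fix V and I :: "plane set set" and p q :: "plane set \<Rightarrow> plane" and J w
    assume fin: "finite I" "finite V" and Jp: "\<forall>i\<in>I. 0 \<le> J i \<and> p i \<in> V" and w0: "\<forall>x. 0 \<le> w x"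
      and wm[measurable]: "w \<in> borel_measurable borel"
      and st: "steps_bounded \<Omega> V I (\<lambda>i. closed_segment (p i) (q i)) J w"
    have [measurable]: "\<Omega> \<in> sets borel" using op by simp
    have Um[measurable]: "U x \<in> sets borel" if "x \<in> F" for x using U that F(1) by auto
    let ?R = "((\<integral>\<^sup>+x. ennreal (w x) * indicator \<Omega> x \<partial>lborel) + (\<Sum>i\<in>I. ennreal (J i * dist (p i) (q i))))\<^sup>2"
    have "(\<integral>\<^sup>+x. ennreal ((w x)\<^sup>2) * indicator \<Omega> x \<partial>lborel)
        \<le> (\<integral>\<^sup>+x. (\<Sum>y\<in>F. ennreal ((w x)\<^sup>2) * indicator (U y \<inter> \<Omega>) x) \<partial>lborel)"
    proof (rule nn_integral_mono)
      fix x
      show "ennreal ((w x)\<^sup>2) * indicator \<Omega> x \<le> (\<Sum>y\<in>F. ennreal ((w x)\<^sup>2) * indicator (U y \<inter> \<Omega>) x)"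
      proof (cases "x \<in> \<Omega>")
        case True
        then obtain y where y: "y \<in> F" "x \<in> U y" using F(3) closure_subset by blast
        have "ennreal ((w x)\<^sup>2) * indicator \<Omega> x = ennreal ((w x)\<^sup>2) * indicator (U y \<inter> \<Omega>) x"
          using True y by simp
        also have "\<dots> \<le> (\<Sum>y\<in>F. ennreal ((w x)\<^sup>2) * indicator (U y \<inter> \<Omega>) x)"
          using y F(2) by (intro member_le_sum) auto
        finally show ?thesis .
      qed simp
    qed
    also have "\<dots> = (\<Sum>y\<in>F. \<integral>\<^sup>+x. ennreal ((w x)\<^sup>2) * indicator (U y \<inter> \<Omega>) x \<partial>lborel)"
      using Um by (intro nn_integral_sum) measurable
    also have "\<dots> \<le> (\<Sum>y\<in>F. ennreal (c y) * ?R)"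
    proof (rule sum_mono)
      fix y assume y: "y \<in> F"
      then have "y \<in> closure \<Omega>" using F(1) by blast
      note Uy = U[OF this]
      show "(\<integral>\<^sup>+x. ennreal ((w x)\<^sup>2) * indicator (U y \<inter> \<Omega>) x \<partial>lborel) \<le> ennreal (c y) * ?R"
        unfolding c_def
        by (rule sobolev_patch[OF st fin _ _ _ wm _ Um[OF y]]) (use Jp w0 Uy in auto)
    qed
    also have "\<dots> = ennreal (\<Sum>y\<in>F. c y) * ?R"
      using c0 by (simp add: sum_distrib_right[symmetric] sum_ennreal)
    also have "\<dots> \<le> ennreal ((\<Sum>y\<in>F. c y) + 1) * ?R"
      by (intro mult_right_mono ennreal_leI) auto
    finally show "(\<integral>\<^sup>+x. ennreal ((w x)\<^sup>2) * indicator \<Omega> x \<partial>lborel) \<le> ennreal ((\<Sum>y\<in>F. c y) + 1) * ?R" .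
  qed
qed

section \<open>From the first power to higher exponents\<close>

lemma weighted_Hoelder_sum:
  fixes a x y :: "'i \<Rightarrow> real"
  assumes pq: "p > 1" "q > 1" "1 / p + 1 / q = 1"
    and a: "\<And>i. i \<in> I \<Longrightarrow> 0 \<le> a i" and x: "\<And>i. i \<in> I \<Longrightarrow> 0 \<le> x i" and y: "\<And>i. i \<in> I \<Longrightarrow> 0 \<le> y i"
  shows "(\<Sum>i\<in>I. a i * x i * y i) \<le> (\<Sum>i\<in>I. a i * x i powr p) powr (1 / p) * (\<Sum>i\<in>I. a i * y i powr q) powr (1 / q)"
proof (cases "finite I")
  case fin: True
  define X where "X = (\<Sum>i\<in>I. a i * x i powr p)"
  define Y where "Y = (\<Sum>i\<in>I. a i * y i powr q)"
  have XY0: "0 \<le> X" "0 \<le> Y" unfolding X_def Y_def using a by (auto intro!: sum_nonneg)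
  show ?thesis
  proof (cases "X = 0 \<or> Y = 0")
    case True
    have "a i * x i * y i = 0" if i: "i \<in> I" for i
    proof -
      have "a i * x i powr p = 0 \<or> a i * y i powr q = 0"
        using True a i fin unfolding X_def Y_def by (subst (asm) (1 2) sum_nonneg_eq_0_iff) auto
      then show ?thesis by auto
    qed
    then have "(\<Sum>i\<in>I. a i * x i * y i) = 0" by (rule sum.neutral[OF ballI])
    then show ?thesis by simp
  next
    case False
    then have pos: "0 < X" "0 < Y" using XY0 by auto
    let ?cx = "X powr (1 / p)" and ?cy = "Y powr (1 / q)"
    have c: "0 < ?cx" "0 < ?cy" using pos by auto
    have cp: "?cx powr p = X" "?cy powr q = Y" using pq pos by (auto simp: powr_powr)
    have "(\<Sum>i\<in>I. a i * x i * y i) / (?cx * ?cy) = (\<Sum>i\<in>I. a i * ((x i / ?cx) * (y i / ?cy)))"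
      by (simp add: sum_divide_distrib mult.assoc)
    also have "\<dots> \<le> (\<Sum>i\<in>I. a i * ((x i / ?cx) powr p / p + (y i / ?cy) powr q / q))"
      using pq a x y c by (intro sum_mono mult_left_mono Youngs_inequality) auto
    also have "\<dots> = (\<Sum>i\<in>I. a i * x i powr p) / X / p + (\<Sum>i\<in>I. a i * y i powr q) / Y / q"
      using x y c by (simp add: powr_divide cp sum.distrib distrib_left sum_divide_distrib)
    also have "\<dots> = 1" using pos pq by (simp flip: X_def Y_def)
    finally show ?thesis using c by (simp add: X_def Y_def pos_divide_le_eq)
  qed
qed simp

text \<open>Hoelder's inequality against the constant function 1.\<close>

lemma power_sum_mono_exponent:
  fixes m x :: "'i \<Rightarrow> real"
  assumes m: "\<And>i. i \<in> I \<Longrightarrow> 0 \<le> m i" and x: "\<And>i. i \<in> I \<Longrightarrow> 0 \<le> x i"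
    and M: "0 < (\<Sum>i\<in>I. m i)" and rt: "0 < r" "r \<le> t"
  shows "(\<Sum>i\<in>I. m i * x i powr r) \<le> (\<Sum>i\<in>I. m i * x i powr t) powr (r / t) * (\<Sum>i\<in>I. m i) powr (1 - r / t)"
proof (cases "r = t")
  case True
  have "0 \<le> (\<Sum>i\<in>I. m i * x i powr t)" using m by (auto intro!: sum_nonneg)
  then show ?thesis using True rt M by simp
next
  case False
  let ?p = "t / r" let ?q = "t / (t - r)"
  have pq: "?p > 1" "?q > 1" "1 / ?p + 1 / ?q = 1" using rt False by (auto simp: field_simps)
  have "(\<Sum>i\<in>I. m i * x i powr r * 1) \<le>
      (\<Sum>i\<in>I. m i * (x i powr r) powr ?p) powr (1 / ?p) * (\<Sum>i\<in>I. m i * 1 powr ?q) powr (1 / ?q)"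
    by (rule weighted_Hoelder_sum[OF pq m]) auto
  moreover have "(x powr r) powr ?p = x powr t" for x :: real using rt by (simp add: powr_powr)
  moreover have "1 / ?p = r / t" "1 / ?q = 1 - r / t" using rt False by (auto simp: field_simps)
  ultimately show ?thesis by simp
qed

text \<open>The mean value theorem; the sum on the right replaces the maximum of its two terms.\<close>

lemma powr_diff_le:
  fixes a b s :: real
  assumes "1 \<le> s" "0 \<le> a" "0 \<le> b"
  shows "\<bar>a powr s - b powr s\<bar> \<le> s * (a powr (s - 1) + b powr (s - 1)) * \<bar>a - b\<bar>"
proof -
  have *: "a powr s - b powr s \<le> s * a powr (s - 1) * (a - b)" if ab: "0 \<le> b" "b < a" for a b
  proof (cases "b = 0")
    case True
    have "a powr s = a powr (s - 1) * a" using ab by (metis add.commute diff_add_cancel le_less_trans less_imp_le powr_add powr_one)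
    then show ?thesis using True assms(1) ab by simp
  next
    case False
    then have "\<exists>z>b. z < a \<and> a powr s - b powr s = (a - b) * (s * z powr (s - 1))"
      using ab by (intro MVT2) (auto intro!: derivative_eq_intros simp: powr_diff)
    then obtain z where z: "b < z" "z < a" "a powr s - b powr s = (a - b) * (s * z powr (s - 1))" by blast
    have "z powr (s - 1) \<le> a powr (s - 1)" using z ab assms(1) by (intro powr_mono2) auto
    then have "(a - b) * (s * z powr (s - 1)) \<le> (a - b) * (s * a powr (s - 1))"
      using ab assms(1) by (intro mult_left_mono) auto
    then show ?thesis using z(3) by (simp add: mult_ac)
  qed
  have mono: "b powr s \<le> a powr s" if "0 \<le> b" "b < a" for a b :: real
    using that assms(1) by (intro powr_mono2) auto
  consider "a = b" | "b < a" | "a < b" by linarith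
  then show ?thesis
  proof cases
    case 2
    have "\<bar>a powr s - b powr s\<bar> \<le> s * a powr (s - 1) * (a - b)" using * mono 2 assms by auto
    also have "\<dots> \<le> s * (a powr (s - 1) + b powr (s - 1)) * (a - b)"
      using assms 2 by (intro mult_right_mono mult_left_mono) auto
    finally show ?thesis using 2 by simp
  next
    case 3
    have "\<bar>a powr s - b powr s\<bar> \<le> s * b powr (s - 1) * (b - a)" using *[of a b] mono[of a b] 3 assms by auto
    also have "\<dots> \<le> s * (a powr (s - 1) + b powr (s - 1)) * (b - a)"
      using assms 3 by (intro mult_right_mono mult_left_mono) auto
    finally show ?thesis using 3 by simp
  qed simp
qed

text \<open>This is how condition (R2) enters. The predicate \<open>P i e\<close>, that \<open>e\<close> is an edge of the cell \<open>i\<close>, may hold for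
more edges than those labelled with \<open>i\<close>.\<close>

lemma sum_edges_le_sum_cells:
  fixes a :: "'e \<Rightarrow> real" and k :: "'e \<Rightarrow> 'i"
  assumes fin: "finite E" "finite I" and k: "\<And>e. e \<in> E \<Longrightarrow> k e \<in> I"
    and a: "\<And>e. e \<in> E \<Longrightarrow> 0 \<le> a e" and F: "\<And>i. i \<in> I \<Longrightarrow> 0 \<le> F i"
    and R2: "\<And>i. i \<in> I \<Longrightarrow> (\<Sum>e | e \<in> E \<and> P i e. a e) \<le> m i / \<zeta>" and P: "\<And>e. e \<in> E \<Longrightarrow> P (k e) e"
  shows "(\<Sum>e\<in>E. a e * F (k e)) \<le> (\<Sum>i\<in>I. m i * F i) / \<zeta>"
proof -
  have "(\<Sum>e\<in>E. a e * F (k e)) = (\<Sum>i\<in>I. \<Sum>e | e \<in> E \<and> k e = i. a e * F (k e))"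
    using fin k by (intro sum.group[symmetric]) auto
  also have "\<dots> = (\<Sum>i\<in>I. (\<Sum>e | e \<in> E \<and> k e = i. a e) * F i)"
    by (intro sum.cong) (auto simp: sum_distrib_right)
  also have "\<dots> \<le> (\<Sum>i\<in>I. (m i / \<zeta>) * F i)"
  proof (intro sum_mono mult_right_mono F)
    fix i assume i: "i \<in> I"
    have "(\<Sum>e | e \<in> E \<and> k e = i. a e) \<le> (\<Sum>e | e \<in> E \<and> P i e. a e)"
      using fin a P by (intro sum_mono2) auto
    then show "(\<Sum>e | e \<in> E \<and> k e = i. a e) \<le> m i / \<zeta>" using R2[OF i] by linarith
  qed
  finally show ?thesis by (simp add: sum_divide_distrib)
qed

text \<open>The discrete functional inequality on an abstract mesh with cells \<open>i\<close> of area \<open>m i\<close> and edges \<open>e\<close> between the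
cells \<open>k e\<close> and \<open>l e\<close>, given the inequality between the exponents 1 and 2 for all functions. The latter is
applied to the power \<open>s\<close> of \<open>\<bar>u\<bar>\<close>. Writing \<open>A r\<close> for the integral of \<open>\<bar>u\<bar>\<close> to the power \<open>r\<close>, for \<open>p > 1\<close> the terms on
the right all carry a factor \<open>A t powr (1 / p')\<close> with \<open>t = (s - 1) p'\<close>. The condition \<open>(s - 1) p \<le> 2 s (p - 1)\<close>
says \<open>t \<le> 2 s\<close>, so that this factor is absorbed by the left-hand side.\<close>

lemma sobolev_from_power_one:
  fixes m :: "'i \<Rightarrow> real" and k l :: "'e \<Rightarrow> 'i" and u :: "'i \<Rightarrow> real"
  assumes fin: "finite I" "finite E" and m: "\<And>i. i \<in> I \<Longrightarrow> 0 \<le> m i"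
    and kl: "\<And>e. e \<in> E \<Longrightarrow> k e \<in> I \<and> l e \<in> I"
    and len: "\<And>e. e \<in> E \<Longrightarrow> 0 \<le> len e" "\<And>e. e \<in> E \<Longrightarrow> 0 \<le> dlen e" and g: "\<And>e. e \<in> E \<Longrightarrow> 0 \<le> g e"
    and grad: "\<And>e. e \<in> E \<Longrightarrow> \<bar>u (l e) - u (k e)\<bar> \<le> g e * dlen e"
    and sob: "\<And>f. (\<And>i. 0 \<le> f i) \<Longrightarrow> (\<Sum>i\<in>I. m i * (f i)\<^sup>2)
       \<le> C * ((\<Sum>i\<in>I. m i * f i) + (\<Sum>e\<in>E. \<bar>f (l e) - f (k e)\<bar> * len e))\<^sup>2" and C: "0 \<le> C"
    and R2: "\<And>i. i \<in> I \<Longrightarrow> (\<Sum>e | e \<in> E \<and> P i e. len e * dlen e) \<le> m i / \<zeta>"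
    and P: "\<And>e. e \<in> E \<Longrightarrow> P (k e) e \<and> P (l e) e" and \<zeta>: "0 < \<zeta>"
    and M: "0 < (\<Sum>i\<in>I. m i)"
    and p: "1 \<le> p" and q: "1 \<le> q" "q \<le> 2 * s" and s: "1 \<le> s" "(s - 1) * p \<le> 2 * s * (p - 1)" "p = 1 \<or> s > 1"
  defines "MM \<equiv> (\<Sum>i\<in>I. m i)"
  shows "(\<Sum>i\<in>I. m i * \<bar>u i\<bar> powr q) powr (1 / q) \<le>
     2 * s * sqrt C * MM powr ((p - 1) / p - (s - 1) / (2 * s)) * MM powr (1 / q - 1 / (2 * s)) *
     ((\<Sum>i\<in>I. m i * \<bar>u i\<bar> powr p) powr (1 / p)
      + (1 / \<zeta>) powr ((p - 1) / p) * (\<Sum>e\<in>E. len e * dlen e * g e powr p) powr (1 / p))"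
proof -
  define A where "A = (\<lambda>r. \<Sum>i\<in>I. m i * \<bar>u i\<bar> powr r)"
  define G where "G = (\<Sum>e\<in>E. len e * dlen e * g e powr p)"
  have A0: "0 \<le> A r" for r unfolding A_def using m by (auto intro!: sum_nonneg)
  have G0: "0 \<le> G" unfolding G_def using len by (auto intro!: sum_nonneg)
  let ?z = "(1 / \<zeta>) powr ((p - 1) / p)"
  let ?R = "A p powr (1 / p) + ?z * G powr (1 / p)"
  have R0: "0 \<le> ?R" by simp
  have sq: "(\<bar>u i\<bar> powr s)\<^sup>2 = \<bar>u i\<bar> powr (2 * s)" for i
    by (simp add: power2_eq_square powr_add[symmetric])
  have "A (2 * s) \<le> C * (A s + (\<Sum>e\<in>E. \<bar>\<bar>u (l e)\<bar> powr s - \<bar>u (k e)\<bar> powr s\<bar> * len e))\<^sup>2"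
    using sob[of "\<lambda>i. \<bar>u i\<bar> powr s"] by (simp add: A_def sq)
  then have "sqrt (A (2 * s)) \<le> sqrt (C * (A s + (\<Sum>e\<in>E. \<bar>\<bar>u (l e)\<bar> powr s - \<bar>u (k e)\<bar> powr s\<bar> * len e))\<^sup>2)"
    by (rule real_sqrt_le_mono)
  also have "\<dots> = sqrt C * (A s + (\<Sum>e\<in>E. \<bar>\<bar>u (l e)\<bar> powr s - \<bar>u (k e)\<bar> powr s\<bar> * len e))"
    using A0 len by (simp add: real_sqrt_mult sum_nonneg)
  finally have S: "sqrt (A (2 * s)) \<le> \<dots>" .
  have N2s: "A (2 * s) powr (1 / (2 * s)) \<le> 2 * s * sqrt C * MM powr ((p - 1) / p - (s - 1) / (2 * s)) * ?R"
  proof (cases "p = 1")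
    case True
    then have s1: "s = 1" using s by auto
    have "\<bar>\<bar>u (l e)\<bar> - \<bar>u (k e)\<bar>\<bar> * len e \<le> len e * dlen e * g e" if e: "e \<in> E" for e
    proof -
      have "\<bar>\<bar>u (l e)\<bar> - \<bar>u (k e)\<bar>\<bar> \<le> g e * dlen e" using grad[OF e] by linarith
      then have "\<bar>\<bar>u (l e)\<bar> - \<bar>u (k e)\<bar>\<bar> * len e \<le> g e * dlen e * len e"
        using len e by (intro mult_right_mono) auto
      then show ?thesis by (simp add: mult_ac)
    qed
    then have "(\<Sum>e\<in>E. \<bar>\<bar>u (l e)\<bar> powr s - \<bar>u (k e)\<bar> powr s\<bar> * len e) \<le> G"
      unfolding G_def s1 True using g by (auto intro!: sum_mono)
    then have "sqrt (A (2 * s)) \<le> sqrt C * (A s + G)"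
      using S C by (smt (verit) mult_left_mono real_sqrt_ge_zero)
    also have "\<dots> \<le> 2 * (sqrt C * (A s + G))" using C A0 G0 by simp
    also have "\<dots> = 2 * s * sqrt C * MM powr ((p - 1) / p - (s - 1) / (2 * s)) * ?R"
    proof -
      have "(1 / \<zeta>) powr ((p - 1) / p) = 1" using \<zeta> True by simp
      then have "?R = A s + G" using A0[of 1] G0 True s1 by simp
      moreover have "MM powr ((p - 1) / p - (s - 1) / (2 * s)) = 1"
        using M s1 True by (simp add: MM_def)
      ultimately show ?thesis using s1 by simp
    qed
    moreover have "A (2 * s) powr (1 / (2 * s)) = sqrt (A (2 * s))"
      using A0 s1 by (simp add: powr_half_sqrt)
    ultimately show ?thesis by simp
  next
    case False
    then have p1: "1 < p" and s1: "1 < s" using p s by auto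
    \<comment> \<open>\<open>p'\<close> is conjugate to \<open>p\<close>, and the power \<open>s - 1\<close> of \<open>u\<close> has to be measured in the norm with exponent \<open>p'\<close>.\<close>
    define p' where "p' = p / (p - 1)"
    have pp: "p' > 1" "p > 1" "1 / p + 1 / p' = 1" "1 / p' = (p - 1) / p"
      using p1 by (auto simp: p'_def field_simps)
    define t where "t = (s - 1) * p'"
    have t: "0 < t" "t \<le> 2 * s" "t / p' = s - 1" "t * ((p - 1) / p) = s - 1"
      using p1 s1 s(2) pp(1) by (auto simp: t_def p'_def field_simps)
    have pt: "(x powr (s - 1)) powr p' = x powr t" for x :: real by (simp add: powr_powr t_def)
    let ?T = "A t powr (1 / p')"
    have As: "A s \<le> A p powr (1 / p) * ?T"
    proof -
      have "A s = (\<Sum>i\<in>I. m i * \<bar>u i\<bar> * \<bar>u i\<bar> powr (s - 1))"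
        unfolding A_def
      proof (intro sum.cong refl)
        fix i show "m i * \<bar>u i\<bar> powr s = m i * \<bar>u i\<bar> * \<bar>u i\<bar> powr (s - 1)"
          using powr_add[of "\<bar>u i\<bar>" 1 "s - 1"] by simp
      qed
      also have "\<dots> \<le> (\<Sum>i\<in>I. m i * \<bar>u i\<bar> powr p) powr (1 / p) * (\<Sum>i\<in>I. m i * (\<bar>u i\<bar> powr (s - 1)) powr p') powr (1 / p')"
        by (rule weighted_Hoelder_sum[OF pp(2,1,3) m]) auto
      finally show ?thesis by (simp add: pt A_def)
    qed
    have one: "(\<Sum>e\<in>E. len e * dlen e * g e * \<bar>u (j e)\<bar> powr (s - 1)) \<le> G powr (1 / p) * (?z * ?T)"
      if j: "j = k \<or> j = l" for j
    proof -
      have "(\<Sum>e\<in>E. len e * dlen e * g e * \<bar>u (j e)\<bar> powr (s - 1))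
          \<le> G powr (1 / p) * (\<Sum>e\<in>E. len e * dlen e * (\<bar>u (j e)\<bar> powr (s - 1)) powr p') powr (1 / p')"
        unfolding G_def by (rule weighted_Hoelder_sum[OF pp(2,1,3)]) (use len g in auto)
      also have "(\<Sum>e\<in>E. len e * dlen e * (\<bar>u (j e)\<bar> powr (s - 1)) powr p') \<le> A t / \<zeta>"
        unfolding pt A_def
        by (rule sum_edges_le_sum_cells[OF fin(2,1), of j _ "\<lambda>i. \<bar>u i\<bar> powr t" P m \<zeta>])
          (use j kl len R2 P in auto)
      then have "(\<Sum>e\<in>E. len e * dlen e * (\<bar>u (j e)\<bar> powr (s - 1)) powr p') powr (1 / p') \<le> (A t / \<zeta>) powr (1 / p')"
        using len pp by (intro powr_mono2) (auto intro!: sum_nonneg)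
      also have "(A t / \<zeta>) powr (1 / p') = ?z * ?T"
        using \<zeta> A0[of t] by (simp add: powr_divide pp(4))
      finally show ?thesis by (simp add: mult_left_mono)
    qed
    have "(\<Sum>e\<in>E. \<bar>\<bar>u (l e)\<bar> powr s - \<bar>u (k e)\<bar> powr s\<bar> * len e)
        \<le> (\<Sum>e\<in>E. s * (len e * dlen e * g e * \<bar>u (l e)\<bar> powr (s - 1)) + s * (len e * dlen e * g e * \<bar>u (k e)\<bar> powr (s - 1)))"
    proof (rule sum_mono)
      fix e assume e: "e \<in> E"
      have "\<bar>\<bar>u (l e)\<bar> powr s - \<bar>u (k e)\<bar> powr s\<bar>
          \<le> s * (\<bar>u (l e)\<bar> powr (s - 1) + \<bar>u (k e)\<bar> powr (s - 1)) * \<bar>\<bar>u (l e)\<bar> - \<bar>u (k e)\<bar>\<bar>"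
        by (rule powr_diff_le) (use s in auto)
      also have "\<dots> \<le> s * (\<bar>u (l e)\<bar> powr (s - 1) + \<bar>u (k e)\<bar> powr (s - 1)) * (g e * dlen e)"
      proof (rule mult_left_mono)
        show "\<bar>\<bar>u (l e)\<bar> - \<bar>u (k e)\<bar>\<bar> \<le> g e * dlen e" using grad[OF e] by linarith
      qed (use s in auto)
      finally have "\<bar>\<bar>u (l e)\<bar> powr s - \<bar>u (k e)\<bar> powr s\<bar> * len e
          \<le> s * (\<bar>u (l e)\<bar> powr (s - 1) + \<bar>u (k e)\<bar> powr (s - 1)) * (g e * dlen e) * len e"
        using len e by (intro mult_right_mono) auto
      then show "\<bar>\<bar>u (l e)\<bar> powr s - \<bar>u (k e)\<bar> powr s\<bar> * len e
          \<le> s * (len e * dlen e * g e * \<bar>u (l e)\<bar> powr (s - 1)) + s * (len e * dlen e * g e * \<bar>u (k e)\<bar> powr (s - 1))"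
        by (simp add: algebra_simps)
    qed
    also have "\<dots> = s * (\<Sum>e\<in>E. len e * dlen e * g e * \<bar>u (l e)\<bar> powr (s - 1))
        + s * (\<Sum>e\<in>E. len e * dlen e * g e * \<bar>u (k e)\<bar> powr (s - 1))"
      by (simp add: sum.distrib sum_distrib_left)
    also have "\<dots> \<le> s * (G powr (1 / p) * (?z * ?T)) + s * (G powr (1 / p) * (?z * ?T))"
      using s one by (intro add_mono mult_left_mono) auto
    finally have J: "(\<Sum>e\<in>E. \<bar>\<bar>u (l e)\<bar> powr s - \<bar>u (k e)\<bar> powr s\<bar> * len e) \<le> 2 * s * (?z * G powr (1 / p)) * ?T"
      by (simp add: mult_ac)
    have "A s + (\<Sum>e\<in>E. \<bar>\<bar>u (l e)\<bar> powr s - \<bar>u (k e)\<bar> powr s\<bar> * len e)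
        \<le> A p powr (1 / p) * ?T + 2 * s * (?z * G powr (1 / p)) * ?T" using As J by linarith
    also have "\<dots> \<le> 2 * s * (A p powr (1 / p)) * ?T + 2 * s * (?z * G powr (1 / p)) * ?T"
      using s mult_right_mono[of 1 "2 * s" "A p powr (1 / p)"] by (intro add_right_mono mult_right_mono) auto
    also have "\<dots> = 2 * s * ?R * ?T" by (simp add: algebra_simps)
    finally have "sqrt (A (2 * s)) \<le> sqrt C * (2 * s * ?R * ?T)"
      using S C by (smt (verit) mult_left_mono real_sqrt_ge_zero)
    also have "?T \<le> (A (2 * s) powr (t / (2 * s)) * MM powr (1 - t / (2 * s))) powr (1 / p')"
      unfolding A_def MM_def using m M t pp
      by (intro powr_mono2 power_sum_mono_exponent) (auto intro!: sum_nonneg)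
    also have "\<dots> = A (2 * s) powr ((s - 1) / (2 * s)) * MM powr ((p - 1) / p - (s - 1) / (2 * s))"
    proof -
      have "t / (2 * s) * (1 / p') = (s - 1) / (2 * s)" using t(3) by (metis divide_divide_eq_left mult.commute times_divide_eq_left mult_1_right)
      moreover have "(1 - t / (2 * s)) * (1 / p') = (p - 1) / p - (s - 1) / (2 * s)"
        unfolding left_diff_distrib calculation using pp(4) by simp
      ultimately show ?thesis using A0 M by (simp add: powr_mult powr_powr MM_def)
    qed
    finally have Z: "sqrt (A (2 * s)) \<le> sqrt C * (2 * s * ?R * (A (2 * s) powr ((s - 1) / (2 * s)) * MM powr ((p - 1) / p - (s - 1) / (2 * s))))"
      using C R0 s by (simp add: mult_left_mono)
    show ?thesis
    proof (cases "A (2 * s) = 0")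
      case True
      then show ?thesis using C R0 s by simp
    next
      case False
      then have pos: "0 < A (2 * s)" using A0 by (simp add: less_le)
      have "sqrt (A (2 * s)) = A (2 * s) powr (1 / (2 * s)) * A (2 * s) powr ((s - 1) / (2 * s))"
      proof -
        have half: "1 / (2 * s) + (s - 1) / (2 * s) = 1 / 2" using s1 by (simp add: field_simps)
        show ?thesis unfolding powr_add[symmetric] half using pos by (simp add: powr_half_sqrt)
      qed
      moreover define R where "R = ?R"
      ultimately have "A (2 * s) powr (1 / (2 * s)) * A (2 * s) powr ((s - 1) / (2 * s))
        \<le> sqrt C * (2 * s * R * (A (2 * s) powr ((s - 1) / (2 * s)) * MM powr ((p - 1) / p - (s - 1) / (2 * s))))"
        using Z by simp
      also have "\<dots> = (2 * s * sqrt C * MM powr ((p - 1) / p - (s - 1) / (2 * s)) * R) * A (2 * s) powr ((s - 1) / (2 * s))"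
        by (simp only: mult_ac)
      finally show ?thesis using pos unfolding R_def by (simp only: mult_le_cancel_right_pos powr_gt_zero)
    qed
  qed
  have "A q powr (1 / q) \<le> (A (2 * s) powr (q / (2 * s)) * MM powr (1 - q / (2 * s))) powr (1 / q)"
    unfolding A_def MM_def using m M q
    by (intro powr_mono2 power_sum_mono_exponent) (auto intro!: sum_nonneg)
  also have "\<dots> = A (2 * s) powr (1 / (2 * s)) * MM powr (1 / q - 1 / (2 * s))"
  proof -
    have "q / (2 * s) * (1 / q) = 1 / (2 * s)" "(1 - q / (2 * s)) * (1 / q) = 1 / q - 1 / (2 * s)"
      using q by (auto simp: field_simps)
    then show ?thesis using A0 M by (simp add: powr_mult powr_powr MM_def)
  qed
  also have "\<dots> \<le> (2 * s * sqrt C * MM powr ((p - 1) / p - (s - 1) / (2 * s)) * ?R) * MM powr (1 / q - 1 / (2 * s))"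
    by (intro mult_right_mono N2s) simp
  finally show ?thesis by (simp add: A_def G_def mult_ac)
qed

section \<open>Functions that are constant on the cells of a partition\<close>

lemma mem_closure_almost_cover:
  fixes W :: "'k \<Rightarrow> plane set"
  assumes op: "open \<Omega>" and fin: "finite K" and neg: "negligible (\<Omega> - (\<Union>k\<in>K. W k))" and z: "z \<in> \<Omega>"
  obtains k where "k \<in> K" "z \<in> closure (W k)"
proof -
  have "\<exists>k\<in>K. z \<in> closure (W k)"
  proof (rule ccontr)
    assume "\<not> ?thesis"
    then have "z \<in> \<Omega> - (\<Union>k\<in>K. closure (W k))" using z by auto
    moreover have "open (\<Omega> - (\<Union>k\<in>K. closure (W k)))"
      using op fin by (intro open_Diff closed_UN) auto
    moreover have "negligible (\<Omega> - (\<Union>k\<in>K. closure (W k)))"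
      by (rule negligible_subset[OF neg]) (use closure_subset in blast)
    ultimately show False using open_not_negligible by blast
  qed
  then show ?thesis using that by blast
qed

definition cellwise :: "'k set \<Rightarrow> ('k \<Rightarrow> plane set) \<Rightarrow> ('k \<Rightarrow> real) \<Rightarrow> plane \<Rightarrow> real" where
  "cellwise K W f x = (\<Sum>k\<in>K. f k * indicat_real (W k) x)"

lemma cellwise_eq:
  assumes "finite K" "disjoint_family_on W K" "k \<in> K" "x \<in> W k"
  shows "cellwise K W f x = f k"
proof -
  have "cellwise K W f x = (\<Sum>j\<in>K. if j = k then f k else 0)"
    unfolding cellwise_def
  proof (rule sum.cong[OF refl])
    fix j assume "j \<in> K"
    then show "f j * indicat_real (W j) x = (if j = k then f k else 0)"
      using assms by (cases "j = k") (auto simp: disjoint_family_on_def indicator_def)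
  qed
  then show ?thesis using assms by simp
qed

lemma cellwise_outside: "(\<And>k. k \<in> K \<Longrightarrow> x \<notin> W k) \<Longrightarrow> cellwise K W f x = 0"
  by (simp add: cellwise_def)

lemma cellwise_compose:
  assumes "finite K" "disjoint_family_on W K" "F 0 = 0"
  shows "F (cellwise K W f x) = cellwise K W (\<lambda>k. F (f k)) x"
proof (cases "\<exists>k\<in>K. x \<in> W k")
  case True
  then obtain k where "k \<in> K" "x \<in> W k" by blast
  then show ?thesis using assms by (simp add: cellwise_eq)
next
  case False
  then show ?thesis using assms by (simp add: cellwise_outside)
qed

text \<open>What the primal and the dual mesh have in common. The family \<open>W\<close> gives the cells as sets: primal cells are
indexed by themselves, dual cells by their vertices.\<close>

locale polygonal_partition =
  fixes \<Omega> :: "plane set" and K :: "'k set" and W :: "'k \<Rightarrow> plane set" and E :: "'k \<Rightarrow> plane set set"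
  assumes \<Omega>: "open \<Omega>" "bounded \<Omega>" "\<Omega> \<noteq> {}"
    and fin: "finite K" and dis: "disjoint_family_on W K"
    and poly: "\<And>k. k \<in> K \<Longrightarrow> open_polygon (W k) (E k)" and sub: "\<And>k. k \<in> K \<Longrightarrow> W k \<subseteq> \<Omega>"
    and cover: "negligible (\<Omega> - (\<Union>k\<in>K. W k))"
begin

lemma W_open: "k \<in> K \<Longrightarrow> open (W k)"
  using open_polygon_frontier(2)[OF poly] .

lemma W_bounded: "k \<in> K \<Longrightarrow> bounded (W k)"
  using open_polygon_frontier(3)[OF poly] .

lemma W_lmeasurable: "k \<in> K \<Longrightarrow> W k \<in> lmeasurable"
  by (simp add: W_open W_bounded lmeasurable_open)

lemma emeasure_W: "k \<in> K \<Longrightarrow> emeasure lborel (W k) = ennreal (measure lebesgue (W k))"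
  using emeasure_eq_measure2[OF W_lmeasurable, of k] W_open[of k] by simp

lemma sum_measure_W: "(\<Sum>k\<in>K. measure lebesgue (W k)) = measure lebesgue \<Omega>"
proof -
  have "(\<Sum>k\<in>K. measure lebesgue (W k)) = measure lebesgue (\<Union>k\<in>K. W k)"
    using fin dis W_lmeasurable emeasure_eq_measure2[OF W_lmeasurable]
    by (intro measure_finite_Union[symmetric]) (auto simp: fmeasurableD simp del: emeasure_completion)
  also have "\<dots> = measure lebesgue \<Omega>"
  proof (rule measure_negligible_symdiff)
    show "\<Omega> \<in> lmeasurable" using \<Omega> by (simp add: lmeasurable_open)
    have "\<Omega> - (\<Union>k\<in>K. W k) \<union> ((\<Union>k\<in>K. W k) - \<Omega>) = \<Omega> - (\<Union>k\<in>K. W k)" using sub by auto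
    then show "negligible (\<Omega> - (\<Union>k\<in>K. W k) \<union> ((\<Union>k\<in>K. W k) - \<Omega>))" using cover by simp
  qed
  finally show ?thesis .
qed

lemma measure_\<Omega>_pos: "0 < measure lebesgue \<Omega>"
  using \<Omega> open_not_negligible[of \<Omega>] negligible_iff_measure0[of \<Omega>]
  by (simp add: lmeasurable_open less_le)

lemma nn_integral_cellwise:
  assumes "\<And>k. k \<in> K \<Longrightarrow> 0 \<le> f k"
  shows "(\<integral>\<^sup>+x. ennreal (cellwise K W f x) * indicator \<Omega> x \<partial>lborel) = ennreal (\<Sum>k\<in>K. measure lebesgue (W k) * f k)"
proof -
  have "ennreal (cellwise K W f x) * indicator \<Omega> x = (\<Sum>k\<in>K. ennreal (f k) * indicator (W k) x)" for x
  proof -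
    have "ennreal (cellwise K W f x) = (\<Sum>k\<in>K. ennreal (f k * indicator (W k) x))"
      unfolding cellwise_def using assms by (subst sum_ennreal) auto
    also have "\<dots> = (\<Sum>k\<in>K. ennreal (f k) * indicator (W k) x)"
      using assms by (intro sum.cong) (auto simp: indicator_def)
    finally have eq: "ennreal (cellwise K W f x) = (\<Sum>k\<in>K. ennreal (f k) * indicator (W k) x)" .
    show ?thesis
    proof (cases "x \<in> \<Omega>")
      case False
      then have "indicator (W k) x = (0 :: ennreal)" if "k \<in> K" for k
        using sub[OF that] by (auto simp: indicator_def)
      then show ?thesis using False by simp
    qed (simp add: eq)
  qed
  then have "(\<integral>\<^sup>+x. ennreal (cellwise K W f x) * indicator \<Omega> x \<partial>lborel) = (\<Sum>k\<in>K. ennreal (f k) * emeasure lborel (W k))"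
    using W_open by (simp add: nn_integral_sum nn_integral_cmult_indicator)
  also have "\<dots> = (\<Sum>k\<in>K. ennreal (measure lebesgue (W k) * f k))"
    using assms by (intro sum.cong) (auto simp: emeasure_W ennreal_mult mult.commute)
  also have "\<dots> = ennreal (\<Sum>k\<in>K. measure lebesgue (W k) * f k)"
    using assms by (subst sum_ennreal) auto
  finally show ?thesis .
qed

lemma Lp_norm_cellwise:
  assumes "0 < r"
  shows "Lp_norm \<Omega> r (cellwise K W f) = (\<Sum>k\<in>K. measure lebesgue (W k) * \<bar>f k\<bar> powr r) powr (1 / r)"
proof -
  have eq: "\<bar>cellwise K W f x\<bar> powr r = cellwise K W (\<lambda>k. \<bar>f k\<bar> powr r) x" for x
    using cellwise_compose[OF fin dis, of "\<lambda>y. \<bar>y\<bar> powr r"] by simp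
  have "(LINT x:\<Omega>|lebesgue. \<bar>cellwise K W f x\<bar> powr r)
      = (LINT x|lebesgue. (\<Sum>k\<in>K. \<bar>f k\<bar> powr r * indicat_real (W k) x))"
    unfolding set_lebesgue_integral_def
  proof (intro Bochner_Integration.integral_cong refl)
    fix x
    show "indicat_real \<Omega> x *\<^sub>R \<bar>cellwise K W f x\<bar> powr r = (\<Sum>k\<in>K. \<bar>f k\<bar> powr r * indicat_real (W k) x)"
    proof (cases "x \<in> \<Omega>")
      case True
      then show ?thesis using eq by (simp add: cellwise_def)
    next
      case False
      then have "indicat_real (W k) x = 0" if "k \<in> K" for k
        using sub[OF that] by (auto simp: indicator_def)
      then show ?thesis using False by simp
    qed
  qed
  also have "\<dots> = (\<Sum>k\<in>K. LINT x|lebesgue. \<bar>f k\<bar> powr r * indicat_real (W k) x)"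
    using W_lmeasurable
    by (intro Bochner_Integration.integral_sum integrable_mult_right integrable_real_indicator)
      (auto simp: fmeasurable_def simp del: emeasure_completion)
  also have "\<dots> = (\<Sum>k\<in>K. measure lebesgue (W k) * \<bar>f k\<bar> powr r)"
    using W_lmeasurable by (intro sum.cong) (auto simp: fmeasurable_def)
  finally show ?thesis by (simp add: Lp_norm_def)
qed

text \<open>Inside the domain and off the endpoints, exactly two cells are adjacent at a point of an
  edge, and they are the two that the edge is labelled with.\<close>

lemma steps_bounded_cellwise:
  fixes p q :: "'e \<Rightarrow> plane" and kk ll :: "'e \<Rightarrow> 'k"
  assumes I: "finite I"
    and kl: "\<And>i. i \<in> I \<Longrightarrow> kk i \<in> K \<and> ll i \<in> K \<and> kk i \<noteq> ll i"
    and edge: "\<And>i. i \<in> I \<Longrightarrow> closed_segment (p i) (q i) \<in> E (kk i) \<inter> E (ll i)"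
    and V: "\<And>i. i \<in> I \<Longrightarrow> p i \<in> V \<and> q i \<in> V"
    and labelled: "\<And>k s z. k \<in> K \<Longrightarrow> s \<in> E k \<Longrightarrow> z \<in> s \<Longrightarrow> z \<in> \<Omega> \<Longrightarrow> \<exists>i\<in>I. z \<in> closed_segment (p i) (q i)"
  shows "steps_bounded \<Omega> V I (\<lambda>i. closed_segment (p i) (q i)) (\<lambda>i. \<bar>f (ll i) - f (kk i)\<bar>) (cellwise K W f)"
  unfolding steps_bounded_def
proof
  fix z assume z: "z \<in> \<Omega> - V"
  let ?S = "\<lambda>i. closed_segment (p i) (q i)"
  let ?J = "\<Sum>i | i \<in> I \<and> z \<in> ?S i. \<bar>f (ll i) - f (kk i)\<bar>"
  show "\<exists>\<epsilon>>0. \<forall>x\<in>ball z \<epsilon> - (\<Union>i\<in>I. ?S i). \<forall>y\<in>ball z \<epsilon> - (\<Union>i\<in>I. ?S i). \<bar>cellwise K W f x - cellwise K W f y\<bar> \<le> ?J"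
  proof (cases "\<exists>k\<in>K. z \<in> W k")
    case True
    then obtain k where k: "k \<in> K" "z \<in> W k" by blast
    then obtain \<epsilon> where e: "\<epsilon> > 0" "ball z \<epsilon> \<subseteq> W k" using W_open openE by metis
    have "cellwise K W f x = f k" if "x \<in> ball z \<epsilon>" for x
      using cellwise_eq[OF fin dis k(1)] that e(2) by blast
    then show ?thesis using e(1) by (intro exI[of _ \<epsilon>]) (simp add: sum_nonneg)
  next
    case False
    obtain k where k: "k \<in> K" "z \<in> closure (W k)"
      using mem_closure_almost_cover[OF \<Omega>(1) fin cover, of z] z by blast
    with False have "z \<in> frontier (W k)" using W_open by (auto simp: frontier_def interior_open)
    then obtain s where "s \<in> E k" "z \<in> s" using open_polygon_frontier(4)[OF poly[OF k(1)]] by auto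
    then obtain i where i: "i \<in> I" "z \<in> ?S i" using labelled[OF k(1)] z by blast
    then have zo: "z \<in> open_segment (p i) (q i)" using z V[OF i(1)] by (auto simp: open_segment_def)
    note ki = kl[OF i(1)]
    have "W (kk i) \<inter> W (ll i) = {}" using dis ki by (auto simp: disjoint_family_on_def)
    then obtain \<epsilon> where e: "\<epsilon> > 0" "ball z \<epsilon> \<subseteq> W (kk i) \<union> W (ll i) \<union> ?S i"
      using polygons_sharing_edge_cover[OF poly poly, of "kk i" "ll i"] ki edge[OF i(1)] zo by blast
    have val: "cellwise K W f x = f (kk i) \<or> cellwise K W f x = f (ll i)"
      if "x \<in> ball z \<epsilon> - (\<Union>i\<in>I. ?S i)" for x
      using that e(2) i(1) ki cellwise_eq[OF fin dis] by blast
    have "\<bar>f (ll i) - f (kk i)\<bar> \<le> ?J"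
      using I i by (intro member_le_sum[of i _ "\<lambda>i. \<bar>f (ll i) - f (kk i)\<bar>"]) auto
    then have "\<bar>cellwise K W f x - cellwise K W f y\<bar> \<le> ?J"
      if "x \<in> ball z \<epsilon> - (\<Union>i\<in>I. ?S i)" "y \<in> ball z \<epsilon> - (\<Union>i\<in>I. ?S i)" for x y
      using val[OF that(1)] val[OF that(2)] by (elim disjE) simp_all
    then show ?thesis using e(1) by blast
  qed
qed

lemma cellwise_sobolev:
  fixes p q :: "plane set \<Rightarrow> plane" and kk ll :: "plane set \<Rightarrow> 'k"
  assumes C: "sobolev_constant \<Omega> C" "0 \<le> C"
    and I: "finite I"
    and kl: "\<And>i. i \<in> I \<Longrightarrow> kk i \<in> K \<and> ll i \<in> K \<and> kk i \<noteq> ll i"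
    and edge: "\<And>i. i \<in> I \<Longrightarrow> closed_segment (p i) (q i) \<in> E (kk i) \<inter> E (ll i)"
    and labelled: "\<And>k s z. k \<in> K \<Longrightarrow> s \<in> E k \<Longrightarrow> z \<in> s \<Longrightarrow> z \<in> \<Omega> \<Longrightarrow> \<exists>i\<in>I. z \<in> closed_segment (p i) (q i)"
    and f: "\<And>k. 0 \<le> f k"
  shows "(\<Sum>k\<in>K. measure lebesgue (W k) * (f k)\<^sup>2)
    \<le> C * ((\<Sum>k\<in>K. measure lebesgue (W k) * f k) + (\<Sum>i\<in>I. \<bar>f (ll i) - f (kk i)\<bar> * dist (p i) (q i)))\<^sup>2"
proof -
  let ?w = "cellwise K W f" and ?V = "p ` I \<union> q ` I"
  let ?Y = "\<Sum>k\<in>K. measure lebesgue (W k) * f k" and ?Z = "\<Sum>i\<in>I. \<bar>f (ll i) - f (kk i)\<bar> * dist (p i) (q i)"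
  have st: "steps_bounded \<Omega> ?V I (\<lambda>i. closed_segment (p i) (q i)) (\<lambda>i. \<bar>f (ll i) - f (kk i)\<bar>) ?w"
    by (rule steps_bounded_cellwise[OF I kl edge _ labelled]) auto
  have w: "?w \<in> borel_measurable borel"
    unfolding cellwise_def[abs_def] using W_open
    by (intro borel_measurable_sum borel_measurable_times borel_measurable_const borel_measurable_indicator) auto
  have w0: "0 \<le> ?w x" for x unfolding cellwise_def using f by (auto intro!: sum_nonneg)
  have Y0: "0 \<le> ?Y" using f by (auto intro!: sum_nonneg)
  have Z0: "0 \<le> ?Z" by (auto intro!: sum_nonneg)
  have "ennreal (\<Sum>k\<in>K. measure lebesgue (W k) * (f k)\<^sup>2) = (\<integral>\<^sup>+x. ennreal ((?w x)\<^sup>2) * indicator \<Omega> x \<partial>lborel)"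
    using cellwise_compose[OF fin dis, of "\<lambda>y. y\<^sup>2"] by (simp add: nn_integral_cellwise)
  also have "\<dots> \<le> ennreal C * ((\<integral>\<^sup>+x. ennreal (?w x) * indicator \<Omega> x \<partial>lborel)
      + (\<Sum>i\<in>I. ennreal (\<bar>f (ll i) - f (kk i)\<bar> * dist (p i) (q i))))\<^sup>2"
    using C(1)[unfolded sobolev_constant_def, rule_format, OF I _ _ w0 w st] I by auto
  also have "(\<integral>\<^sup>+x. ennreal (?w x) * indicator \<Omega> x \<partial>lborel) = ennreal ?Y"
    using f by (simp add: nn_integral_cellwise)
  also have "(\<Sum>i\<in>I. ennreal (\<bar>f (ll i) - f (kk i)\<bar> * dist (p i) (q i))) = ennreal ?Z"
    by (subst sum_ennreal) auto
  also have "ennreal C * (ennreal ?Y + ennreal ?Z)\<^sup>2 = ennreal (C * (?Y + ?Z)\<^sup>2)"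
    using C(2) Y0 Z0 by (simp add: ennreal_mult flip: ennreal_power)
  finally show ?thesis using C(2) by (subst (asm) ennreal_le_iff) auto
qed

end

section \<open>The primal and the dual mesh\<close>

locale ddfv_mesh_on =
  fixes \<Omega> :: "plane set" and T :: ddfv
  assumes mesh: "ddfv_mesh \<Omega> T" and \<Omega>: "open \<Omega>" "bounded \<Omega>" "\<Omega> \<noteq> {}"
begin

lemma cell_facts:
  assumes "K \<in> cells T"
  shows "K \<subseteq> \<Omega>" "open_polygon K (cell_edges T K)" "center T K \<in> K"
  using mesh assms unfolding ddfv_mesh_def by blast+

lemma edge_facts:
  assumes "\<sigma> \<in> edges T"
  shows "vertK T \<sigma> \<noteq> vertL T \<sigma>" "\<sigma> = closed_segment (vertK T \<sigma>) (vertL T \<sigma>)"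
    "cellK T \<sigma> \<in> cells T" "\<sigma> \<in> cell_edges T (cellK T \<sigma>)"
    and edge_labelled: "if \<sigma> \<in> boundary_edges \<Omega> T then cellL T \<sigma> = \<sigma> \<and> center T \<sigma> \<in> \<sigma>
         else cellL T \<sigma> \<in> cells T \<and> cellL T \<sigma> \<noteq> cellK T \<sigma> \<and> \<sigma> \<subseteq> frontier (cellL T \<sigma>)"
  using mesh assms unfolding ddfv_mesh_def cell_edges_def by blast+

lemma boundary_edge_facts:
  assumes "\<sigma> \<in> boundary_edges \<Omega> T"
  shows "cellL T \<sigma> = \<sigma>" "center T \<sigma> \<in> \<sigma>" "\<sigma> \<subseteq> frontier \<Omega>" "\<sigma> \<in> edges T"
proof -
  show "\<sigma> \<in> edges T" "\<sigma> \<subseteq> frontier \<Omega>" using assms by (auto simp: boundary_edges_def)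
  then show "cellL T \<sigma> = \<sigma>" "center T \<sigma> \<in> \<sigma>" using edge_labelled[of \<sigma>] assms by auto
qed

lemma interior_edge_facts:
  assumes "\<sigma> \<in> edges T - boundary_edges \<Omega> T"
  shows "cellL T \<sigma> \<in> cells T" "cellL T \<sigma> \<noteq> cellK T \<sigma>" "\<sigma> \<in> cell_edges T (cellL T \<sigma>)"
  using edge_labelled[of \<sigma>] assms by (auto simp: cell_edges_def)

lemma dual_cell_facts:
  assumes "v \<in> vertices T"
  shows "dual_cell \<Omega> T v \<subseteq> \<Omega>" "open_polygon (dual_cell \<Omega> T v) (dual_cell_edges \<Omega> T v)"
    "star_shaped_wrt (dual_cell \<Omega> T v) v"
  using mesh assms unfolding ddfv_mesh_def by blast+

lemma finite_cells: "finite (cells T)" and finite_edges: "finite (edges T)"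
  using mesh unfolding ddfv_mesh_def by blast+

lemma finite_vertices: "finite (vertices T)"
  using finite_edges unfolding vertices_def by simp

lemma cells_disjoint: "pairwise disjnt (cells T)"
  and cells_cover: "negligible (\<Omega> - \<Union>(cells T))"
  and dual_cells_disjoint: "disjoint_family_on (dual_cell \<Omega> T) (vertices T)"
  and dual_cells_cover: "negligible (\<Omega> - (\<Union>v\<in>vertices T. dual_cell \<Omega> T v))"
  using mesh unfolding ddfv_mesh_def by blast+

lemma vert_in_vertices:
  "\<sigma> \<in> edges T \<Longrightarrow> vertK T \<sigma> \<in> vertices T \<and> vertL T \<sigma> \<in> vertices T"
  by (auto simp: vertices_def)

lemma dual_edge_in:
  "\<sigma> \<in> edges T \<Longrightarrow> dual_edge T \<sigma> \<in> dual_cell_edges \<Omega> T (vertK T \<sigma>) \<inter> dual_cell_edges \<Omega> T (vertL T \<sigma>)"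
  by (auto simp: dual_cell_edges_def)

lemma off_boundary: "z \<in> \<Omega> \<Longrightarrow> z \<notin> frontier \<Omega>"
  using \<Omega>(1) by (simp add: frontier_def interior_open)

lemma centers_ne:
  assumes \<sigma>: "\<sigma> \<in> edges T"
  shows "center T (cellK T \<sigma>) \<noteq> center T (cellL T \<sigma>)"
proof (cases "\<sigma> \<in> boundary_edges \<Omega> T")
  case True
  have "center T (cellL T \<sigma>) \<in> frontier \<Omega>" using boundary_edge_facts[OF True] by auto
  moreover have "center T (cellK T \<sigma>) \<in> \<Omega>" using cell_facts[OF edge_facts(3)[OF \<sigma>]] by auto
  ultimately show ?thesis using off_boundary by metis
next
  case False
  then have \<sigma>': "\<sigma> \<in> edges T - boundary_edges \<Omega> T" using \<sigma> by blast
  have "cellK T \<sigma> \<inter> cellL T \<sigma> = {}"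
    using cells_disjoint edge_facts(3)[OF \<sigma>] interior_edge_facts(1,2)[OF \<sigma>']
    unfolding pairwise_def disjnt_def by metis
  then show ?thesis
    using cell_facts(3)[OF edge_facts(3)[OF \<sigma>]] cell_facts(3)[OF interior_edge_facts(1)[OF \<sigma>']] by auto
qed

text \<open>The sides of a boundary dual cell that are not dual edges lie on the boundary of the domain, where
no jump is counted.\<close>

lemma dual_cell_edges_cases:
  assumes "s \<in> dual_cell_edges \<Omega> T v"
  obtains \<sigma> where "\<sigma> \<in> edges T" "v \<in> {vertK T \<sigma>, vertL T \<sigma>}" "s = dual_edge T \<sigma>"
  | \<sigma> where "\<sigma> \<in> boundary_edges \<Omega> T" "s = closed_segment v (center T \<sigma>)" "s \<subseteq> frontier \<Omega>"
proof -
  consider (dual) \<sigma> where "\<sigma> \<in> edges T" "v \<in> {vertK T \<sigma>, vertL T \<sigma>}" "s = dual_edge T \<sigma>"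
    | (bd) \<sigma> where "\<sigma> \<in> boundary_edges \<Omega> T" "v \<in> {vertK T \<sigma>, vertL T \<sigma>}" "s = closed_segment v (center T \<sigma>)"
    using assms unfolding dual_cell_edges_def by blast
  then show ?thesis
  proof cases
    case dual
    then show ?thesis using that(1) by blast
  next
    case bd
    note b = boundary_edge_facts[OF bd(1)]
    have eq: "\<sigma> = closed_segment (vertK T \<sigma>) (vertL T \<sigma>)" using edge_facts(2)[OF b(4)] .
    have "v \<in> \<sigma>" using bd(2) by (subst eq) auto
    moreover have "convex \<sigma>" by (subst eq) simp
    ultimately have "s \<subseteq> \<sigma>" unfolding bd(3) using b(2) by (simp add: closed_segment_subset)
    then show ?thesis using that(2)[OF bd(1,3)] b(3) by blast
  qed
qed

sublocale primal: polygonal_partition \<Omega> "cells T" "\<lambda>K. K" "cell_edges T"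
proof
  show "disjoint_family_on (\<lambda>K. K) (cells T)"
    using cells_disjoint unfolding disjoint_family_on_def pairwise_def disjnt_def by blast
  show "negligible (\<Omega> - (\<Union>K\<in>cells T. K))" using cells_cover by simp
qed (fact \<Omega> cell_facts finite_cells)+

sublocale dual: polygonal_partition \<Omega> "vertices T" "dual_cell \<Omega> T" "dual_cell_edges \<Omega> T"
  by unfold_locales (fact \<Omega> dual_cell_facts finite_vertices dual_cells_disjoint dual_cells_cover)+

lemma primal_part_eq: "primal_part T u = cellwise (cells T) (\<lambda>K. K) (fst u)"
  by (simp add: fun_eq_iff primal_part_def cellwise_def)

lemma dual_part_eq: "dual_part \<Omega> T u = cellwise (vertices T) (dual_cell \<Omega> T) (snd u)"
  by (simp add: fun_eq_iff dual_part_def cellwise_def)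

lemma primal_sobolev:
  assumes "sobolev_constant \<Omega> C" "0 \<le> C" "\<And>K. 0 \<le> f K"
  shows "(\<Sum>K\<in>cells T. measure lebesgue K * (f K)\<^sup>2) \<le> C * ((\<Sum>K\<in>cells T. measure lebesgue K * f K)
      + (\<Sum>\<sigma>\<in>edges T - boundary_edges \<Omega> T. \<bar>f (cellL T \<sigma>) - f (cellK T \<sigma>)\<bar> * edge_length T \<sigma>))\<^sup>2"
  unfolding edge_length_def
proof (rule primal.cellwise_sobolev[OF assms(1,2) _ _ _ _ assms(3)])
  show "finite (edges T - boundary_edges \<Omega> T)" using finite_edges by simp
next
  fix \<sigma> assume \<sigma>: "\<sigma> \<in> edges T - boundary_edges \<Omega> T"
  show "cellK T \<sigma> \<in> cells T \<and> cellL T \<sigma> \<in> cells T \<and> cellK T \<sigma> \<noteq> cellL T \<sigma>"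
    using \<sigma> edge_facts(3)[of \<sigma>] interior_edge_facts(1,2)[OF \<sigma>] by auto
  have "\<sigma> \<in> cell_edges T (cellK T \<sigma>) \<inter> cell_edges T (cellL T \<sigma>)"
    using \<sigma> edge_facts(4) interior_edge_facts(3) by auto
  then show "closed_segment (vertK T \<sigma>) (vertL T \<sigma>) \<in> cell_edges T (cellK T \<sigma>) \<inter> cell_edges T (cellL T \<sigma>)"
    using edge_facts(2)[of \<sigma>] \<sigma> by simp
next
  fix K s z assume s: "K \<in> cells T" "s \<in> cell_edges T K" "z \<in> s" "z \<in> \<Omega>"
  then have "s \<in> edges T - boundary_edges \<Omega> T"
    using off_boundary by (auto simp: cell_edges_def boundary_edges_def)
  then show "\<exists>\<sigma>\<in>edges T - boundary_edges \<Omega> T. z \<in> closed_segment (vertK T \<sigma>) (vertL T \<sigma>)"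
    using s(3) edge_facts(2) by blast
qed

lemma dual_sobolev:
  assumes "sobolev_constant \<Omega> C" "0 \<le> C" "\<And>v. 0 \<le> f v"
  shows "(\<Sum>v\<in>vertices T. measure lebesgue (dual_cell \<Omega> T v) * (f v)\<^sup>2)
    \<le> C * ((\<Sum>v\<in>vertices T. measure lebesgue (dual_cell \<Omega> T v) * f v)
      + (\<Sum>\<sigma>\<in>edges T. \<bar>f (vertL T \<sigma>) - f (vertK T \<sigma>)\<bar> * dual_edge_length T \<sigma>))\<^sup>2"
  unfolding dual_edge_length_def
proof (rule dual.cellwise_sobolev[OF assms(1,2) finite_edges _ _ _ assms(3)])
  fix \<sigma> assume \<sigma>: "\<sigma> \<in> edges T"
  show "vertK T \<sigma> \<in> vertices T \<and> vertL T \<sigma> \<in> vertices T \<and> vertK T \<sigma> \<noteq> vertL T \<sigma>"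
    using \<sigma> edge_facts(1) vert_in_vertices by auto
  show "closed_segment (center T (cellK T \<sigma>)) (center T (cellL T \<sigma>))
      \<in> dual_cell_edges \<Omega> T (vertK T \<sigma>) \<inter> dual_cell_edges \<Omega> T (vertL T \<sigma>)"
    using dual_edge_in[OF \<sigma>] by (simp add: dual_edge_def)
next
  fix v s z assume s: "v \<in> vertices T" "s \<in> dual_cell_edges \<Omega> T v" "z \<in> s" "z \<in> \<Omega>"
  show "\<exists>\<sigma>\<in>edges T. z \<in> closed_segment (center T (cellK T \<sigma>)) (center T (cellL T \<sigma>))"
    using s(2)
  proof (cases rule: dual_cell_edges_cases)
    case (1 \<sigma>)
    then show ?thesis using s(3) by (auto simp: dual_edge_def)
  next
    case (2 \<sigma>)
    then show ?thesis using s(3,4) off_boundary by blast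
  qed
qed

text \<open>The components of the discrete gradient along the dual edge and along the edge are the difference
quotients of \<open>u\<close>, up to sign.\<close>

lemma grad_bounds:
  assumes \<sigma>: "\<sigma> \<in> edges T" and sn: "0 < sin (diamond_angle T \<sigma>)"
  shows "\<bar>fst u (cellL T \<sigma>) - fst u (cellK T \<sigma>)\<bar> \<le> norm (discrete_grad \<Omega> T u \<sigma>) * dual_edge_length T \<sigma>"
    and "\<bar>snd u (vertL T \<sigma>) - snd u (vertK T \<sigma>)\<bar> \<le> norm (discrete_grad \<Omega> T u \<sigma>) * edge_length T \<sigma>"
proof -
  let ?d = "center T (cellL T \<sigma>) - center T (cellK T \<sigma>)" and ?e = "vertL T \<sigma> - vertK T \<sigma>"
  let ?n1 = "outward_normal \<sigma> (cellK T \<sigma>)" and ?n2 = "outward_normal (dual_edge T \<sigma>) (dual_cell \<Omega> T (vertK T \<sigma>))"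
  note e = edge_facts[OF \<sigma>]
  have n1: "norm ?n1 = 1" "?n1 \<bullet> ?e = 0"
    using outward_normal_polygon[OF cell_facts(2)[OF e(3)], of "vertK T \<sigma>" "vertL T \<sigma>"] e by auto
  have n2: "norm ?n2 = 1" "?n2 \<bullet> ?d = 0"
    unfolding dual_edge_def
    using outward_normal_polygon[OF dual_cell_facts(2), of "vertK T \<sigma>"
        "center T (cellK T \<sigma>)" "center T (cellL T \<sigma>)"] vert_in_vertices[OF \<sigma>] dual_edge_in[OF \<sigma>] centers_ne[OF \<sigma>]
    by (auto simp: dual_edge_def)
  have ne: "?d \<noteq> 0" "?e \<noteq> 0" using centers_ne[OF \<sigma>] e(1) by auto
  have len: "dual_edge_length T \<sigma> = norm ?d" "edge_length T \<sigma> = norm ?e"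
    by (simp_all add: dual_edge_length_def edge_length_def dist_norm norm_minus_commute)
  show "\<bar>fst u (cellL T \<sigma>) - fst u (cellK T \<sigma>)\<bar> \<le> norm (discrete_grad \<Omega> T u \<sigma>) * dual_edge_length T \<sigma>"
    "\<bar>snd u (vertL T \<sigma>) - snd u (vertK T \<sigma>)\<bar> \<le> norm (discrete_grad \<Omega> T u \<sigma>) * edge_length T \<sigma>"
    using two_directions_gradient[OF n1 n2 ne sn[unfolded diamond_angle_def]]
    unfolding discrete_grad_def diamond_angle_def len by blast+
qed

lemma diamond_area:
  assumes \<sigma>: "\<sigma> \<in> edges T"
  shows "edge_length T \<sigma> * dual_edge_length T \<sigma> * sin (diamond_angle T \<sigma>) \<le> 2 * measure lebesgue (diamond T \<sigma>)"
proof -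
  let ?d = "center T (cellL T \<sigma>) - center T (cellK T \<sigma>)" and ?e = "vertL T \<sigma> - vertK T \<sigma>"
  have ne: "?d \<noteq> 0" "?e \<noteq> 0" using centers_ne[OF \<sigma>] edge_facts(1)[OF \<sigma>] by auto
  have "norm ?d * norm ?e * sin (line_angle ?d ?e) = \<bar>rot ?d \<bullet> ?e\<bar>"
    by (rule sin_line_angle[OF ne])
  also have "\<dots> \<le> 2 * measure lebesgue (diamond T \<sigma>)"
    using quadrilateral_area[OF centers_ne[OF \<sigma>], of "vertL T \<sigma>" "vertK T \<sigma>"] by (simp add: diamond_def)
  finally show ?thesis
    by (simp add: diamond_angle_def dual_edge_length_def edge_length_def dist_norm norm_minus_commute mult_ac)
qed

text \<open>The areas of the triangles that join the vertex of a dual cell to its sides add up to at least the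
area of the cell. The vertices of two adjacent dual cells are on different sides of the dual edge
between them, so the height of the triangle over it is at most the distance of the vertices, which is
the length of the corresponding edge. The triangles over the sides of the other kind are degenerate. So (R2) fails for
large \<open>\<zeta>\<close>.\<close>

lemma regularity_parameter_le:
  assumes R2: "regular_R2 \<Omega> T \<zeta>"
  shows "\<zeta> \<le> 1 / 2"
proof -
  \<comment> \<open>Any dual cell of positive area will do.\<close>
  have "\<exists>v\<in>vertices T. measure lebesgue (dual_cell \<Omega> T v) > 0"
  proof (rule ccontr)
    assume "\<not> ?thesis"
    then have "(\<Sum>v\<in>vertices T. measure lebesgue (dual_cell \<Omega> T v)) = 0"
      by (intro sum.neutral) (auto simp: not_less intro: antisym)
    then show False using dual.sum_measure_W dual.measure_\<Omega>_pos by simp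
  qed
  then obtain v where v: "v \<in> vertices T" and pos: "measure lebesgue (dual_cell \<Omega> T v) > 0" by blast
  let ?V = "dual_cell \<Omega> T v" and ?Ev = "{\<sigma> \<in> edges T. v \<in> {vertK T \<sigma>, vertL T \<sigma>}}"
  let ?tri = "\<lambda>s. measure lebesgue (convex hull (insert v s))"
  let ?a = "\<lambda>\<sigma>. edge_length T \<sigma> * dual_edge_length T \<sigma>"
  have tri: "?tri (dual_edge T \<sigma>) \<le> ?a \<sigma> / 2" if \<sigma>: "\<sigma> \<in> ?Ev" for \<sigma>
  proof -
    let ?x = "center T (cellK T \<sigma>)" and ?y = "center T (cellL T \<sigma>)"
    have s: "\<sigma> \<in> edges T" using \<sigma> by simp
    obtain v' where v': "v' \<in> vertices T" "v' \<noteq> v" "dist v v' = edge_length T \<sigma>"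
      "dual_edge T \<sigma> \<in> dual_cell_edges \<Omega> T v" "dual_edge T \<sigma> \<in> dual_cell_edges \<Omega> T v'"
      using \<sigma> edge_facts(1)[OF s] vert_in_vertices[OF s] dual_edge_in[OF s]
      by (auto simp: edge_length_def dist_commute)
    have "?V \<inter> dual_cell \<Omega> T v' = {}" using dual.dis v v' by (auto simp: disjoint_family_on_def)
    then have "\<bar>rot (?y - ?x) \<bullet> (v - ?x)\<bar> \<le> norm (?y - ?x) * dist v v'"
      using adjacent_centers_distance[OF dual_cell_facts(2)[OF v] dual_cell_facts(2)[OF v'(1)] _ _ _ centers_ne[OF s]
          dual_cell_facts(3)[OF v] dual_cell_facts(3)[OF v'(1)]] v'(4,5) by (simp add: dual_edge_def)
    moreover have "convex hull (insert v (dual_edge T \<sigma>)) = convex hull {?x, ?y, v}"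
      unfolding dual_edge_def convex_hull_insert_segment by (simp add: insert_commute)
    ultimately show ?thesis
      using v'(3) by (simp add: measure_triangle dual_edge_length_def dist_norm norm_minus_commute mult.commute)
  qed
  have flat: "?tri s = 0" if "s \<in> dual_cell_edges \<Omega> T v - dual_edge T ` ?Ev" for s
  proof -
    have "s \<in> dual_cell_edges \<Omega> T v" using that by simp
    then show ?thesis
    proof (cases rule: dual_cell_edges_cases)
      case (1 \<sigma>)
      then show ?thesis using that by auto
    next
      case (2 \<sigma>)
      then show ?thesis unfolding 2(2) convex_hull_insert_segment measure_triangle by (simp add: rot_inner)
    qed
  qed
  have finE: "finite (dual_cell_edges \<Omega> T v)" using open_polygon_frontier(1)[OF dual_cell_facts(2)[OF v]] .
  have sub: "dual_edge T ` ?Ev \<subseteq> dual_cell_edges \<Omega> T v" by (auto simp: dual_cell_edges_def)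
  have a0: "0 \<le> ?a \<sigma>" for \<sigma> by (simp add: edge_length_def dual_edge_length_def)
  have "measure lebesgue ?V \<le> (\<Sum>s\<in>dual_cell_edges \<Omega> T v. ?tri s)"
    by (rule polygon_area_le[OF dual_cell_facts(2)[OF v]])
  also have "\<dots> = (\<Sum>s\<in>dual_edge T ` ?Ev. ?tri s)"
    using flat by (intro sum.mono_neutral_right finE sub) auto
  also have "\<dots> \<le> (\<Sum>\<sigma>\<in>?Ev. ?tri (dual_edge T \<sigma>))"
    using finite_edges sum_image_le[of ?Ev ?tri "dual_edge T"] by simp
  also have "\<dots> \<le> (\<Sum>\<sigma>\<in>?Ev. ?a \<sigma> / 2)" using tri by (rule sum_mono)
  also have "\<dots> \<le> (\<Sum>\<sigma> | \<sigma> \<in> edges T \<and> dual_edge T \<sigma> \<in> dual_cell_edges \<Omega> T v. ?a \<sigma> / 2)"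
    using finite_edges a0 by (intro sum_mono2) (auto simp: dual_cell_edges_def)
  also have "\<dots> = (\<Sum>\<sigma> | \<sigma> \<in> edges T \<and> dual_edge T \<sigma> \<in> dual_cell_edges \<Omega> T v. ?a \<sigma>) / 2"
    by (simp add: sum_divide_distrib)
  also have "\<dots> \<le> measure lebesgue ?V / \<zeta> / 2"
    using R2 v unfolding regular_R2_def by (intro divide_right_mono) auto
  finally have "measure lebesgue ?V * (2 * \<zeta>) \<le> measure lebesgue ?V * 1"
    using R2 by (simp add: regular_R2_def field_simps)
  then show ?thesis using pos by simp
qed

section \<open>The discrete Sobolev inequality\<close>

lemma norm0_eq:
  "norm0 \<Omega> T r u = (1/2 * ((\<Sum>K\<in>cells T. measure lebesgue K * \<bar>fst u K\<bar> powr r) powr (1 / r)) powr r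
     + 1/2 * ((\<Sum>v\<in>vertices T. measure lebesgue (dual_cell \<Omega> T v) * \<bar>snd u v\<bar> powr r) powr (1 / r)) powr r) powr (1 / r)"
  if "0 < r"
  unfolding norm0_def primal_part_eq dual_part_eq using that
  by (simp add: primal.Lp_norm_cellwise dual.Lp_norm_cellwise)

text \<open>Condition (R1) bounds the product of the edge lengths by the area of the diamond. For the primal mesh only
the interior edges are summed.\<close>

lemma gradient_sum_le:
  assumes R1: "regular_R1 T \<alpha>" and p: "1 \<le> p" and E: "E \<subseteq> edges T"
  shows "(\<Sum>\<sigma>\<in>E. edge_length T \<sigma> * dual_edge_length T \<sigma> * norm (discrete_grad \<Omega> T u \<sigma>) powr p) powr (1 / p)
    \<le> 2 / sin \<alpha> powr (1 / p) * seminorm1 \<Omega> T p u"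
proof -
  have sn: "0 < sin \<alpha>" using R1 pi_gt_zero by (auto simp: regular_R1_def intro!: sin_gt_zero)
  let ?N = "\<lambda>\<sigma>. norm (discrete_grad \<Omega> T u \<sigma>) powr p"
  have len0: "0 \<le> edge_length T \<sigma> * dual_edge_length T \<sigma>" for \<sigma>
    by (simp add: edge_length_def dual_edge_length_def)
  have le: "edge_length T \<sigma> * dual_edge_length T \<sigma> \<le> 2 / sin \<alpha> * measure lebesgue (diamond T \<sigma>)"
    if \<sigma>: "\<sigma> \<in> edges T" for \<sigma>
  proof -
    have "sin \<alpha> \<le> sin (diamond_angle T \<sigma>)"
      using R1 \<sigma> sin_line_angle_nonneg by (fastforce simp: regular_R1_def diamond_angle_def)
    then have "edge_length T \<sigma> * dual_edge_length T \<sigma> * sin \<alpha> \<le> 2 * measure lebesgue (diamond T \<sigma>)"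
      using mult_left_mono[OF _ len0] diamond_area[OF \<sigma>] by (meson order_trans)
    then show ?thesis using sn by (simp add: field_simps)
  qed
  have "(\<Sum>\<sigma>\<in>E. edge_length T \<sigma> * dual_edge_length T \<sigma> * ?N \<sigma>)
      \<le> (\<Sum>\<sigma>\<in>edges T. edge_length T \<sigma> * dual_edge_length T \<sigma> * ?N \<sigma>)"
    using E finite_edges len0 by (intro sum_mono2) auto
  also have "\<dots> \<le> (\<Sum>\<sigma>\<in>edges T. 2 / sin \<alpha> * (measure lebesgue (diamond T \<sigma>) * ?N \<sigma>))"
  proof (rule sum_mono)
    fix \<sigma> assume "\<sigma> \<in> edges T"
    then show "edge_length T \<sigma> * dual_edge_length T \<sigma> * ?N \<sigma> \<le> 2 / sin \<alpha> * (measure lebesgue (diamond T \<sigma>) * ?N \<sigma>)"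
      using mult_right_mono[OF le, of \<sigma> "?N \<sigma>"] by (simp add: mult.assoc)
  qed
  also have "\<dots> = 2 / sin \<alpha> * (\<Sum>\<sigma>\<in>edges T. measure lebesgue (diamond T \<sigma>) * ?N \<sigma>)"
    by (simp add: sum_distrib_left)
  finally have "(\<Sum>\<sigma>\<in>E. edge_length T \<sigma> * dual_edge_length T \<sigma> * ?N \<sigma>) powr (1 / p)
      \<le> (2 / sin \<alpha> * (\<Sum>\<sigma>\<in>edges T. measure lebesgue (diamond T \<sigma>) * ?N \<sigma>)) powr (1 / p)"
    using p len0 by (intro powr_mono2) (auto intro!: sum_nonneg)
  also have "\<dots> = 2 powr (1 / p) / sin \<alpha> powr (1 / p) * seminorm1 \<Omega> T p u"
    using sn by (simp add: powr_mult powr_divide sum_nonneg seminorm1_def)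
  also have "\<dots> \<le> 2 / sin \<alpha> powr (1 / p) * seminorm1 \<Omega> T p u"
    using powr_mono[of "1 / p" 1 2] p by (intro mult_right_mono divide_right_mono) (auto simp: seminorm1_def)
  finally show ?thesis .
qed

text \<open>Both parts of \<open>u\<close> satisfy the inequality with the same constant, which depends on \<open>\<Omega>\<close> only through
its area and the constant \<open>C\<close>.\<close>

lemma sobolev_on_mesh:
  assumes C: "sobolev_constant \<Omega> C" "0 \<le> C"
    and R1: "regular_R1 T \<alpha>" and R2: "regular_R2 \<Omega> T \<zeta>"
    and p: "1 \<le> p" and q: "1 \<le> q" "q \<le> 2 * s" and s: "1 \<le> s" "(s - 1) * p \<le> 2 * s * (p - 1)" "p = 1 \<or> s > 1"
  defines "Kc \<equiv> 2 * s * sqrt C * measure lebesgue \<Omega> powr ((p - 1) / p - (s - 1) / (2 * s))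
      * measure lebesgue \<Omega> powr (1 / q - 1 / (2 * s))"
  shows "norm0 \<Omega> T q u \<le> 2 * Kc / (sin \<alpha> powr (1 / p) * \<zeta> powr ((p - 1) / p)) * norm1 \<Omega> T p u"
proof -
  have sn: "0 < sin \<alpha>" using R1 pi_gt_zero by (auto simp: regular_R1_def intro!: sin_gt_zero)
  have z: "0 < \<zeta>" "\<zeta> \<le> 1" using R2 regularity_parameter_le[OF R2] by (auto simp: regular_R2_def)
  have angle: "0 < sin (diamond_angle T \<sigma>)" if "\<sigma> \<in> edges T" for \<sigma>
    using R1 that sn sin_line_angle_nonneg by (fastforce simp: regular_R1_def diamond_angle_def)
  have K0: "0 \<le> Kc" using s C by (simp add: Kc_def)
  have len0: "0 \<le> edge_length T \<sigma>" "0 \<le> dual_edge_length T \<sigma>" for \<sigma>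
    by (simp_all add: edge_length_def dual_edge_length_def)
  define X where "X = (\<lambda>r. (\<Sum>K\<in>cells T. measure lebesgue K * \<bar>fst u K\<bar> powr r) powr (1 / r))"
  define Y where "Y = (\<lambda>r. (\<Sum>v\<in>vertices T. measure lebesgue (dual_cell \<Omega> T v) * \<bar>snd u v\<bar> powr r) powr (1 / r))"
  have XY0: "0 \<le> X r" "0 \<le> Y r" for r by (simp_all add: X_def Y_def)
  have n0: "norm0 \<Omega> T r u = (1/2 * X r powr r + 1/2 * Y r powr r) powr (1 / r)" if "1 \<le> r" for r
    using norm0_eq[of r u] that by (simp add: X_def Y_def)
  let ?g = "\<lambda>\<sigma>. norm (discrete_grad \<Omega> T u \<sigma>)"
  let ?zz = "(1 / \<zeta>) powr ((p - 1) / p)" and ?I = "edges T - boundary_edges \<Omega> T"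
  have R2p: "(\<Sum>\<sigma> | \<sigma> \<in> ?I \<and> \<sigma> \<in> cell_edges T K. edge_length T \<sigma> * dual_edge_length T \<sigma>) \<le> measure lebesgue K / \<zeta>"
    if "K \<in> cells T" for K
  proof -
    have "(\<Sum>\<sigma> | \<sigma> \<in> ?I \<and> \<sigma> \<in> cell_edges T K. edge_length T \<sigma> * dual_edge_length T \<sigma>)
        \<le> (\<Sum>\<sigma>\<in>cell_edges T K. edge_length T \<sigma> * dual_edge_length T \<sigma>)"
      using finite_edges len0 by (intro sum_mono2) (auto simp: cell_edges_def)
    also have "\<dots> \<le> measure lebesgue K / \<zeta>" using R2 that by (auto simp: regular_R2_def)
    finally show ?thesis .
  qed
  have "X q \<le> Kc * (X p + ?zz * (\<Sum>\<sigma>\<in>?I. edge_length T \<sigma> * dual_edge_length T \<sigma> * ?g \<sigma> powr p) powr (1 / p))"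
    unfolding X_def Kc_def primal.sum_measure_W[symmetric]
  proof (rule sobolev_from_power_one[where k = "cellK T" and l = "cellL T" and P = "\<lambda>K \<sigma>. \<sigma> \<in> cell_edges T K"])
    show "\<bar>fst u (cellL T \<sigma>) - fst u (cellK T \<sigma>)\<bar> \<le> ?g \<sigma> * dual_edge_length T \<sigma>" if "\<sigma> \<in> ?I" for \<sigma>
      using grad_bounds(1)[OF _ angle] that by blast
    show "cellK T \<sigma> \<in> cells T \<and> cellL T \<sigma> \<in> cells T" if "\<sigma> \<in> ?I" for \<sigma>
      using that edge_facts(3) interior_edge_facts(1) by blast
    show "\<sigma> \<in> cell_edges T (cellK T \<sigma>) \<and> \<sigma> \<in> cell_edges T (cellL T \<sigma>)" if "\<sigma> \<in> ?I" for \<sigma>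
      using that edge_facts(4) interior_edge_facts(3) by blast
    show "0 < (\<Sum>K\<in>cells T. measure lebesgue K)"
      using primal.sum_measure_W primal.measure_\<Omega>_pos by simp
    show "(\<Sum>K\<in>cells T. measure lebesgue K * (f K)\<^sup>2) \<le> C * ((\<Sum>K\<in>cells T. measure lebesgue K * f K)
      + (\<Sum>\<sigma>\<in>?I. \<bar>f (cellL T \<sigma>) - f (cellK T \<sigma>)\<bar> * edge_length T \<sigma>))\<^sup>2" if "\<And>K. 0 \<le> f K" for f
      by (rule primal_sobolev[OF C that])
  qed (use finite_edges finite_cells len0 C z p q s R2p in auto)
  also have "\<dots> \<le> Kc * (X p + ?zz * (2 / sin \<alpha> powr (1 / p) * seminorm1 \<Omega> T p u))"
    by (intro mult_left_mono add_left_mono gradient_sum_le[OF R1 p] K0) auto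
  finally have Xq: "X q \<le> \<dots>" .
  have R2d: "(\<Sum>\<sigma> | \<sigma> \<in> edges T \<and> dual_edge T \<sigma> \<in> dual_cell_edges \<Omega> T v. dual_edge_length T \<sigma> * edge_length T \<sigma>)
      \<le> measure lebesgue (dual_cell \<Omega> T v) / \<zeta>" if "v \<in> vertices T" for v
    using R2 that by (simp add: regular_R2_def mult.commute)
  have "Y q \<le> Kc * (Y p + ?zz * (\<Sum>\<sigma>\<in>edges T. dual_edge_length T \<sigma> * edge_length T \<sigma> * ?g \<sigma> powr p) powr (1 / p))"
    unfolding Y_def Kc_def dual.sum_measure_W[symmetric]
  proof (rule sobolev_from_power_one[where k = "vertK T" and l = "vertL T"
        and P = "\<lambda>v \<sigma>. dual_edge T \<sigma> \<in> dual_cell_edges \<Omega> T v"])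
    show "\<bar>snd u (vertL T \<sigma>) - snd u (vertK T \<sigma>)\<bar> \<le> ?g \<sigma> * edge_length T \<sigma>" if "\<sigma> \<in> edges T" for \<sigma>
      using grad_bounds(2)[OF _ angle] that by blast
    show "vertK T \<sigma> \<in> vertices T \<and> vertL T \<sigma> \<in> vertices T" if "\<sigma> \<in> edges T" for \<sigma>
      by (rule vert_in_vertices[OF that])
    show "dual_edge T \<sigma> \<in> dual_cell_edges \<Omega> T (vertK T \<sigma>) \<and> dual_edge T \<sigma> \<in> dual_cell_edges \<Omega> T (vertL T \<sigma>)"
      if "\<sigma> \<in> edges T" for \<sigma>
      using dual_edge_in[OF that] by simp
    show "0 < (\<Sum>v\<in>vertices T. measure lebesgue (dual_cell \<Omega> T v))"
      using dual.sum_measure_W dual.measure_\<Omega>_pos by simp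
    show "(\<Sum>v\<in>vertices T. measure lebesgue (dual_cell \<Omega> T v) * (f v)\<^sup>2)
      \<le> C * ((\<Sum>v\<in>vertices T. measure lebesgue (dual_cell \<Omega> T v) * f v)
      + (\<Sum>\<sigma>\<in>edges T. \<bar>f (vertL T \<sigma>) - f (vertK T \<sigma>)\<bar> * dual_edge_length T \<sigma>))\<^sup>2" if "\<And>v. 0 \<le> f v" for f
      by (rule dual_sobolev[OF C that])
  qed (use finite_edges finite_vertices len0 C z p q s R2d in auto)
  also have "\<dots> \<le> Kc * (Y p + ?zz * (2 / sin \<alpha> powr (1 / p) * seminorm1 \<Omega> T p u))"
    using gradient_sum_le[OF R1 p subset_refl, of u]
    by (intro mult_left_mono add_left_mono K0) (auto simp: mult.commute[of "dual_edge_length T _"])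
  finally have Yq: "Y q \<le> \<dots>" .
  let ?c = "1 / (sin \<alpha> powr (1 / p) * \<zeta> powr ((p - 1) / p))"
  \<comment> \<open>The factor in front of the lower order term is at least 1, because \<open>\<zeta>\<close> and the sine are at most 1.\<close>
  have "sin \<alpha> powr (1 / p) \<le> 1" "\<zeta> powr ((p - 1) / p) \<le> 1"
    using sn z p by (auto intro!: powr_le1)
  then have "sin \<alpha> powr (1 / p) * \<zeta> powr ((p - 1) / p) \<le> 1" by (simp add: mult_le_one)
  then have c: "1 \<le> ?c" using sn z by (simp add: le_divide_eq)
  have zc: "?zz * (2 / sin \<alpha> powr (1 / p)) = 2 * ?c"
    using z by (simp add: powr_divide)
  have N0: "0 \<le> norm0 \<Omega> T p u" by (simp add: norm0_def)
  have part: "a \<le> 2 * norm0 \<Omega> T p u" if a: "0 \<le> a" "1/2 * a powr p \<le> 1/2 * X p powr p + 1/2 * Y p powr p" for a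
  proof -
    have "a = (a powr p) powr (1 / p)" using a(1) p by (simp add: powr_powr)
    also have "\<dots> \<le> (2 * (1/2 * X p powr p + 1/2 * Y p powr p)) powr (1 / p)"
      using a p by (intro powr_mono2) auto
    also have "\<dots> = 2 powr (1 / p) * norm0 \<Omega> T p u"
      unfolding n0[OF p] by (rule powr_mult)
    also have "\<dots> \<le> 2 * norm0 \<Omega> T p u"
      using powr_mono[of "1 / p" 1 2] p by (intro mult_right_mono N0) auto
    finally show ?thesis .
  qed
  have bound: "b \<le> 2 * Kc * ?c * norm1 \<Omega> T p u"
    if b: "b \<le> Kc * (a + ?zz * (2 / sin \<alpha> powr (1 / p) * seminorm1 \<Omega> T p u))" and a: "a \<le> 2 * norm0 \<Omega> T p u" for a b
  proof -
    have "a \<le> 2 * ?c * norm0 \<Omega> T p u"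
      using a mult_right_mono[OF c N0] by (simp add: mult.assoc)
    then have "a + ?zz * (2 / sin \<alpha> powr (1 / p) * seminorm1 \<Omega> T p u) \<le> 2 * ?c * norm1 \<Omega> T p u"
      unfolding norm1_def distrib_left mult.assoc[symmetric] zc by simp
    then have "Kc * (a + ?zz * (2 / sin \<alpha> powr (1 / p) * seminorm1 \<Omega> T p u)) \<le> Kc * (2 * ?c * norm1 \<Omega> T p u)"
      using K0 by (rule mult_left_mono)
    with b show ?thesis by (simp add: mult_ac)
  qed
  let ?B = "2 * Kc * ?c * norm1 \<Omega> T p u"
  have XB: "X q \<le> ?B" by (rule bound[OF Xq part]) (use XY0 in auto)
  have YB: "Y q \<le> ?B" by (rule bound[OF Yq part]) (use XY0 in auto)
  have B0: "0 \<le> ?B" using XB XY0(1)[of q] by linarith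
  have "norm0 \<Omega> T q u \<le> (1/2 * ?B powr q + 1/2 * ?B powr q) powr (1 / q)"
    unfolding n0[OF q(1)] using XB YB XY0 q
    by (intro powr_mono2 add_mono mult_left_mono) auto
  also have "\<dots> = (?B powr q) powr (1 / q)" by simp
  also have "\<dots> = ?B"
  proof -
    have "(x powr q) powr (1 / q) = x" if "0 \<le> x" for x :: real
      using that q(1) by (simp add: powr_powr)
    then show ?thesis using B0 by blast
  qed
  finally show ?thesis by simp
qed

end

theorem theorem8:
  fixes \<Omega> :: "plane set" and p q :: real
  assumes "polygonal_domain \<Omega>" and "lipschitz_domain \<Omega>"
    and "(1 \<le> p \<and> p < 2 \<and> 1 \<le> q \<and> q \<le> 2 * p / (2 - p)) \<or> (2 \<le> p \<and> 1 \<le> q)"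
  shows "\<exists>C>0. \<forall>T \<alpha> \<zeta>. ddfv_mesh \<Omega> T \<and> regular_R1 T \<alpha> \<and> regular_R2 \<Omega> T \<zeta> \<longrightarrow>
           (\<forall>u. norm0 \<Omega> T q u \<le> C / (sin \<alpha> powr (1 / p) * \<zeta> powr ((p - 1) / p)) * norm1 \<Omega> T p u)"
proof -
  have \<Omega>: "open \<Omega>" "bounded \<Omega>" "\<Omega> \<noteq> {}" using assms(1) by (auto simp: polygonal_domain_def)
  obtain C where C: "0 < C" "sobolev_constant \<Omega> C"
    using piecewise_constant_sobolev[OF assms(2) \<Omega>(2)] by blast
  have p: "1 \<le> p" and q: "1 \<le> q" using assms(3) by auto
  \<comment> \<open>The power \<open>s\<close> of \<open>u\<close> to which the inequality for the exponent 1 is applied.\<close>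
  have "\<exists>s. 1 \<le> s \<and> q \<le> 2 * s \<and> (s - 1) * p \<le> 2 * s * (p - 1) \<and> (p = 1 \<or> s > 1)"
  proof (cases "p < 2")
    case True
    have "1 \<le> p / (2 - p)" "q \<le> 2 * (p / (2 - p))" "p = 1 \<or> p / (2 - p) > 1"
      using assms(3) True by (auto simp: field_simps)
    moreover have "(p / (2 - p) - 1) * p = 2 * (p / (2 - p)) * (p - 1)"
      using True by (simp add: field_simps)
    ultimately show ?thesis by (intro exI[of _ "p / (2 - p)"]) simp
  next
    case False
    have "(max 2 q - 1) * p \<le> 2 * max 2 q * (p - 1)"
    proof -
      have "(max 2 q - 1) * p \<le> max 2 q * p" using p by (intro mult_right_mono) auto
      also have "\<dots> \<le> max 2 q * (2 * (p - 1))" using False by (intro mult_left_mono) auto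
      also have "\<dots> = 2 * max 2 q * (p - 1)" by simp
      finally show ?thesis .
    qed
    then show ?thesis using q by (intro exI[of _ "max 2 q"]) auto
  qed
  then obtain s where s: "1 \<le> s" "q \<le> 2 * s" "(s - 1) * p \<le> 2 * s * (p - 1)" "p = 1 \<or> s > 1" by blast
  define Kc where "Kc = 2 * s * sqrt C * measure lebesgue \<Omega> powr ((p - 1) / p - (s - 1) / (2 * s))
      * measure lebesgue \<Omega> powr (1 / q - 1 / (2 * s))"
  have "0 < measure lebesgue \<Omega>"
    using \<Omega> open_not_negligible[of \<Omega>] negligible_iff_measure0[of \<Omega>]
    by (simp add: lmeasurable_open less_le)
  then have "0 < Kc" using s C by (simp add: Kc_def)
  moreover have "norm0 \<Omega> T q u \<le> 2 * Kc / (sin \<alpha> powr (1 / p) * \<zeta> powr ((p - 1) / p)) * norm1 \<Omega> T p u"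
    if "ddfv_mesh \<Omega> T" "regular_R1 T \<alpha>" "regular_R2 \<Omega> T \<zeta>" for T \<alpha> \<zeta> u
  proof -
    interpret ddfv_mesh_on \<Omega> T using that(1) \<Omega> by unfold_locales
    show ?thesis unfolding Kc_def
      by (rule sobolev_on_mesh[OF C(2) _ that(2,3) p q s(2,1,3,4)]) (use C in simp)
  qed
  ultimately show ?thesis by (intro exI[of _ "2 * Kc"]) auto
qed

end
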